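(* Let $n\ge2$, let $m,m'\ge0$ and let $s,s'$ be integers with $0\le s\le m$, $0\le s'\le m'$. Let $h_{s,s'}=h_{s,s'}({\bf z}',{\bf w}')$ be a homogeneous $q$-harmonic polynomial of degree $s$ in ${\bf z}'=(z_1,\dots,z_{n-1})$ and of degree $s'$ in ${\bf w}'=(w_1,\dots,w_{n-1})$. Then $z_n^{m-s}w_n^{m'-s'}h_{s,s'}\in\mathcal A_{m,m'}$ and: If $m-s\ge m'-s'$, then $${\sf H}_{m,m'}\bigl(z_n^{m-s}w_n^{m'-s'}h_{s,s'}\bigr)=z_n^{m-s-m'+s'}\,Q^{m'-s'}d^{mm'}_{ss'}\,h_{s,s'},$$ $$d^{mm'}_{ss'}=q^{-2(m-s)(m'-s')}\frac{(q^{-2m'-2s-2n+4};q^2)_{m'-s'}}{(q^{-2m-2m'-2n+4};q^2)_{m'-s'}}\;{}_2\varphi_1\bigl(q^{-2(m'-s')},q^{2(m+s'+n-1)};q^{2(s+s'+n-1)};q^2;\,q^2Q_{n-1}/Q\bigr).$$ If $m-s\le m'-s'$, then $${\sf H}_{m,m'}\bigl(z_n^{m-s}w_n^{m'-s'}h_{s,s'}\bigr)=Q^{m-s}d^{mm'}_{ss'}\,w_n^{m'-s'-m+s}\,h_{s,s'},$$ $$d^{mm'}_{ss'}=q^{-2(m-s)(m'-s')}\frac{(q^{-2m-2s'-2n+4};q^2)_{m-s}}{(q^{-2m-2m'-2n+4};q^2)_{m-s}}\;{}_2\varphi_1\bigl(q^{-2(m-s)},q^{2(m'+s+n-1)};q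^{2(s+s'+n-1)};q^2;\,q^2Q_{n-1}/Q\bigr).$$
   Context: Let $q$ be a nonzero complex number that is not a root of unity. Put $[a]=(q^a-q^{-a})/(q-q^{-1})$, $(a;t)_s=(1-a)(1-at)\cdots(1-at^{s-1})$ and ${}_2\varphi_1(a,b;c;t;x)=\sum_{k\ge0}\frac{(a;t)_k(b;t)_k}{(c;t)_k(t;t)_k}x^k$. $\mathcal A$ is the unital associative $\mathbb C$-algebra generated by $z_1,\dots,z_n,w_1,\dots,w_n$ with relations $z_iz_j=qz_jz_i$ and $w_iw_j=q^{-1}w_jw_i$ for $i<j$; $w_jz_i=qz_iw_j$ for $i\ne j$; $w_kz_k=z_kw_k+(1-q^2)\sum_{s<k}z_sw_s$. Both the monomials $z_1^{r_1}\cdots z_n^{r_n}w_1^{s_1}\cdots w_n^{s_n}$ and the monomials $w_1^{r_1}\cdots w_n^{r_n}z_1^{s_1}\cdots z_n^{s_n}$ form bases of $\mathcal A$. $\mathcal A_{m,m'}$ is the subspace of polynomials homogeneous of degree $m$ in the $z_i$ and of degree $m'$ in the $w_i$ (zero if $m<0$ or $m'<0$). Linear operators $\partial_i,\bar\partial_i$ on $\mathcal A$ are defined on these bases by $\partial_i(z_1^{r_1}\cdots z_n^{r_n}w_1^{s_1}\cdots w_n^{s_n})=q^{r_{i+1}+\cdots+r_n}[r_i]\,z_1^{r_1}\cdots z_i^{r_i-1}\cdots z_n^{r_n}w_1^{s_1}\cdots w_n^{s_n}$ and $\bar\partial_i(w_1^{r_1}\cdots w_n^{r_n}z_1^{s_1}\cdots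 z_n^{s_n})=q^{-(r_{i+1}+\cdots+r_n)}[r_i]\,w_1^{r_1}\cdots w_i^{r_i-1}\cdots w_n^{r_n}z_1^{s_1}\cdots z_n^{s_n}$ (both are $0$ if $r_i=0$). $\Delta_q=\sum_{i=1}^n q^{2(i-1)}\bar\partial_i\partial_i$ $(=\sum_{i=1}^n\partial_i\bar\partial_i)$, and $\mathcal H_{m,m'}=\{p\in\mathcal A_{m,m'}:\Delta_qp=0\}$. $Q=\sum_{i=1}^n z_iw_i$ is central in $\mathcal A$; $Q_{n-1}=\sum_{i=1}^{n-1}z_iw_i$. Expressions such as $Q^{N}\,{}_2\varphi_1(q^{-2N},\dots;q^2;q^2Q_{n-1}/Q)$ denote the polynomials in the commuting elements $Q,Q_{n-1}$ obtained by expanding the terminating series, $Q^N(Q_{n-1}/Q)^k:=Q^{N-k}Q_{n-1}^k$. A polynomial $h$ in $z_1,\dots,z_{n-1},w_1,\dots,w_{n-1}$ is $q$-harmonic (in these variables) if $\sum_{i=1}^{n-1}q^{2(i-1)}\bar\partial_i\partial_i h=0$. ${\sf H}_{m,m'}:\mathcal A_{m,m'}\to\mathcal H_{m,m'}$ is the projector along $Q\mathcal A_{m-1,m'-1}$ in the direct sum decomposition $\mathcal A_{m,m'}=\mathcal H_{m,m'}\oplus Q\mathcal A_{m-1,m'-1}$. *)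

theory Defs
  imports Complex_Main "HOL-Library.Poly_Mapping"
begin

section \<open>Unital associative complex algebras given by generators and relations\<close>

class complex_algebra_1 = ring_1 +
  fixes scaleC :: "complex \<Rightarrow> 'a \<Rightarrow> 'a" (infixr \<open>*\<^sub>C\<close> 75)
  assumes scaleC_add_right: "a *\<^sub>C (x + y) = a *\<^sub>C x + a *\<^sub>C y"
    and scaleC_add_left: "(a + b) *\<^sub>C x = a *\<^sub>C x + b *\<^sub>C x"
    and scaleC_scaleC: "a *\<^sub>C (b *\<^sub>C x) = (a * b) *\<^sub>C x"
    and scaleC_one: "1 *\<^sub>C x = x"
    and mult_scaleC_left: "(a *\<^sub>C x) * y = a *\<^sub>C (x * y)"
    and mult_scaleC_right: "x * (a *\<^sub>C y) = a *\<^sub>C (x * y)"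

global_interpretation complex_vs: vector_space "scaleC :: complex \<Rightarrow> 'a \<Rightarrow> 'a::complex_algebra_1"
  by unfold_locales
    (simp_all add: scaleC_add_right scaleC_add_left scaleC_scaleC scaleC_one)

text \<open>Words form a monoid under concatenation. Hence, by the multiplication of
  \<^theory>\<open>HOL-Library.Poly_Mapping\<close>, the type \<open>'g list \<Rightarrow>\<^sub>0 complex\<close> is the free algebra on \<open>'g\<close>;
  the coefficients are central because \<open>single [] c\<close> commutes with everything.\<close>

instantiation list :: (type) monoid_add
begin
definition zero_list :: "'a list" where "zero_list = []"
definition plus_list :: "'a list \<Rightarrow> 'a list \<Rightarrow> 'a list" where "plus_list = (@)"
instance by standard (simp_all add: zero_list_def plus_list_def)
end

definition free_alg :: "'g set \<Rightarrow> ('g list \<Rightarrow>\<^sub>0 complex) set" where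
  "free_alg G = {p. \<forall>u \<in> Poly_Mapping.keys p. set u \<subseteq> G}"

definition eval_free :: "('g \<Rightarrow> 'a) \<Rightarrow> ('g list \<Rightarrow>\<^sub>0 complex) \<Rightarrow> 'a::complex_algebra_1" where
  "eval_free \<phi> p = (\<Sum>u \<in> Poly_Mapping.keys p. Poly_Mapping.lookup p u *\<^sub>C prod_list (map \<phi> u))"

text \<open>The two-sided ideal of a subring \<open>S\<close> generated by \<open>R\<close>. Below \<open>S\<close> is a free algebra, which
  contains the scalars, so the ideal is closed under scalar multiplication and negation.\<close>

inductive_set two_sided_ideal :: "'b::ring_1 set \<Rightarrow> 'b set \<Rightarrow> 'b set" for S R where
  zero: "0 \<in> two_sided_ideal S R"
| base: "r \<in> R \<Longrightarrow> r \<in> two_sided_ideal S R"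
| add: "x \<in> two_sided_ideal S R \<Longrightarrow> y \<in> two_sided_ideal S R \<Longrightarrow> x + y \<in> two_sided_ideal S R"
| left: "a \<in> S \<Longrightarrow> x \<in> two_sided_ideal S R \<Longrightarrow> a * x \<in> two_sided_ideal S R"
| right: "a \<in> S \<Longrightarrow> x \<in> two_sided_ideal S R \<Longrightarrow> x * a \<in> two_sided_ideal S R"

text \<open>The whole type \<open>'a\<close> is the algebra with generators \<open>\<phi> g\<close>, \<open>g \<in> G\<close>, and relations \<open>R\<close>: evaluation
  is onto and its kernel is the ideal generated by \<open>R\<close>, so it induces an isomorphism from the
  quotient of the free algebra to \<open>'a\<close>.\<close>

definition presented_by ::
    "'g set \<Rightarrow> ('g list \<Rightarrow>\<^sub>0 complex) set \<Rightarrow> ('g \<Rightarrow> 'a::complex_algebra_1) \<Rightarrow> bool" where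
  "presented_by G R \<phi> \<longleftrightarrow>
     eval_free \<phi> ` free_alg G = UNIV \<and>
     {p \<in> free_alg G. eval_free \<phi> p = 0} = two_sided_ideal (free_alg G) R"


section \<open>The algebra of polynomials on the quantum vector space\<close>

datatype gen = Z nat | W nat

definition gens :: "nat \<Rightarrow> gen set" where
  "gens n = Z ` {1..n} \<union> W ` {1..n}"

definition word :: "gen list \<Rightarrow> (gen list \<Rightarrow>\<^sub>0 complex)" where
  "word u = Poly_Mapping.single u 1"

definition const :: "complex \<Rightarrow> (gen list \<Rightarrow>\<^sub>0 complex)" where
  "const c = Poly_Mapping.single [] c"

definition q_relations :: "complex \<Rightarrow> nat \<Rightarrow> (gen list \<Rightarrow>\<^sub>0 complex) set" where
  "q_relations q n =
     {word [Z i, Z j] - const q * word [Z j, Z i] | i j. 1 \<le> i \<and> i < j \<and> j \<le> n} \<union>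
     {word [W i, W j] - const (inverse q) * word [W j, W i] | i j. 1 \<le> i \<and> i < j \<and> j \<le> n} \<union>
     {word [W j, Z i] - const q * word [Z i, W j] | i j. i \<in> {1..n} \<and> j \<in> {1..n} \<and> i \<noteq> j} \<union>
     {word [W k, Z k] - (word [Z k, W k] + const (1 - q\<^sup>2) * (\<Sum>s=1..<k. word [Z s, W s])) | k.
        k \<in> {1..n}}"

definition is_q_algebra ::
    "complex \<Rightarrow> nat \<Rightarrow> (nat \<Rightarrow> 'a) \<Rightarrow> (nat \<Rightarrow> 'a::complex_algebra_1) \<Rightarrow> bool" where
  "is_q_algebra q n z w \<longleftrightarrow> presented_by (gens n) (q_relations q n) (case_gen z w)"

definition ord_mon :: "nat \<Rightarrow> (nat \<Rightarrow> 'a) \<Rightarrow> (nat \<Rightarrow> nat) \<Rightarrow> 'a::monoid_mult" where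
  "ord_mon n x r = prod_list (map (\<lambda>i. x i ^ r i) [1..<Suc n])"

text \<open>Bihomogeneous polynomials of degree \<open>m\<close> in \<open>z\<^sub>1, \<dots>, z\<^sub>k\<close> and \<open>m'\<close> in \<open>w\<^sub>1, \<dots>, w\<^sub>k\<close>. With integer
  degrees this space is \<open>{0}\<close> as soon as one of the degrees is negative.\<close>

definition bihom ::
    "nat \<Rightarrow> (nat \<Rightarrow> 'a) \<Rightarrow> (nat \<Rightarrow> 'a) \<Rightarrow> int \<Rightarrow> int \<Rightarrow> 'a::complex_algebra_1 set" where
  "bihom k z w m m' =
     complex_vs.span {ord_mon k z r * ord_mon k w t | r t.
       int (\<Sum>i=1..k. r i) = m \<and> int (\<Sum>i=1..k. t i) = m'}"


section \<open>The q-derivatives, the q-Laplacian and the harmonic projector\<close>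

definition qnum :: "complex \<Rightarrow> int \<Rightarrow> complex" where
  "qnum q a = (q powi a - q powi (-a)) / (q - inverse q)"

text \<open>The truncated subtraction \<open>r i - 1\<close> is harmless: for \<open>r i = 0\<close> the coefficient is \<open>qnum q 0 = 0\<close>.
  The descriptions are unique because the ordered monomials (of either kind) form a basis.\<close>

definition dz ::
    "complex \<Rightarrow> nat \<Rightarrow> (nat \<Rightarrow> 'a) \<Rightarrow> (nat \<Rightarrow> 'a) \<Rightarrow> nat \<Rightarrow> 'a::complex_algebra_1 \<Rightarrow> 'a" where
  "dz q n z w i = (THE D. Vector_Spaces.linear scaleC scaleC D \<and>
     (\<forall>r t. D (ord_mon n z r * ord_mon n w t) =
       (q powi int (\<Sum>j=i+1..n. r j) * qnum q (int (r i))) *\<^sub>C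
         (ord_mon n z (r(i := r i - 1)) * ord_mon n w t)))"

definition dw ::
    "complex \<Rightarrow> nat \<Rightarrow> (nat \<Rightarrow> 'a) \<Rightarrow> (nat \<Rightarrow> 'a) \<Rightarrow> nat \<Rightarrow> 'a::complex_algebra_1 \<Rightarrow> 'a" where
  "dw q n z w i = (THE D. Vector_Spaces.linear scaleC scaleC D \<and>
     (\<forall>r t. D (ord_mon n w r * ord_mon n z t) =
       (q powi (- int (\<Sum>j=i+1..n. r j)) * qnum q (int (r i))) *\<^sub>C
         (ord_mon n w (r(i := r i - 1)) * ord_mon n z t)))"

text \<open>The Laplacian in the first \<open>k\<close> pairs of variables, acting on the algebra in \<open>n\<close> pairs.\<close>

definition qLaplace ::
    "complex \<Rightarrow> nat \<Rightarrow> nat \<Rightarrow> (nat \<Rightarrow> 'a) \<Rightarrow> (nat \<Rightarrow> 'a) \<Rightarrow> 'a::complex_algebra_1 \<Rightarrow> 'a" where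
  "qLaplace q n k z w p = (\<Sum>i=1..k. q ^ (2 * (i - 1)) *\<^sub>C dw q n z w i (dz q n z w i p))"

definition harmonic ::
    "complex \<Rightarrow> nat \<Rightarrow> nat \<Rightarrow> (nat \<Rightarrow> 'a) \<Rightarrow> (nat \<Rightarrow> 'a) \<Rightarrow> int \<Rightarrow> int \<Rightarrow> 'a::complex_algebra_1 set" where
  "harmonic q n k z w m m' = {p \<in> bihom k z w m m'. qLaplace q n k z w p = 0}"

definition Qsum :: "nat \<Rightarrow> (nat \<Rightarrow> 'a) \<Rightarrow> (nat \<Rightarrow> 'a) \<Rightarrow> 'a::ring_1" where
  "Qsum k z w = (\<Sum>i=1..k. z i * w i)"

text \<open>Meaningful for arguments in \<open>bihom n z w m m'\<close>, which is the direct sum of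
  \<open>harmonic q n n z w m m'\<close> and \<open>Qsum n z w * bihom n z w (m - 1) (m' - 1)\<close>.\<close>

definition harm_proj ::
    "complex \<Rightarrow> nat \<Rightarrow> (nat \<Rightarrow> 'a) \<Rightarrow> (nat \<Rightarrow> 'a) \<Rightarrow> int \<Rightarrow> int \<Rightarrow> 'a::complex_algebra_1 \<Rightarrow> 'a" where
  "harm_proj q n z w m m' p = (THE f. f \<in> harmonic q n n z w m m' \<and>
     (\<exists>g \<in> bihom n z w (m - 1) (m' - 1). p = f + Qsum n z w * g))"


section \<open>Basic hypergeometric polynomials\<close>

definition qpoch :: "complex \<Rightarrow> complex \<Rightarrow> nat \<Rightarrow> complex" where
  "qpoch a t s = (\<Prod>j<s. 1 - a * t ^ j)"

definition phi21_coeff :: "complex \<Rightarrow> complex \<Rightarrow> complex \<Rightarrow> complex \<Rightarrow> nat \<Rightarrow> complex" where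
  "phi21_coeff a b c t k = (qpoch a t k * qpoch b t k) / (qpoch c t k * qpoch t t k)"

text \<open>\<open>Y\<^sup>N \<cdot> \<^sub>2\<phi>\<^sub>1(a, b; c; t; x X / Y)\<close> as a polynomial in commuting \<open>X\<close>, \<open>Y\<close>. It is only used with
  \<open>a = t\<^sup>-\<^sup>N\<close>, in which case \<open>qpoch a t k = 0\<close> for \<open>k > N\<close> and the series terminates at \<open>k = N\<close>.\<close>

definition phi21_hom :: "nat \<Rightarrow> complex \<Rightarrow> complex \<Rightarrow> complex \<Rightarrow> complex \<Rightarrow> complex \<Rightarrow>
    'a \<Rightarrow> 'a \<Rightarrow> 'a::complex_algebra_1" where
  "phi21_hom N a b c t x X Y =
     (\<Sum>k\<le>N. (phi21_coeff a b c t k * x ^ k) *\<^sub>C (Y ^ (N - k) * X ^ k))"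

end

theory Submission
  imports Defs
begin

text \<open>Write \<open>Q\<^sub>k = z\<^sub>1w\<^sub>1 + \<dots> + z\<^sub>kw\<^sub>k\<close> and \<open>\<Delta>\<^sub>k\<close> for the Laplacian in the first \<open>k\<close> pairs of variables.
  Normal ordering gives \<open>\<partial>\<^sub>iQ\<^sub>k = qQ\<^sub>k\<partial>\<^sub>i + q\<^sup>-\<^sup>cw\<^sub>i\<close> on polynomials of bidegree \<open>(c, d)\<close>, and a dual formula
  for the other derivatives. With two Euler identities these yield
  \<open>\<Delta>\<^sub>kQ\<^sub>k - Q\<^sub>k\<Delta>\<^sub>k = q\<^sup>k\<^sup>-\<^sup>1[c + d + k]\<close>, from which \<open>\<Delta>\<^sub>n(Q\<^sub>ng) = 0\<close> forces \<open>g = 0\<close>; so the projection is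
  determined by its defining property. Since moreover \<open>\<Delta>\<^sub>nz\<^sub>n\<^sup>a = q\<^sup>-\<^sup>az\<^sub>n\<^sup>a\<Delta>\<^sub>n\<^sub>-\<^sub>1\<close> on polynomials in the first
  \<open>n - 1\<close> pairs, the elements \<open>z\<^sub>n\<^sup>aQ\<^sub>n\<^sub>-\<^sub>1\<^sup>kh\<close> form a ladder for \<open>\<Delta>\<^sub>n\<close>, and \<open>\<Delta>\<^sub>n(\<Sum>\<^sub>k \<phi>\<^sub>k Q\<^sub>n\<^sup>N\<^sup>-\<^sup>k z\<^sub>n\<^sup>aQ\<^sub>n\<^sub>-\<^sub>1\<^sup>kh) = 0\<close>
  is a two-term recursion for the \<open>\<phi>\<^sub>k\<close>, solved by the coefficients of \<open>\<^sub>2\<phi>\<^sub>1\<close>. The scalar factor is found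
  modulo \<open>Q\<^sub>n\<close>, where \<open>z\<^sub>n\<^sup>Nw\<^sub>n\<^sup>N \<equiv> (-1)\<^sup>N q\<^sup>-\<^sup>N\<^sup>(\<^sup>N\<^sup>-\<^sup>1\<^sup>) Q\<^sub>n\<^sub>-\<^sub>1\<^sup>N\<close>.\<close>


text \<open>The derivatives \<open>dz\<close> and \<open>dw\<close> are definite descriptions, so
  nothing can be said about them before the ordered monomials of both kinds are known to be
  independent, while the algebra is given only by its presentation. Relations alone can show that
  elements are equal, never that they are independent; that takes a model, here a representation of
  the free algebra which kills the relations. In it every word, in whatever order its letters stand,
  has a leading monomial, so one argument serves both bases. The calculus itself uses only the
  relations and the rules for the derivatives; it is therefore carried out for arbitrary maps
  obeying these rules, and existence is supplied at the end.

  Exchanging z and w together with q and q^-1 transfers every fact on z-derivatives to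
  w-derivatives. It also reverses the order of the two derivatives inside the Laplacian. For this
  reason the exchange is used for single derivatives and Euler identities, whereas the two cases of
  the theorem are computed separately and share only an abstract ladder lemma.\<close>

text \<open>Powers of \<open>q\<close> keep integer exponents, so that they can be merged.\<close>

declare power_int_of_nat [simp del]

lemmas scaleC_mult = mult_scaleC_left mult_scaleC_right scaleC_scaleC
lemmas scaleC_linear = scaleC_mult scaleC_one scaleC_add_right
  complex_vs.scale_right_diff_distrib complex_vs.scale_sum_right

lemma scaleC_right_cancelD:
  assumes "(c::complex) \<noteq> 0" "c *\<^sub>C x = c *\<^sub>C y" shows "x = y"
  using assms by (metis complex_vs.scale_left_imp_eq)

section \<open>Ordered monomials in \<open>q\<close>-commuting variables\<close>

lemma ord_mon_0 [simp]: "ord_mon 0 x r = 1"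
  by (simp add: ord_mon_def)

lemma ord_mon_Suc: "ord_mon (Suc k) x r = ord_mon k x r * x (Suc k) ^ r (Suc k)"
  by (simp add: ord_mon_def)

lemma ord_mon_cong:
  assumes "\<And>i. 1 \<le> i \<Longrightarrow> i \<le> k \<Longrightarrow> r i = r' i"
  shows "ord_mon k x r = ord_mon k x r'"
  unfolding ord_mon_def using assms by (intro arg_cong[of _ _ prod_list] map_cong) auto

lemma qcomm_power_right:
  fixes x y :: "'a::complex_algebra_1"
  assumes "q \<noteq> 0" "y * x = q powi e *\<^sub>C (x * y)"
  shows "y * x ^ m = q powi (e * int m) *\<^sub>C (x ^ m * y)"
proof (induction m)
  case 0
  show ?case by (simp add: scaleC_one)
next
  case (Suc m)
  have "y * x ^ Suc m = y * x ^ m * x" by (simp add: mult.assoc power_commutes)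
  also have "\<dots> = q powi (e * int m) *\<^sub>C (x ^ m * (y * x))"
    by (simp add: Suc.IH scaleC_mult mult.assoc)
  also have "\<dots> = (q powi (e * int m) * q powi e) *\<^sub>C (x ^ m * x * y)"
    by (simp add: assms(2) scaleC_mult mult.assoc)
  also have "\<dots> = q powi (e * int (Suc m)) *\<^sub>C (x ^ Suc m * y)"
    using assms(1) by (simp add: power_int_add[symmetric] power_commutes algebra_simps)
  finally show ?case .
qed

lemma qcomm_power_left:
  fixes x y :: "'a::complex_algebra_1"
  assumes "q \<noteq> 0" "y * x = q powi e *\<^sub>C (x * y)"
  shows "y ^ m * x = q powi (e * int m) *\<^sub>C (x * y ^ m)"
proof (induction m)
  case 0
  show ?case by (simp add: scaleC_one)
next
  case (Suc m)
  have "y ^ Suc m * x = y * (y ^ m * x)" by (simp add: mult.assoc)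
  also have "\<dots> = q powi (e * int m) *\<^sub>C (y * x * y ^ m)"
    by (simp add: Suc.IH scaleC_mult mult.assoc)
  also have "\<dots> = (q powi (e * int m) * q powi e) *\<^sub>C (x * y ^ Suc m)"
    by (simp add: assms(2) scaleC_mult mult.assoc)
  also have "\<dots> = q powi (e * int (Suc m)) *\<^sub>C (x * y ^ Suc m)"
    using assms(1) by (simp add: power_int_add[symmetric] algebra_simps)
  finally show ?case .
qed

lemma qcomm_flip:
  fixes x y :: "'a::complex_algebra_1"
  assumes "q \<noteq> 0" "y * x = q powi e *\<^sub>C (x * y)"
  shows "x * y = q powi (- e) *\<^sub>C (y * x)"
  using assms by (simp add: scaleC_mult scaleC_one flip: power_int_add)

lemma qcomm_ord_mon:
  fixes x :: "nat \<Rightarrow> 'a::complex_algebra_1"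
  assumes "q \<noteq> 0" "\<And>i. 1 \<le> i \<Longrightarrow> i \<le> k \<Longrightarrow> y * x i = q powi e *\<^sub>C (x i * y)"
  shows "y * ord_mon k x r = q powi (e * int (\<Sum>i=1..k. r i)) *\<^sub>C (ord_mon k x r * y)"
  using assms(2)
proof (induction k)
  case 0
  show ?case by (simp add: scaleC_one)
next
  case (Suc k)
  have "y * ord_mon (Suc k) x r = (y * ord_mon k x r) * x (Suc k) ^ r (Suc k)"
    by (simp add: ord_mon_Suc mult.assoc)
  also have "\<dots> = q powi (e * int (\<Sum>i=1..k. r i)) *\<^sub>C
      (ord_mon k x r * (y * x (Suc k) ^ r (Suc k)))"
    by (subst Suc.IH) (use Suc.prems in \<open>auto simp: scaleC_mult mult.assoc\<close>)
  also have "y * x (Suc k) ^ r (Suc k) = q powi (e * int (r (Suc k))) *\<^sub>C (x (Suc k) ^ r (Suc k) * y)"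
    by (rule qcomm_power_right[OF assms(1)]) (use Suc.prems in auto)
  finally show ?case
    using assms(1) by (simp add: ord_mon_Suc scaleC_mult mult.assoc algebra_simps flip: power_int_add)
qed

lemma mult_ord_mon:
  fixes x :: "nat \<Rightarrow> 'a::complex_algebra_1"
  assumes "q \<noteq> 0" "\<And>i j. 1 \<le> i \<Longrightarrow> i < j \<Longrightarrow> j \<le> n \<Longrightarrow> x i * x j = q powi e *\<^sub>C (x j * x i)"
    and "1 \<le> j" "j \<le> k" "k \<le> n"
  shows "x j * ord_mon k x r =
    q powi (- e * int (\<Sum>i=1..<j. r i)) *\<^sub>C ord_mon k x (r(j := Suc (r j)))"
  using assms(4,5)
proof (induction k rule: dec_induct)
  case base
  obtain j' where j': "j = Suc j'" using assms(3) by (cases j) auto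
  have *: "{1..<Suc j'} = {1..j'}" by auto
  have "x j * ord_mon j' x r = q powi (- e * int (\<Sum>i=1..j'. r i)) *\<^sub>C (ord_mon j' x r * x j)"
    by (rule qcomm_ord_mon[OF assms(1)], rule qcomm_flip[OF assms(1)])
      (use assms(2) base j' in auto)
  moreover have "ord_mon j' x (r(j := Suc (r j))) = ord_mon j' x r"
    by (rule ord_mon_cong) (use j' in auto)
  ultimately show ?case
    unfolding j' ord_mon_Suc *
    by (simp add: scaleC_mult flip: mult.assoc)
next
  case (step k)
  then show ?case
    by (simp add: ord_mon_Suc scaleC_mult flip: mult.assoc)
qed

lemma ord_mon_mult:
  fixes x :: "nat \<Rightarrow> 'a::complex_algebra_1"
  assumes "q \<noteq> 0" "\<And>i j. 1 \<le> i \<Longrightarrow> i < j \<Longrightarrow> j \<le> n \<Longrightarrow> x i * x j = q powi e *\<^sub>C (x j * x i)"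
    and "1 \<le> j" "j \<le> k" "k \<le> n"
  shows "ord_mon k x r * x j =
    q powi (- e * int (\<Sum>i=j+1..k. r i)) *\<^sub>C ord_mon k x (r(j := Suc (r j)))"
  using assms(4,5)
proof (induction k rule: dec_induct)
  case base
  obtain j' where j': "j = Suc j'" using assms(3) by (cases j) auto
  have "ord_mon j' x (r(j := Suc (r j))) = ord_mon j' x r"
    by (rule ord_mon_cong) (use j' in auto)
  then show ?case
    unfolding j' ord_mon_Suc by (simp add: scaleC_one mult.assoc power_commutes)
next
  case (step k)
  have "x (Suc k) ^ r (Suc k) * x j = q powi (- e * int (r (Suc k))) *\<^sub>C (x j * x (Suc k) ^ r (Suc k))"
    by (rule qcomm_power_left[OF assms(1)], rule qcomm_flip[OF assms(1)]) (use assms(2,3) step in auto)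
  then have "ord_mon (Suc k) x r * x j =
      q powi (- e * int (r (Suc k))) *\<^sub>C (ord_mon k x r * x j * x (Suc k) ^ r (Suc k))"
    by (simp add: ord_mon_Suc mult.assoc scaleC_mult)
  also have "ord_mon k x r * x j = q powi (- e * int (\<Sum>i=j+1..k. r i)) *\<^sub>C ord_mon k x (r(j := Suc (r j)))"
    by (rule step.IH) (use step in auto)
  also have "q powi (- e * int (r (Suc k))) *\<^sub>C
      (q powi (- e * int (\<Sum>i=j+1..k. r i)) *\<^sub>C ord_mon k x (r(j := Suc (r j))) * x (Suc k) ^ r (Suc k)) =
    q powi (- e * int (r (Suc k)) + - e * int (\<Sum>i=j+1..k. r i)) *\<^sub>C
      (ord_mon k x (r(j := Suc (r j))) * x (Suc k) ^ r (Suc k))"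
    using assms(1) by (simp only: scaleC_mult power_int_add simp_thms)
  also have "ord_mon k x (r(j := Suc (r j))) * x (Suc k) ^ r (Suc k) = ord_mon (Suc k) x (r(j := Suc (r j)))"
    using step.hyps by (simp add: ord_mon_Suc)
  also have "- e * int (r (Suc k)) + - e * int (\<Sum>i=j+1..k. r i) = - e * int (\<Sum>i=j+1..Suc k. r i)"
    using step.hyps by (simp add: algebra_simps)
  finally show ?case .
qed

section \<open>The defining relations\<close>

text \<open>Assuming the bare relations, without a presentation, allows the same results to be
  instantiated at the dual data \<open>inverse q\<close>, \<open>zd\<close>, \<open>z\<close>, where
  only the relations are checked.\<close>

locale q_relations_hold =
  fixes q :: complex and n :: nat and z w :: "nat \<Rightarrow> 'a::complex_algebra_1"
  assumes q0: "q \<noteq> 0"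
    and zz: "1 \<le> i \<Longrightarrow> i < j \<Longrightarrow> j \<le> n \<Longrightarrow> z i * z j = q *\<^sub>C (z j * z i)"
    and ww: "1 \<le> i \<Longrightarrow> i < j \<Longrightarrow> j \<le> n \<Longrightarrow> w i * w j = inverse q *\<^sub>C (w j * w i)"
    and wz: "1 \<le> i \<Longrightarrow> i \<le> n \<Longrightarrow> 1 \<le> j \<Longrightarrow> j \<le> n \<Longrightarrow> i \<noteq> j \<Longrightarrow> w j * z i = q *\<^sub>C (z i * w j)"
    and wzk: "1 \<le> k \<Longrightarrow> k \<le> n \<Longrightarrow>
      w k * z k = z k * w k + (1 - q\<^sup>2) *\<^sub>C (\<Sum>s=1..<k. z s * w s)"
begin

abbreviation Q :: "nat \<Rightarrow> 'a" where "Q k \<equiv> Qsum k z w"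

lemma Q_0 [simp]: "Q 0 = 0" by (simp add: Qsum_def)
lemma Q_Suc: "Q (Suc k) = Q k + z (Suc k) * w (Suc k)" by (simp add: Qsum_def)

lemma wz_Suc: "Suc k \<le> n \<Longrightarrow> w (Suc k) * z (Suc k) = z (Suc k) * w (Suc k) + (1 - q\<^sup>2) *\<^sub>C Q k"
  using wzk[of "Suc k"] by (simp add: Qsum_def atLeastLessThanSuc_atLeastAtMost)

lemma qpow_add: "q powi a * q powi b = q powi (a + b)"
  using q0 by (simp add: power_int_add)

lemma qpow_add': "q powi a * (q powi b * c) = q powi (a + b) * c"
  using q0 by (simp add: power_int_add)

lemma zz': "1 \<le> i \<Longrightarrow> i < j \<Longrightarrow> j \<le> n \<Longrightarrow> z i * z j = q powi 1 *\<^sub>C (z j * z i)"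
  using zz by simp
lemma ww': "1 \<le> i \<Longrightarrow> i < j \<Longrightarrow> j \<le> n \<Longrightarrow> w i * w j = q powi (-1) *\<^sub>C (w j * w i)"
  using ww by (simp add: power_int_minus)
lemma wz': "1 \<le> i \<Longrightarrow> i \<le> n \<Longrightarrow> 1 \<le> j \<Longrightarrow> j \<le> n \<Longrightarrow> i \<noteq> j \<Longrightarrow> w j * z i = q powi 1 *\<^sub>C (z i * w j)"
  using wz by simp

lemmas zz_flip = qcomm_flip[OF q0 zz']
lemmas ww_flip = qcomm_flip[OF q0 ww']
lemmas wz_flip = qcomm_flip[OF q0 wz']

lemma Q_z_high: "k < j \<Longrightarrow> j \<le> n \<Longrightarrow> Q k * z j = q powi 2 *\<^sub>C (z j * Q k)"
proof (induction k)
  case (Suc k)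
  have "z (Suc k) * w (Suc k) * z j = q *\<^sub>C (z (Suc k) * z j * w (Suc k))"
    using wz[of j "Suc k"] Suc.prems by (simp add: mult.assoc scaleC_mult)
  also have "\<dots> = q powi 2 *\<^sub>C (z j * (z (Suc k) * w (Suc k)))"
    using zz[of "Suc k" j] Suc.prems by (simp add: mult.assoc scaleC_mult power2_eq_square)
  finally show ?case
    using Suc by (simp add: Q_Suc algebra_simps scaleC_linear)
qed (simp)

lemma Q_w_high: "k < j \<Longrightarrow> j \<le> n \<Longrightarrow> w j * Q k = q powi 2 *\<^sub>C (Q k * w j)"
proof (induction k)
  case (Suc k)
  have "w j * (z (Suc k) * w (Suc k)) = q *\<^sub>C (z (Suc k) * (w j * w (Suc k)))"
    using wz[of "Suc k" j] Suc.prems by (simp add: mult.assoc[symmetric] scaleC_mult)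
  also have "w j * w (Suc k) = q powi 1 *\<^sub>C (w (Suc k) * w j)"
    using ww_flip[of "Suc k" j] Suc.prems by simp
  finally have "w j * (z (Suc k) * w (Suc k)) = q powi 2 *\<^sub>C (z (Suc k) * w (Suc k) * w j)"
    by (simp add: mult.assoc scaleC_mult power2_eq_square)
  then show ?case
    using Suc by (simp add: Q_Suc algebra_simps scaleC_linear)
qed (simp)

text \<open>For k = j the correction (1 - q^2) Q_(j-1) from the last relation compensates the factor
  q^2 by which Q_(j-1) fails to commute with z_j. Each later summand z_k w_k commutes with z_j by
  itself, because the factors from w_k and z_k are inverse to each other.\<close>

lemma Q_z_low:
  assumes "1 \<le> j" "j \<le> k" "k \<le> n"
  shows "Q k * z j = z j * Q k"
  using assms(2,3)
proof (induction k rule: dec_induct)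
  case base
  obtain j' where j': "j = Suc j'" using assms(1) by (cases j) auto
  have "z j * (w j * z j) = z j * (z j * w j) + (1 - q\<^sup>2) *\<^sub>C (z j * Q j')"
    using wz_Suc[of j'] base j' by (simp add: distrib_left scaleC_mult)
  moreover have "Q j' * z j = q\<^sup>2 *\<^sub>C (z j * Q j')"
    using Q_z_high[of j' j] base j' by simp
  ultimately show ?case
    unfolding j' Q_Suc by (simp add: algebra_simps scaleC_linear complex_vs.scale_left_diff_distrib)
next
  case (step k)
  have "z (Suc k) * w (Suc k) * z j = q *\<^sub>C (z (Suc k) * z j * w (Suc k))"
    using wz[of j "Suc k"] step assms by (simp add: mult.assoc scaleC_mult)
  also have "\<dots> = z j * (z (Suc k) * w (Suc k))"
    using zz[of j "Suc k"] step assms by (simp add: mult.assoc[symmetric] scaleC_mult)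
  finally show ?case
    using step by (simp add: Q_Suc algebra_simps)
qed

lemma Q_w_low:
  assumes "1 \<le> j" "j \<le> k" "k \<le> n"
  shows "Q k * w j = w j * Q k"
  using assms(2,3)
proof (induction k rule: dec_induct)
  case base
  obtain j' where j': "j = Suc j'" using assms(1) by (cases j) auto
  have "(w j * z j) * w j = (z j * w j) * w j + (1 - q\<^sup>2) *\<^sub>C (Q j' * w j)"
    using wz_Suc[of j'] base j' by (simp add: distrib_right scaleC_mult)
  moreover have "w j * Q j' = q\<^sup>2 *\<^sub>C (Q j' * w j)"
    using Q_w_high[of j' j] base j' by simp
  ultimately show ?case
    unfolding j' Q_Suc by (simp add: algebra_simps scaleC_linear complex_vs.scale_left_diff_distrib)
next
  case (step k)
  have "w j * (z (Suc k) * w (Suc k)) = q *\<^sub>C (z (Suc k) * (w j * w (Suc k)))"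
    using wz[of "Suc k" j] step assms by (simp add: mult.assoc[symmetric] scaleC_mult)
  also have "\<dots> = z (Suc k) * w (Suc k) * w j"
    using ww[of j "Suc k"] step assms q0 by (simp add: mult.assoc scaleC_mult scaleC_one)
  finally show ?case
    using step by (simp add: Q_Suc algebra_simps)
qed

subsection \<open>Reordering\<close>

text \<open>Each z that w passes leaves (1 - q^2) Q_k, and moving Q_k to the right past the
  remaining z's multiplies it by q^2 per step. The geometric sum of these contributions is 1 -
  q^(2r).\<close>

lemma w_pow_z:
  assumes "Suc k \<le> n"
  shows "w (Suc k) * z (Suc k) ^ r = z (Suc k) ^ r * w (Suc k)
    + (1 - q powi (2 * int r)) *\<^sub>C (z (Suc k) ^ (r - 1) * Q k)"
proof (induction r)
  case 0
  show ?case by simp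
next
  case (Suc r)
  let ?z = "z (Suc k)" and ?w = "w (Suc k)"
  have "Q k * ?z = q powi 2 *\<^sub>C (?z * Q k)" by (rule Q_z_high) (use assms in auto)
  then have 1: "?z ^ (r - 1) * Q k * ?z = q powi 2 *\<^sub>C (?z ^ (r - 1) * ?z * Q k)"
    by (simp add: mult.assoc scaleC_mult)
  \<comment> \<open>For r = 0 the truncated exponent would be wrong, but the coefficient 1 - q^0 is
    zero on both sides.\<close>
  have 2: "(1 - q powi (2 * int r)) *\<^sub>C (?z ^ (r - 1) * ?z * Q k) = (1 - q powi (2 * int r)) *\<^sub>C (?z ^ r * Q k)"
    by (cases r) (auto simp: power_commutes)
  have 3: "(1 - q powi (2 * int r)) *\<^sub>C (?z ^ (r - 1) * Q k * ?z) =
      (q powi 2 - q powi (2 * int (Suc r))) *\<^sub>C (?z ^ r * Q k)"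
  proof -
    have "(1 - q powi (2 * int r)) *\<^sub>C (?z ^ (r - 1) * Q k * ?z) =
      q powi 2 *\<^sub>C ((1 - q powi (2 * int r)) *\<^sub>C (?z ^ (r - 1) * ?z * Q k))"
      unfolding 1 by (simp add: scaleC_mult mult.commute)
    also have "\<dots> = (q powi 2 - q powi (2 * int (Suc r))) *\<^sub>C (?z ^ r * Q k)"
      unfolding 2 by (simp add: scaleC_mult right_diff_distrib qpow_add algebra_simps del: power_int_numeral)
    finally show ?thesis .
  qed
  have "?w * ?z ^ Suc r = (?w * ?z ^ r) * ?z" by (simp only: power_Suc2 mult.assoc)
  also have "\<dots> = ?z ^ r * (?w * ?z) + (1 - q powi (2 * int r)) *\<^sub>C (?z ^ (r - 1) * Q k * ?z)"
    by (simp add: Suc.IH algebra_simps scaleC_mult)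
  also have "?z ^ r * (?w * ?z) = ?z ^ Suc r * ?w + (1 - q powi 2) *\<^sub>C (?z ^ r * Q k)"
    by (simp add: wz_Suc[OF assms] distrib_left scaleC_linear power_commutes flip: mult.assoc)
  finally show ?case
    unfolding 3 by (simp add: add.assoc flip: scaleC_add_left)
qed

text \<open>For \<open>r j = 0\<close> the coefficient \<open>1 - q\<^sup>0\<close> of the second term vanishes.\<close>

lemma w_ord_mon_z:
  assumes "1 \<le> j" "j \<le> k" "k \<le> n"
  shows "w j * ord_mon k z r =
    q powi (int (\<Sum>i=1..<j. r i) + int (\<Sum>i=j+1..k. r i)) *\<^sub>C (ord_mon k z r * w j) +
    (q powi (int (\<Sum>i=1..<j. r i) + 2 * int (\<Sum>i=j+1..k. r i)) * (1 - q powi (2 * int (r j)))) *\<^sub>C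
      (ord_mon k z (r(j := r j - 1)) * Q (j - 1))"
  using assms(2,3)
proof (induction k rule: dec_induct)
  case base
  obtain j' where j': "j = Suc j'" using assms(1) by (cases j) auto
  have *: "{1..<Suc j'} = {1..j'}" by auto
  have c: "ord_mon j' z (r(Suc j' := x)) = ord_mon j' z r" for x
    by (rule ord_mon_cong) auto
  have "w j * ord_mon j' z r = q powi (1 * int (\<Sum>i=1..j'. r i)) *\<^sub>C (ord_mon j' z r * w j)"
    by (rule qcomm_ord_mon[OF q0], rule wz') (use base j' in auto)
  then have "w j * ord_mon j z r =
      q powi (int (\<Sum>i=1..j'. r i)) *\<^sub>C (ord_mon j' z r * (w (Suc j') * z (Suc j') ^ r (Suc j')))"
    unfolding j' ord_mon_Suc by (simp add: scaleC_mult flip: mult.assoc)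
  also have "\<dots> = q powi (int (\<Sum>i=1..j'. r i)) *\<^sub>C (ord_mon j z r * w j) +
    (q powi (int (\<Sum>i=1..j'. r i)) * (1 - q powi (2 * int (r j)))) *\<^sub>C
      (ord_mon j' z r * z (Suc j') ^ (r j - 1) * Q j')"
    using w_pow_z[of j' "r (Suc j')"] base j' by (simp add: ord_mon_Suc ring_distribs scaleC_linear mult.assoc)
  finally show ?case
    unfolding j' * ord_mon_Suc[of j' z "r(Suc j' := r (Suc j') - 1)"] c by simp
next
  case (step k)
  let ?Z = "z (Suc k) ^ r (Suc k)"
  have a: "w j * ?Z = q powi (1 * int (r (Suc k))) *\<^sub>C (?Z * w j)"
    by (rule qcomm_power_right[OF q0], rule wz') (use assms step in auto)
  have b: "Q (j - 1) * ?Z = q powi (2 * int (r (Suc k))) *\<^sub>C (?Z * Q (j - 1))"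
    by (rule qcomm_power_right[OF q0], rule Q_z_high) (use assms step in auto)
  have "w j * ord_mon (Suc k) z r = (w j * ord_mon k z r) * ?Z"
    by (simp add: ord_mon_Suc mult.assoc)
  also have "\<dots> =
    q powi (int (\<Sum>i=1..<j. r i) + int (\<Sum>i=j+1..k. r i)) *\<^sub>C (ord_mon k z r * (w j * ?Z)) +
    (q powi (int (\<Sum>i=1..<j. r i) + 2 * int (\<Sum>i=j+1..k. r i)) * (1 - q powi (2 * int (r j)))) *\<^sub>C
      (ord_mon k z (r(j := r j - 1)) * (Q (j - 1) * ?Z))"
    by (subst step.IH) (use step in \<open>auto simp: ring_distribs scaleC_mult mult.assoc\<close>)
  also have "ord_mon k z r * (w j * ?Z) = q powi (int (r (Suc k))) *\<^sub>C (ord_mon (Suc k) z r * w j)"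
    unfolding a by (simp add: ord_mon_Suc scaleC_mult mult.assoc)
  also have "ord_mon k z (r(j := r j - 1)) * (Q (j - 1) * ?Z) =
      q powi (2 * int (r (Suc k))) *\<^sub>C (ord_mon (Suc k) z (r(j := r j - 1)) * Q (j - 1))"
    unfolding b using step.hyps by (simp add: ord_mon_Suc scaleC_mult mult.assoc)
  also have "q powi (int (\<Sum>i=1..<j. r i) + int (\<Sum>i=j+1..k. r i)) *\<^sub>C q powi int (r (Suc k)) *\<^sub>C (ord_mon (Suc k) z r * w j) =
      q powi (int (\<Sum>i=1..<j. r i) + int (\<Sum>i=j+1..Suc k. r i)) *\<^sub>C (ord_mon (Suc k) z r * w j)"
    using step.hyps by (simp add: scaleC_scaleC qpow_add algebra_simps)
  also have "(q powi (int (\<Sum>i=1..<j. r i) + 2 * int (\<Sum>i=j+1..k. r i)) * (1 - q powi (2 * int (r j)))) *\<^sub>C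
      q powi (2 * int (r (Suc k))) *\<^sub>C (ord_mon (Suc k) z (r(j := r j - 1)) * Q (j - 1)) =
      (q powi (int (\<Sum>i=1..<j. r i) + 2 * int (\<Sum>i=j+1..Suc k. r i)) * (1 - q powi (2 * int (r j)))) *\<^sub>C
      (ord_mon (Suc k) z (r(j := r j - 1)) * Q (j - 1))"
    using step.hyps by (simp add: scaleC_scaleC qpow_add qpow_add' algebra_simps del: fun_upd_apply)
  finally show ?case .
qed

lemma z_ord_mon_z:
  "1 \<le> j \<Longrightarrow> j \<le> k \<Longrightarrow> k \<le> n \<Longrightarrow>
    z j * ord_mon k z r = q powi (- int (\<Sum>i=1..<j. r i)) *\<^sub>C ord_mon k z (r(j := Suc (r j)))"
  using mult_ord_mon[OF q0, of n z 1 j k r] zz' by simp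

lemma ord_mon_z_z:
  "1 \<le> j \<Longrightarrow> j \<le> k \<Longrightarrow> k \<le> n \<Longrightarrow>
    ord_mon k z r * z j = q powi (- int (\<Sum>i=j+1..k. r i)) *\<^sub>C ord_mon k z (r(j := Suc (r j)))"
  using ord_mon_mult[OF q0, of n z 1 j k r] zz' by simp

lemma w_ord_mon_w:
  "1 \<le> j \<Longrightarrow> j \<le> k \<Longrightarrow> k \<le> n \<Longrightarrow>
    w j * ord_mon k w r = q powi (int (\<Sum>i=1..<j. r i)) *\<^sub>C ord_mon k w (r(j := Suc (r j)))"
  using mult_ord_mon[OF q0, of n w "-1" j k r] ww' by simp

lemma ord_mon_w_w:
  "1 \<le> j \<Longrightarrow> j \<le> k \<Longrightarrow> k \<le> n \<Longrightarrow>
    ord_mon k w r * w j = q powi (int (\<Sum>i=j+1..k. r i)) *\<^sub>C ord_mon k w (r(j := Suc (r j)))"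
  using ord_mon_mult[OF q0, of n w "-1" j k r] ww' by simp

end

section \<open>Bihomogeneous polynomials\<close>

lemma bihom_mon:
  assumes "int (\<Sum>i=1..k. r i) = c" "int (\<Sum>i=1..k. t i) = d"
  shows "ord_mon k z r * ord_mon k w t \<in> bihom k z w c d"
  unfolding bihom_def by (rule complex_vs.span_base) (use assms in blast)

lemma bihom_0 [simp]: "0 \<in> bihom k z w c d"
  and bihom_add: "x \<in> bihom k z w c d \<Longrightarrow> y \<in> bihom k z w c d \<Longrightarrow> x + y \<in> bihom k z w c d"
  and bihom_diff: "x \<in> bihom k z w c d \<Longrightarrow> y \<in> bihom k z w c d \<Longrightarrow> x - y \<in> bihom k z w c d"
  and bihom_scale: "x \<in> bihom k z w c d \<Longrightarrow> a *\<^sub>C x \<in> bihom k z w c d"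
  and bihom_sum: "(\<And>i. i \<in> I \<Longrightarrow> f i \<in> bihom k z w c d) \<Longrightarrow> sum f I \<in> bihom k z w c d"
  unfolding bihom_def
  by (auto intro: complex_vs.span_zero complex_vs.span_add complex_vs.span_diff complex_vs.span_scale
      complex_vs.span_sum)

lemma bihom_induct [consumes 1, case_names mon zero add scale]:
  assumes "x \<in> bihom k z w c d"
    and "\<And>r t. int (\<Sum>i=1..k. r i) = c \<Longrightarrow> int (\<Sum>i=1..k. t i) = d \<Longrightarrow>
      P (ord_mon k z r * ord_mon k w t)"
    and "P 0" "\<And>x y. P x \<Longrightarrow> P y \<Longrightarrow> P (x + y)" "\<And>a x. P x \<Longrightarrow> P (a *\<^sub>C x)"
  shows "P x"
  using assms(1) unfolding bihom_def
  by (induction rule: complex_vs.span_induct_alt) (use assms(2-) in blast)+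

lemma bihom_neg: "x \<in> bihom k z w c d \<Longrightarrow> c < 0 \<or> d < 0 \<Longrightarrow> x = 0"
  by (induction rule: bihom_induct) (auto simp del: of_nat_sum)

lemma ord_mon_zero: "(\<And>i. 1 \<le> i \<Longrightarrow> i \<le> k \<Longrightarrow> r i = 0) \<Longrightarrow> ord_mon k x r = 1"
  by (induction k) (auto simp: ord_mon_Suc)

lemma sum_upd_Suc:
  fixes j k :: nat
  assumes "1 \<le> j" "j \<le> k"
  shows "int (\<Sum>i=1..k. (r(j := Suc (r j))) i) = int (\<Sum>i=1..k. r i) + 1"
proof -
  have "j \<in> {1..k}" using assms by simp
  then have "(\<Sum>i=1..k. f i) = f j + (\<Sum>i\<in>{1..k}-{j}. f i)" for f :: "nat \<Rightarrow> nat"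
    by (intro sum.remove) auto
  note this[of r] this[of "r(j := Suc (r j))"]
  moreover have "(\<Sum>i\<in>{1..k}-{j}. (r(j := Suc (r j))) i) = (\<Sum>i\<in>{1..k}-{j}. r i)"
    by (rule sum.cong) auto
  ultimately show ?thesis by simp
qed

lemma sum_upd_pred:
  fixes j k :: nat
  assumes "1 \<le> j" "j \<le> k" "r j \<noteq> 0"
  shows "int (\<Sum>i=1..k. (r(j := r j - 1)) i) = int (\<Sum>i=1..k. r i) - 1"
  using sum_upd_Suc[OF assms(1,2), of "r(j := r j - 1)"] assms(3)
  by (simp add: fun_upd_idem del: of_nat_sum)

lemma sum_upd_notin: "j \<notin> A \<Longrightarrow> (\<Sum>i\<in>A. (r(j := x)) i) = (\<Sum>i\<in>A. r i)"
  by (rule sum.cong) auto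

lemma ord_mon_extend:
  fixes k k' :: nat
  assumes "k \<le> k'"
  shows "ord_mon k' x (\<lambda>i. if i \<le> k then r i else 0) = ord_mon k x r"
  using assms
proof (induction k' rule: dec_induct)
  case base
  show ?case by (rule ord_mon_cong) auto
qed (simp add: ord_mon_Suc)

lemma sum_extend:
  fixes k k' :: nat
  assumes "k \<le> k'"
  shows "(\<Sum>i=1..k'. if i \<le> k then r i else 0) = (\<Sum>i=1..k. r i :: nat)"
  using assms by (induction k' rule: dec_induct) auto

lemma bihom_mono:
  assumes "k \<le> k'" "x \<in> bihom k z w c d"
  shows "x \<in> bihom k' z w c d"
  using assms(2)
proof (induction rule: bihom_induct)
  case (mon r t)
  have "ord_mon k' z (\<lambda>i. if i \<le> k then r i else 0) * ord_mon k' w (\<lambda>i. if i \<le> k then t i else 0)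
    \<in> bihom k' z w c d"
    by (rule bihom_mon) (use mon sum_extend[OF assms(1)] in simp_all)
  then show ?case by (simp add: ord_mon_extend[OF assms(1)])
qed (auto intro: bihom_add bihom_scale)

lemma ord_mon_scale:
  fixes x :: "nat \<Rightarrow> 'a::complex_algebra_1"
  shows "ord_mon k (\<lambda>i. a i *\<^sub>C x i) r = (\<Prod>i=1..k. a i ^ r i) *\<^sub>C ord_mon k x r"
proof (induction k)
  case (Suc k)
  have "(c *\<^sub>C y) ^ m = c ^ m *\<^sub>C y ^ m" for c m and y :: 'a
    by (induction m) (auto simp: scaleC_mult scaleC_one)
  then show ?case by (simp add: ord_mon_Suc Suc.IH scaleC_mult mult.commute)
qed (simp add: scaleC_one)

section \<open>Products of bihomogeneous polynomials, centrality of \<open>Q k\<close>, and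
  commutation with outer variables\<close>

context q_relations_hold
begin

abbreviation hom :: "nat \<Rightarrow> int \<Rightarrow> int \<Rightarrow> 'a set" where "hom k \<equiv> bihom k z w"

lemma z_mult_hom:
  assumes "1 \<le> j" "j \<le> k" "k \<le> n" "x \<in> hom k c d"
  shows "z j * x \<in> hom k (c + 1) d"
  using assms(4)
proof (induction rule: bihom_induct)
  case (mon r t)
  show ?case
    unfolding mult.assoc[symmetric] z_ord_mon_z[OF assms(1-3)] scaleC_mult
    by (intro bihom_scale bihom_mon)
      (use mon sum_upd_Suc[OF assms(1,2), of r] in auto)
qed (auto simp: distrib_left scaleC_mult intro: bihom_add bihom_scale)

text \<open>Reordering leaves a \<open>Q j\<close> between the z-part and the w-part. Summand by
  summand, its z joins the left factor and its w the right one, so no further reordering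
  arises.\<close>

lemma ord_Q_ord_hom:
  assumes "j \<le> k" "k \<le> n" "int (\<Sum>i=1..k. r i) = c" "int (\<Sum>i=1..k. t i) = d"
  shows "ord_mon k z r * Q j * ord_mon k w t \<in> hom k (c + 1) (d + 1)"
  unfolding Qsum_def sum_distrib_left sum_distrib_right
proof (rule bihom_sum)
  fix s assume "s \<in> {1..j}"
  then have s: "1 \<le> s" "s \<le> k" "k \<le> n" using assms by auto
  have "ord_mon k z r * (z s * w s) * ord_mon k w t = (ord_mon k z r * z s) * (w s * ord_mon k w t)"
    by (simp add: mult.assoc)
  also have "\<dots> \<in> hom k (c + 1) (d + 1)"
    unfolding ord_mon_z_z[OF s] w_ord_mon_w[OF s] scaleC_mult
    by (intro bihom_scale bihom_mon)
      (use assms sum_upd_Suc[OF s(1,2), of r] sum_upd_Suc[OF s(1,2), of t] in auto)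
  finally show "ord_mon k z r * (z s * w s) * ord_mon k w t \<in> hom k (c + 1) (d + 1)" .
qed

lemma w_mult_hom:
  assumes "1 \<le> j" "j \<le> k" "k \<le> n" "x \<in> hom k c d"
  shows "w j * x \<in> hom k c (d + 1)"
  using assms(4)
proof (induction rule: bihom_induct)
  case (mon r t)
  have 1: "ord_mon k z r * (w j * ord_mon k w t) \<in> hom k c (d + 1)"
    unfolding w_ord_mon_w[OF assms(1-3)] scaleC_mult
    by (intro bihom_scale bihom_mon)
      (use mon sum_upd_Suc[OF assms(1,2), of t] in auto)
  have 2: "((a * (1 - q powi (2 * int (r j)))) *\<^sub>C (ord_mon k z (r(j := r j - 1)) * Q (j - 1))) * ord_mon k w t
      \<in> hom k c (d + 1)" for a
  proof (cases "r j = 0")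
    case False
    have "ord_mon k z (r(j := r j - 1)) * Q (j - 1) * ord_mon k w t \<in> hom k (c - 1 + 1) (d + 1)"
      by (rule ord_Q_ord_hom)
        (use mon assms sum_upd_pred[of j k r] False in \<open>auto simp del: of_nat_sum fun_upd_apply\<close>)
    then show ?thesis by (simp add: scaleC_mult bihom_scale)
  qed simp
  show ?case
    unfolding mult.assoc[symmetric] w_ord_mon_z[OF assms(1-3)] distrib_right
    by (rule bihom_add[OF _ 2]) (use 1 in \<open>simp add: scaleC_mult bihom_scale mult.assoc\<close>)
qed (auto simp: distrib_left scaleC_mult intro: bihom_add bihom_scale)

lemma ord_mon_z_mult_hom:
  assumes "k' \<le> k" "k \<le> n" "x \<in> hom k c d"
  shows "ord_mon k' z r * x \<in> hom k (c + int (\<Sum>i=1..k'. r i)) d"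
  using assms(1,3)
proof (induction k' arbitrary: x c)
  case (Suc k')
  have "z (Suc k') ^ m * x \<in> hom k (c + int m) d" for m
  proof (induction m)
    case (Suc m)
    have "z (Suc k') * (z (Suc k') ^ m * x) \<in> hom k (c + int m + 1) d"
      by (rule z_mult_hom) (use Suc \<open>Suc k' \<le> k\<close> assms in auto)
    then show ?case by (simp add: mult.assoc ac_simps)
  qed (use Suc in simp)
  from Suc.IH[OF _ this] show ?case
    using Suc.prems by (auto simp: ord_mon_Suc mult.assoc ac_simps)
qed simp

lemma ord_mon_w_mult_hom:
  assumes "k' \<le> k" "k \<le> n" "x \<in> hom k c d"
  shows "ord_mon k' w r * x \<in> hom k c (d + int (\<Sum>i=1..k'. r i))"
  using assms(1,3)
proof (induction k' arbitrary: x d)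
  case (Suc k')
  have "w (Suc k') ^ m * x \<in> hom k c (d + int m)" for m
  proof (induction m)
    case (Suc m)
    have "w (Suc k') * (w (Suc k') ^ m * x) \<in> hom k c (d + int m + 1)"
      by (rule w_mult_hom) (use Suc \<open>Suc k' \<le> k\<close> assms in auto)
    then show ?case by (simp add: mult.assoc ac_simps)
  qed (use Suc in simp)
  from Suc.IH[OF _ this] show ?case
    using Suc.prems by (auto simp: ord_mon_Suc mult.assoc ac_simps)
qed simp

lemma hom_mult:
  assumes "k \<le> n" "x \<in> hom k c d" "y \<in> hom k c' d'"
  shows "x * y \<in> hom k (c + c') (d + d')"
  using assms(2)
proof (induction rule: bihom_induct)
  case (mon r t)
  have "ord_mon k z r * (ord_mon k w t * y) \<in>
      hom k (c' + int (\<Sum>i=1..k. r i)) (d' + int (\<Sum>i=1..k. t i))"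
    by (intro ord_mon_z_mult_hom ord_mon_w_mult_hom assms(1,3) order_refl)
  then show ?case by (simp only: mon mult.assoc add.commute)
qed (auto simp: distrib_right scaleC_mult intro: bihom_add bihom_scale)

lemma one_hom: "1 \<in> hom k 0 0"
  using bihom_mon[where r="\<lambda>_. 0" and t="\<lambda>_. 0" and k=k and z=z and w=w] by (simp add: ord_mon_zero)

lemma ord_mon_z_hom: "k \<le> n \<Longrightarrow> ord_mon k z r \<in> hom k (int (\<Sum>i=1..k. r i)) 0"
  using ord_mon_z_mult_hom[OF order_refl _ one_hom, where r=r] by simp

lemma ord_mon_w_hom: "k \<le> n \<Longrightarrow> ord_mon k w r \<in> hom k 0 (int (\<Sum>i=1..k. r i))"
  using ord_mon_w_mult_hom[OF order_refl _ one_hom, where r=r] by simp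

lemma z_hom: "1 \<le> j \<Longrightarrow> j \<le> k \<Longrightarrow> k \<le> n \<Longrightarrow> z j \<in> hom k 1 0"
  using z_mult_hom[OF _ _ _ one_hom] by fastforce

lemma w_hom: "1 \<le> j \<Longrightarrow> j \<le> k \<Longrightarrow> k \<le> n \<Longrightarrow> w j \<in> hom k 0 1"
  using w_mult_hom[OF _ _ _ one_hom] by fastforce

lemma hom_power:
  assumes "k \<le> n" "x \<in> hom k c d"
  shows "x ^ m \<in> hom k (int m * c) (int m * d)"
proof (induction m)
  case (Suc m)
  from hom_mult[OF assms this] show ?case by (simp add: algebra_simps)
qed (simp add: one_hom)

lemma Q_hom: "j \<le> k \<Longrightarrow> k \<le> n \<Longrightarrow> Q j \<in> hom k 1 1"
  using ord_Q_ord_hom[where r="\<lambda>_. 0" and t="\<lambda>_. 0"] by (simp add: ord_mon_zero)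

lemma Q_ord_mon_z: "k \<le> n \<Longrightarrow> Q k * ord_mon k z r = ord_mon k z r * Q k"
  using qcomm_ord_mon[OF q0, of k "Q k" z 0 r] Q_z_low[of _ k] by (simp add: scaleC_one)

lemma Q_ord_mon_w: "k \<le> n \<Longrightarrow> Q k * ord_mon k w r = ord_mon k w r * Q k"
  using qcomm_ord_mon[OF q0, of k "Q k" w 0 r] Q_w_low[of _ k] by (simp add: scaleC_one)

lemma Q_central:
  assumes "k \<le> n" "x \<in> hom k c d"
  shows "Q k * x = x * Q k"
  using assms(2)
proof (induction rule: bihom_induct)
  case (mon r t)
  then show ?case
    using Q_ord_mon_z[OF assms(1)] Q_ord_mon_w[OF assms(1)] by (metis mult.assoc)
qed (auto simp: distrib_left distrib_right scaleC_mult)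

text \<open>Every inner variable, z or w, costs the same factor q^-1, so the power of q depends only
  on the total degree.\<close>

lemma z_qcomm_hom:
  assumes "k < j" "j \<le> n" "x \<in> hom k c d"
  shows "z j * x = q powi (- (c + d)) *\<^sub>C (x * z j)"
  using assms(3)
proof (induction rule: bihom_induct)
  case (mon r t)
  have a: "z j * ord_mon k z r = q powi (-1 * int (\<Sum>i=1..k. r i)) *\<^sub>C (ord_mon k z r * z j)"
    by (rule qcomm_ord_mon[OF q0], rule zz_flip) (use assms in auto)
  have b: "z j * ord_mon k w t = q powi (-1 * int (\<Sum>i=1..k. t i)) *\<^sub>C (ord_mon k w t * z j)"
    by (rule qcomm_ord_mon[OF q0], rule wz_flip) (use assms in auto)
  have "z j * (ord_mon k z r * ord_mon k w t) = q powi (-c) *\<^sub>C (ord_mon k z r * (z j * ord_mon k w t))"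
    using a mon by (simp add: scaleC_mult mult.assoc[symmetric])
  also have "z j * ord_mon k w t = q powi (-d) *\<^sub>C (ord_mon k w t * z j)"
    using b mon by simp
  finally show ?case by (simp add: scaleC_mult mult.assoc qpow_add)
qed (auto simp: distrib_left distrib_right scaleC_mult scaleC_add_right mult.commute)

lemma w_qcomm_hom:
  assumes "k < j" "j \<le> n" "x \<in> hom k c d"
  shows "w j * x = q powi (c + d) *\<^sub>C (x * w j)"
  using assms(3)
proof (induction rule: bihom_induct)
  case (mon r t)
  have a: "w j * ord_mon k z r = q powi (1 * int (\<Sum>i=1..k. r i)) *\<^sub>C (ord_mon k z r * w j)"
    by (rule qcomm_ord_mon[OF q0], rule wz') (use assms in auto)
  have b: "w j * ord_mon k w t = q powi (- (-1) * int (\<Sum>i=1..k. t i)) *\<^sub>C (ord_mon k w t * w j)"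
    by (rule qcomm_ord_mon[OF q0], rule ww_flip) (use assms in auto)
  have "w j * (ord_mon k z r * ord_mon k w t) = q powi c *\<^sub>C (ord_mon k z r * (w j * ord_mon k w t))"
    using a mon by (simp add: scaleC_mult mult.assoc[symmetric])
  also have "w j * ord_mon k w t = q powi d *\<^sub>C (ord_mon k w t * w j)"
    using b mon by simp
  finally show ?case by (simp add: scaleC_mult mult.assoc qpow_add)
qed (auto simp: distrib_left distrib_right scaleC_mult scaleC_add_right mult.commute)

lemma qpow_power: "(q powi a) ^ m = q powi (a * int m)"
  using q0 by (induction m) (auto simp: algebra_simps power_int_add)

subsection \<open>Exchanging the roles of \<open>z\<close> and \<open>w\<close>\<close>

text \<open>The relations also hold for \<open>q\<^sup>-\<^sup>1\<close> with \<open>q\<^sup>-\<^sup>2\<^sup>iw\<^sub>i\<close> in the role of \<open>z\<^sub>i\<close> and \<open>z\<^sub>i\<close> in the role of \<open>w\<^sub>i\<close>.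
  This turns \<open>q\<^sup>2\<^sup>i\<close> times the \<open>i\<close>-th \<open>w\<close>-derivative into the \<open>i\<close>-th \<open>z\<close>-derivative.\<close>

definition zd :: "nat \<Rightarrow> 'a" where "zd i = q powi (- 2 * int i) *\<^sub>C w i"

text \<open>The corrections from w_k z_k telescope: their coefficients are differences of
  consecutive powers q^(-2k). This identifies the quadratic element of the dual data and also
  provides the sum in the last dual relation.\<close>

lemma sum_w_z: "k \<le> n \<Longrightarrow> (\<Sum>s=1..k. zd s * z s) = q powi (- 2 * int k) *\<^sub>C Q k"
proof (induction k)
  case (Suc k)
  have "zd (Suc k) * z (Suc k) = q powi (- 2 * int (Suc k)) *\<^sub>C (z (Suc k) * w (Suc k))
      + (q powi (- 2 * int (Suc k)) - q powi (- 2 * int k)) *\<^sub>C Q k"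
    unfolding zd_def mult_scaleC_left wz_Suc[OF Suc.prems]
    using qpow_add[of "- 2 * int (Suc k)" 2] by (simp add: scaleC_linear algebra_simps)
  then show ?case
    using Suc by (simp add: Q_Suc scaleC_add_right complex_vs.scale_left_diff_distrib)
qed simp

lemma dual: "q_relations_hold (inverse q) n zd z"
proof
  show "inverse q \<noteq> 0" using q0 by simp
  fix i j assume ij: "1 \<le> i" "i < j" "j \<le> n"
  show "zd i * zd j = inverse q *\<^sub>C (zd j * zd i)"
    using ww[OF ij] by (simp add: zd_def scaleC_mult mult.commute mult.left_commute)
  show "z i * z j = inverse (inverse q) *\<^sub>C (z j * z i)"
    using zz[OF ij] by simp
next
  fix i j assume ij: "1 \<le> i" "i \<le> n" "1 \<le> j" "j \<le> n" "i \<noteq> j"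
  show "z j * zd i = inverse q *\<^sub>C (zd i * z j)"
    using wz[of j i] ij q0 by (simp add: zd_def scaleC_mult)
next
  fix k assume k: "1 \<le> k" "k \<le> n"
  then obtain l where l: "k = Suc l" by (cases k) auto
  have "z k * zd k = q powi (- 2 * int k) *\<^sub>C (z k * w k)" by (simp add: zd_def scaleC_mult)
  also have "z k * w k = w k * z k - (1 - q\<^sup>2) *\<^sub>C Q l"
    using wz_Suc[of l] k l by simp
  also have "q powi (- 2 * int k) *\<^sub>C \<dots> = zd k * z k + (1 - (inverse q)\<^sup>2) *\<^sub>C (q powi (-2 * int l) *\<^sub>C Q l)"
  proof -
    have "q powi (- 2 * int k) * (1 - q\<^sup>2) = - ((1 - (inverse q)\<^sup>2) * q powi (- 2 * int l))"
      using qpow_add[of "- 2 * int l" "-2"] q0 unfolding l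
      by (simp add: field_simps power_int_minus power2_eq_square)
    then show ?thesis
      by (simp add: zd_def scaleC_linear)
  qed
  also have "q powi (-2 * int l) *\<^sub>C Q l = (\<Sum>s=1..<k. zd s * z s)"
    using sum_w_z[of l] k l by (simp add: atLeastLessThanSuc_atLeastAtMost)
  finally show "z k * zd k = zd k * z k + (1 - (inverse q)\<^sup>2) *\<^sub>C (\<Sum>s=1..<k. zd s * z s)" .
qed

lemma Qsum_dual: "k \<le> n \<Longrightarrow> Qsum k zd z = q powi (- 2 * int k) *\<^sub>C Q k"
  using sum_w_z by (simp add: Qsum_def)

lemma ord_mon_zd: "ord_mon k zd r = q powi (- 2 * (\<Sum>i=1..k. int i * int (r i))) *\<^sub>C ord_mon k w r"
proof -
  have "(\<Prod>i=1..k. (q powi (- 2 * int i)) ^ r i) = q powi (- 2 * (\<Sum>i=1..k. int i * int (r i)))"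
  proof (induction k)
    case (Suc k)
    then show ?case
      by (simp add: qpow_power qpow_add algebra_simps)
  qed simp
  then show ?thesis
    unfolding zd_def[abs_def] ord_mon_scale by simp
qed

text \<open>For the dual data the spanning monomials have their w's on the left. Both inclusions
  follow from multiplicativity of the bidegree, which holds on either side of the duality.\<close>

lemma hom_dual:
  assumes "k \<le> n"
  shows "bihom k zd z d c = hom k c d"
proof
  interpret d: q_relations_hold "inverse q" n zd z by (rule dual)
  show "hom k c d \<subseteq> bihom k zd z d c"
  proof
    fix x assume "x \<in> hom k c d"
    then show "x \<in> bihom k zd z d c"
    proof (induction rule: bihom_induct)
      case (mon r t)
      define e where "e = (\<Sum>i=1..k. int i * int (t i))"
      have w: "ord_mon k w t = q powi (2 * e) *\<^sub>C ord_mon k zd t"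
        unfolding ord_mon_zd e_def[symmetric] by (simp add: scaleC_scaleC qpow_add scaleC_one)
      have "ord_mon k z r * ord_mon k zd t \<in> bihom k zd z d c"
        using d.hom_mult[OF assms d.ord_mon_w_hom[OF assms, of r] d.ord_mon_z_hom[OF assms, of t]] mon
        by simp
      then show ?case unfolding w mult_scaleC_right by (rule bihom_scale)
    qed (auto intro: bihom_add bihom_scale)
  qed
  show "bihom k zd z d c \<subseteq> hom k c d"
  proof
    fix x assume "x \<in> bihom k zd z d c"
    then show "x \<in> hom k c d"
    proof (induction rule: bihom_induct)
      case (mon r t)
      have "ord_mon k w r * ord_mon k z t \<in> hom k c d"
        using hom_mult[OF assms ord_mon_w_hom[OF assms, of r] ord_mon_z_hom[OF assms, of t]] mon
        by simp
      then show ?case unfolding ord_mon_zd mult_scaleC_left by (rule bihom_scale)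
    qed (auto intro: bihom_add bihom_scale)
  qed
qed

end

section \<open>\<open>q\<close>-numbers and \<open>q\<close>-derivatives\<close>

lemma inverse_powi: "inverse q powi a = (q :: complex) powi (- a)"
  by (simp add: power_int_inverse power_int_minus)

lemma qnum_0 [simp]: "qnum q 0 = 0"
  by (simp add: qnum_def)

lemma qnum_inverse: "qnum (inverse q) a = qnum q a"
proof -
  have "inverse q - inverse (inverse q) = - (q - inverse q)" by simp
  then show ?thesis
    unfolding qnum_def inverse_powi
    by (metis (no_types) minus_diff_eq minus_divide_divide minus_minus)
qed

lemma qnum_add:
  assumes "q \<noteq> 0"
  shows "qnum q (a + b) = q powi b * qnum q a + q powi (- a) * qnum q b"
proof -
  have "q powi (a + b) - q powi (- (a + b)) =
      q powi b * (q powi a - q powi (- a)) + q powi (- a) * (q powi b - q powi (- b))"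
    using assms by (simp add: right_diff_distrib power_int_add[symmetric] algebra_simps)
  then show ?thesis by (simp add: qnum_def add_divide_distrib)
qed

lemma qnum_1: "q - inverse q \<noteq> 0 \<Longrightarrow> qnum q 1 = 1"
  by (simp add: qnum_def power_int_minus)

lemma qnum_mult: "q - inverse q \<noteq> 0 \<Longrightarrow> (q - inverse q) * qnum q a = q powi a - q powi (- a)"
  by (simp add: qnum_def)

definition lo :: "(nat \<Rightarrow> nat) \<Rightarrow> nat \<Rightarrow> int" where "lo r j = int (\<Sum>i=1..<j. r i)"
definition hi :: "nat \<Rightarrow> (nat \<Rightarrow> nat) \<Rightarrow> nat \<Rightarrow> int" where "hi k r j = int (\<Sum>i=j+1..k. r i)"

lemma sum_upd:
  "finite A \<Longrightarrow> int (\<Sum>i\<in>A. (r(j := x)) i) =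
    int (\<Sum>i\<in>A. r i) + (if j \<in> A then int x - int (r j) else 0)"
proof (cases "j \<in> A")
  case True
  assume "finite A"
  then have "(\<Sum>i\<in>A. f i) = f j + (\<Sum>i\<in>A-{j}. f i)" for f :: "'a \<Rightarrow> nat"
    using True by (intro sum.remove) auto
  note this[of r] this[of "r(j := x)"]
  moreover have "(\<Sum>i\<in>A-{j}. (r(j := x)) i) = (\<Sum>i\<in>A-{j}. r i)"
    by (rule sum.cong) auto
  ultimately show ?thesis using True by simp
qed (simp add: sum_upd_notin del: fun_upd_apply)

lemma lo_upd: "lo (r(j := x)) i = lo r i + (if 1 \<le> j \<and> j < i then int x - int (r j) else 0)"
  unfolding lo_def by (subst sum_upd) auto

lemma hi_upd: "hi k (r(j := x)) i = hi k r i + (if i < j \<and> j \<le> k then int x - int (r j) else 0)"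
  unfolding hi_def by (subst sum_upd) auto

lemma lo_hi:
  assumes "1 \<le> j" "j \<le> k"
  shows "lo r j + int (r j) + hi k r j = int (\<Sum>i=1..k. r i)"
proof -
  have "{1..k} = insert j ({1..<j} \<union> {j+1..k})" "{1..<j} \<inter> {j+1..k} = {}" using assms by auto
  then show ?thesis
    unfolding lo_def hi_def by (simp add: sum.union_disjoint)
qed

text \<open>A telescoping sum: adding the variable \<open>Suc k\<close> turns \<open>[A]\<close> into \<open>q\<^sup>b [A] + q\<^sup>-\<^sup>A [b] = [A + b]\<close>.\<close>

lemma qnum_sum:
  assumes "q \<noteq> 0"
  shows "(\<Sum>i=1..k. q powi ((\<Sum>j=i+1..k. f j) - (\<Sum>j=1..<i. f j)) * qnum q (f i)) =
    qnum q (\<Sum>i=1..k::nat. f i :: int)"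
proof (induction k)
  case (Suc k)
  have "(\<Sum>i=1..Suc k. q powi ((\<Sum>j=i+1..Suc k. f j) - (\<Sum>j=1..<i. f j)) * qnum q (f i)) =
    q powi f (Suc k) * (\<Sum>i=1..k. q powi ((\<Sum>j=i+1..k. f j) - (\<Sum>j=1..<i. f j)) * qnum q (f i)) +
    q powi (- (\<Sum>j=1..k. f j)) * qnum q (f (Suc k))"
    unfolding sum_distrib_left
    using assms
    by (simp add: atLeastLessThanSuc_atLeastAtMost mult.assoc[symmetric] power_int_add[symmetric])
      (simp add: algebra_simps)
  then show ?case
    unfolding Suc.IH using qnum_add[OF assms, of "\<Sum>i=1..k. f i" "f (Suc k)"] by simp
qed simp

lemma linear_scaleC_iff:
  "Vector_Spaces.linear scaleC scaleC (D :: 'a::complex_algebra_1 \<Rightarrow> 'a) \<longleftrightarrow>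
    (\<forall>x y. D (x + y) = D x + D y) \<and> (\<forall>c x. D (c *\<^sub>C x) = c *\<^sub>C D x)"
  using complex_vs.vector_space_axioms by (auto simp: Vector_Spaces.linear_iff)

text \<open>The predicate inside the description of \<open>dz\<close>, named so that the calculus
  applies to any map satisfying it, in particular to the rescaled w-derivatives at the dual
  data.\<close>

definition is_dz ::
    "complex \<Rightarrow> nat \<Rightarrow> (nat \<Rightarrow> 'a) \<Rightarrow> (nat \<Rightarrow> 'a) \<Rightarrow> nat \<Rightarrow> ('a::complex_algebra_1 \<Rightarrow> 'a) \<Rightarrow> bool" where
  "is_dz q n z w i D \<longleftrightarrow> Vector_Spaces.linear scaleC scaleC D \<and>
     (\<forall>r t. D (ord_mon n z r * ord_mon n w t) =
       (q powi int (\<Sum>j=i+1..n. r j) * qnum q (int (r i))) *\<^sub>C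
         (ord_mon n z (r(i := r i - 1)) * ord_mon n w t))"

definition is_dw ::
    "complex \<Rightarrow> nat \<Rightarrow> (nat \<Rightarrow> 'a) \<Rightarrow> (nat \<Rightarrow> 'a) \<Rightarrow> nat \<Rightarrow> ('a::complex_algebra_1 \<Rightarrow> 'a) \<Rightarrow> bool" where
  "is_dw q n z w i D \<longleftrightarrow> Vector_Spaces.linear scaleC scaleC D \<and>
     (\<forall>r t. D (ord_mon n w r * ord_mon n z t) =
       (q powi (- int (\<Sum>j=i+1..n. r j)) * qnum q (int (r i))) *\<^sub>C
         (ord_mon n w (r(i := r i - 1)) * ord_mon n z t))"

locale q_derivative = q_relations_hold +
  fixes i :: nat and D :: "'a \<Rightarrow> 'a"
  assumes i_le: "1 \<le> i" "i \<le> n"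
    and D: "is_dz q n z w i D"
    and qq: "q - inverse q \<noteq> 0"
begin

lemma D_add: "D (x + y) = D x + D y"
  and D_scale: "D (c *\<^sub>C x) = c *\<^sub>C D x"
  using D by (auto simp: is_dz_def linear_scaleC_iff)

lemma D_0 [simp]: "D 0 = 0"
  using D_scale[of 0 0] by simp

lemma D_sum: "D (sum f A) = (\<Sum>x\<in>A. D (f x))"
  by (induction A rule: infinite_finite_induct) (auto simp: D_add)

lemma D_mon:
  assumes "i \<le> k" "k \<le> n"
  shows "D (ord_mon k z r * ord_mon k w t) =
    (q powi hi k r i * qnum q (int (r i))) *\<^sub>C (ord_mon k z (r(i := r i - 1)) * ord_mon k w t)"
proof -
  define r' where "r' = (\<lambda>j. if j \<le> k then r j else 0)"
  define t' where "t' = (\<lambda>j. if j \<le> k then t j else 0)"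
  have *: "r'(i := r' i - 1) = (\<lambda>j. if j \<le> k then (r(i := r i - 1)) j else 0)"
    using assms by (auto simp: r'_def)
  have "(\<Sum>j=i+1..n. r' j) = (\<Sum>j=i+1..k. r j)"
    unfolding r'_def by (rule sum.mono_neutral_cong_right) (use assms in auto)
  then have **: "int (\<Sum>j=i+1..n. r' j) = hi k r i" by (simp add: hi_def)
  have "ord_mon k z r * ord_mon k w t = ord_mon n z r' * ord_mon n w t'"
    unfolding r'_def t'_def by (simp only: ord_mon_extend[OF assms(2)])
  then have "D (ord_mon k z r * ord_mon k w t) =
    (q powi hi k r i * qnum q (int (r' i))) *\<^sub>C (ord_mon n z (r'(i := r' i - 1)) * ord_mon n w t')"
    using D[unfolded is_dz_def] ** by simp
  also have "ord_mon n z (r'(i := r' i - 1)) * ord_mon n w t' =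
      ord_mon k z (r(i := r i - 1)) * ord_mon k w t"
    unfolding * t'_def by (simp only: ord_mon_extend[OF assms(2)])
  also have "r' i = r i" using assms by (simp add: r'_def)
  finally show ?thesis .
qed

lemma D_high:
  assumes "k < i" "x \<in> hom k c d"
  shows "D x = 0"
  using assms(2)
proof (induction rule: bihom_induct)
  case (mon r t)
  define r' where "r' = (\<lambda>j. if j \<le> k then r j else 0)"
  define t' where "t' = (\<lambda>j. if j \<le> k then t j else 0)"
  have "k \<le> i" using assms by simp
  then have "ord_mon k z r * ord_mon k w t = ord_mon i z r' * ord_mon i w t'"
    unfolding r'_def t'_def by (simp only: ord_mon_extend)
  moreover have "r' i = 0" using assms by (simp add: r'_def)
  ultimately show ?case using D_mon[OF order_refl i_le(2), of r' t'] by simp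
qed (auto simp: D_add D_scale)

lemma D_hom:
  assumes "k \<le> n" "x \<in> hom k c d"
  shows "D x \<in> hom k (c - 1) d"
proof (cases "i \<le> k")
  case True
  show ?thesis
    using assms(2)
  proof (induction rule: bihom_induct)
    case (mon r t)
    show ?case
    proof (cases "r i = 0")
      case True
      then show ?thesis using D_mon[OF \<open>i \<le> k\<close> assms(1), of r t] by simp
    next
      case False
      then show ?thesis
        unfolding D_mon[OF \<open>i \<le> k\<close> assms(1)]
        by (intro bihom_scale bihom_mon) (use mon sum_upd_pred[OF i_le(1) \<open>i \<le> k\<close>, of r] in auto)
    qed
  qed (auto simp: D_add D_scale bihom_add bihom_scale)
next
  case False
  then show ?thesis using D_high[OF _ assms(2)] by simp
qed

lemma D_mon_w:
  assumes "i \<le> k" "k \<le> n" "1 \<le> j" "j \<le> k"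
  shows "D (ord_mon k z r * (w j * ord_mon k w t)) =
    (q powi hi k r i * qnum q (int (r i))) *\<^sub>C (ord_mon k z (r(i := r i - 1)) * (w j * ord_mon k w t))"
  unfolding w_ord_mon_w[OF assms(3,4,2)] mult_scaleC_right D_scale D_mon[OF assms(1,2)]
  by (simp add: scaleC_scaleC mult.commute)

text \<open>Right multiplication by \<open>w j\<close> changes only the w-part of an ordered
  monomial, and \<open>D\<close> acts only on the z-part.\<close>

lemma D_mult_w:
  assumes "k \<le> n" "1 \<le> j" "j \<le> n" "x \<in> hom k c d"
  shows "D (x * w j) = D x * w j"
  using bihom_mono[OF assms(1,4)]
proof (induction rule: bihom_induct)
  case (mon r t)
  show ?case
    unfolding mult.assoc ord_mon_w_w[OF assms(2,3) order_refl] mult_scaleC_right D_scale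
      D_mon[OF i_le(2) order_refl] mult_scaleC_left
    by (simp add: scaleC_scaleC mult.commute)
qed (auto simp: D_add D_scale distrib_right mult_scaleC_left)

lemma D_mult_w_power:
  assumes "k \<le> n" "1 \<le> j" "j \<le> n" "x \<in> hom k c d"
  shows "D (x * w j ^ b) = D x * w j ^ b"
proof (induction b)
  case (Suc b)
  have "x * w j ^ b \<in> hom n (c + int b * 0) (d + int b * 1)"
    by (intro hom_mult hom_power w_hom bihom_mono[OF assms(1,4)] order_refl assms)
  then show ?case
    using D_mult_w[OF order_refl assms(2,3)] Suc by (simp add: power_Suc2 flip: mult.assoc del: power_Suc)
qed simp

text \<open>No power of q appears. If i < j, raising \<open>r j\<close> adds one to the exponent
  \<open>hi\<close> of the derivative, while lowering \<open>r i\<close> takes one from the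
  \<open>lo\<close> paid by \<open>z j\<close>; the two changes cancel. If j < i, neither exponent
  changes.\<close>

lemma D_z_comm:
  assumes "1 \<le> j" "j \<le> n" "j \<noteq> i" "k \<le> n" "x \<in> hom k c d"
  shows "D (z j * x) = z j * D x"
  using bihom_mono[OF assms(4,5)]
proof (induction rule: bihom_induct)
  case (mon r t)
  have r: "r(j := Suc (r j), i := (r(j := Suc (r j))) i - 1) = r(i := r i - 1, j := Suc ((r(i := r i - 1)) j))"
    using assms by auto
  have c: "q powi - lo r j * q powi hi n (r(j := Suc (r j))) i * qnum q (int ((r(j := Suc (r j))) i)) =
    q powi hi n r i * qnum q (int (r i)) * q powi (- lo (r(i := r i - 1)) j)"
  proof (cases "r i = 0")
    case r0: False
    have "hi n (r(j := Suc (r j))) i = hi n r i + (if j < i then 0 else 1)"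
      using assms by (auto simp: hi_upd)
    moreover have "lo (r(i := r i - 1)) j = lo r j - (if j < i then 0 else 1)"
      using r0 assms i_le by (auto simp: lo_upd of_nat_diff)
    moreover have "q powi - lo r j * q powi (hi n r i + (if j < i then 0 else 1)) =
        q powi hi n r i * q powi - (lo r j - (if j < i then 0 else 1))"
      by (auto simp add: qpow_add algebra_simps)
    ultimately show ?thesis
      using assms by (simp add: mult_ac)
  qed (use assms in simp)
  show ?case
    unfolding mult.assoc[symmetric] z_ord_mon_z[OF assms(1,2) order_refl] scaleC_mult D_scale
      D_mon[OF i_le(2) order_refl]
    unfolding r lo_def[symmetric] hi_def[symmetric] c ..
qed (auto simp: D_add D_scale distrib_left mult_scaleC_right)

lemma D_z_power_comm:
  assumes "1 \<le> j" "j \<le> n" "j \<noteq> i" "k \<le> n" "x \<in> hom k c d"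
  shows "D (z j ^ a * x) = z j ^ a * D x"
proof (induction a)
  case (Suc a)
  have "z j ^ a * x \<in> hom n (int a * 1 + c) (int a * 0 + d)"
    by (intro hom_mult hom_power z_hom bihom_mono[OF assms(4,5)] order_refl assms)
  then show ?case
    using D_z_comm[OF assms(1-3) order_refl] Suc by (simp add: mult.assoc)
qed simp

text \<open>Raising undoes lowering, so ordered monomials are eigenvectors. The eigenvalues have the
  shape summed by \<open>qnum_sum\<close>, which is how the Euler identities arise.\<close>

lemma z_D_mon:
  assumes "i \<le> k" "k \<le> n"
  shows "z i * D (ord_mon k z r * ord_mon k w t) =
    (q powi (hi k r i - lo r i) * qnum q (int (r i))) *\<^sub>C (ord_mon k z r * ord_mon k w t)"
proof (cases "r i = 0")
  case False
  then have r: "r(i := r i - 1, i := Suc ((r(i := r i - 1)) i)) = r" by auto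
  show ?thesis
    unfolding D_mon[OF assms] scaleC_mult mult.assoc[symmetric] z_ord_mon_z[OF i_le(1) assms]
    unfolding r lo_def[symmetric] 
    using q0 by (simp add: lo_upd power_int_diff power_int_minus divide_inverse mult_ac)
qed (simp add: D_mon[OF assms])

lemma D_z_mon:
  assumes "i \<le> k" "k \<le> n"
  shows "D (z i * (ord_mon k z r * ord_mon k w t)) =
    (q powi (hi k r i - lo r i) * qnum q (int (r i) + 1)) *\<^sub>C (ord_mon k z r * ord_mon k w t)"
proof -
  have r: "r(i := Suc (r i), i := (r(i := Suc (r i))) i - 1) = r" by auto
  show ?thesis
    unfolding mult.assoc[symmetric] z_ord_mon_z[OF i_le(1) assms] scaleC_mult D_scale D_mon[OF assms]
    unfolding r lo_def[symmetric] 
    using q0 by (simp add: hi_upd power_int_diff power_int_minus divide_inverse mult_ac add.commute)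
qed

text \<open>Bringing z_i^a to its ordered place, after the other z's and before the w's, costs
  q^(-ca); returning z_i^(a-1) gives back q^(c(a-1)). The net factor is q^-c, independent of the
  w-degree.\<close>

lemma D_top:
  assumes "i = Suc k" "x \<in> hom k c d"
  shows "D (z i ^ a * x) = (q powi (- c) * qnum q (int a)) *\<^sub>C (z i ^ (a - 1) * x)"
  using assms(2)
proof (induction rule: bihom_induct)
  case (mon r t)
  define t' where "t' = (\<lambda>j. if j \<le> k then t j else 0)"
  have ki: "k \<le> i" using assms by simp
  have mz: "z i ^ b * ord_mon k z r = q powi (- c * int b) *\<^sub>C ord_mon i z (r(i := b))" for b
  proof -
    have "z i * ord_mon k z r = q powi (-1 * int (\<Sum>i=1..k. r i)) *\<^sub>C (ord_mon k z r * z i)"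
      by (rule qcomm_ord_mon[OF q0], rule zz_flip) (use assms i_le in auto)
    then have "z i ^ b * ord_mon k z r = q powi (-1 * int (\<Sum>i=1..k. r i) * int b) *\<^sub>C (ord_mon k z r * z i ^ b)"
      by (rule qcomm_power_left[OF q0])
    moreover have "ord_mon k z (r(i := b)) = ord_mon k z r"
      by (rule ord_mon_cong) (use assms in auto)
    ultimately show ?thesis using mon by (simp add: assms ord_mon_Suc del: of_nat_sum)
  qed
  have mw: "ord_mon k w t = ord_mon i w t'"
    unfolding t'_def by (simp only: ord_mon_extend[OF ki])
  have m: "z i ^ b * (ord_mon k z r * ord_mon k w t) =
      q powi (- c * int b) *\<^sub>C (ord_mon i z (r(i := b)) * ord_mon i w t')" for b
    by (simp add: mult.assoc[symmetric] mz mult_scaleC_left mw)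
  have h: "hi i (r(i := a)) i = 0" by (simp add: hi_def)
  show ?case
  proof (cases "a = 0")
    case True
    then show ?thesis
      unfolding m D_scale D_mon[OF order_refl i_le(2)] by simp
  next
    case False
    then have "- c * int a = - c + - c * int (a - 1)" by (simp add: algebra_simps of_nat_diff)
    then have "q powi (- c * int a) = q powi (- c) * q powi (- c * int (a - 1))"
      by (simp only: qpow_add)
    then show ?thesis
      unfolding m D_scale D_mon[OF order_refl i_le(2)] h by (simp add: scaleC_mult mult_ac)
  qed
qed (auto simp: D_add D_scale distrib_left scaleC_mult scaleC_add_right mult.commute)

text \<open>\<open>Q k\<close> commutes with the z-part and is inserted between the z-part and the
  w-part, where each summand z_j w_j again gives an ordered monomial. Summands with j < i acquire
  q^-1 where the others acquire q. Their deviation is a multiple of \<open>Q (i - 1)\<close> in the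
  middle, which is just the correction created when w_i is moved through the z-part.\<close>

lemma D_Q:
  assumes "i \<le> k" "k \<le> n" "x \<in> hom k c d"
  shows "D (Q k * x) = q *\<^sub>C (Q k * D x) + q powi (- c) *\<^sub>C (w i * x)"
  using assms(3)
proof (induction rule: bihom_induct)
  case (mon r t)
  let ?R = "r(i := r i - 1)" and ?T = "ord_mon k w t"
  define C where "C = q powi hi k r i * qnum q (int (r i))"
  define T where "T j = C *\<^sub>C (ord_mon k z ?R * z j * (w j * ?T))" for j
  define Y where "Y = ord_mon k z r * (w i * ?T)"
  \<comment> \<open>The additional term at j = i comes from [r_i + 1] = q [r_i] + q^(-r_i).\<close>
  have Dj: "D (ord_mon k z r * z j * (w j * ?T)) =
      q powi (if j < i then -1 else 1) *\<^sub>C T j + (if j = i then q powi (- int (r i)) *\<^sub>C Y else 0)"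
    if j: "1 \<le> j" "j \<le> k" for j
  proof (cases "j = i")
    case True
    have r: "r(i := Suc (r i), i := (r(i := Suc (r i))) i - 1) = r" by auto
    have 1: "D (ord_mon k z r * z i * (w i * ?T)) = qnum q (int (r i) + 1) *\<^sub>C Y"
      unfolding ord_mon_z_z[OF i_le(1) assms(1,2)] mult_scaleC_left D_scale D_mon_w[OF assms(1,2) i_le(1) assms(1)] Y_def
      unfolding r hi_def[symmetric] by (simp add: hi_upd scaleC_scaleC qpow_add' add.commute)
    have 2: "T i = qnum q (int (r i)) *\<^sub>C Y"
    proof (cases "r i = 0")
      case False
      then have r: "r(i := r i - 1, i := Suc ((r(i := r i - 1)) i)) = r" by auto
      show ?thesis
        unfolding T_def C_def ord_mon_z_z[OF i_le(1) assms(1,2)] mult_scaleC_left Y_def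
        unfolding r hi_def[symmetric]
        by (simp add: hi_upd scaleC_scaleC power_int_minus q0)
    qed (simp add: T_def C_def)
    show ?thesis
      unfolding True 1 2 using qnum_add[OF q0, of "int (r i)" 1] qnum_1[OF qq]
      by (simp add: scaleC_scaleC flip: scaleC_add_left)
  next
    case False
    have r: "r(j := Suc (r j), i := (r(j := Suc (r j))) i - 1) = r(i := r i - 1, j := Suc ((r(i := r i - 1)) j))"
      using False by auto
    have c: "q powi - hi k r j * (q powi hi k (r(j := Suc (r j))) i * qnum q (int ((r(j := Suc (r j))) i))) =
        q powi (if j < i then - 1 else 1) * (C * q powi (- hi k ?R j))"
    proof (cases "r i = 0")
      case r0: False
      have "hi k (r(j := Suc (r j))) i = hi k r i + (if j < i then 0 else 1)"
        using False j by (auto simp: hi_upd)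
      moreover have "hi k ?R j = hi k r j - (if j < i then 1 else 0)"
        using r0 assms by (auto simp: hi_upd of_nat_diff)
      moreover have "q powi (if j < i then - 1 else 1) * (q powi hi k r i * q powi - (hi k r j - (if j < i then 1 else 0))) =
          q powi - hi k r j * q powi (hi k r i + (if j < i then 0 else 1))"
        by (auto simp add: qpow_add algebra_simps)
      ultimately show ?thesis
        using False unfolding C_def by (simp add: mult_ac)
    qed (use False in \<open>simp add: C_def\<close>)
    show ?thesis
      unfolding T_def ord_mon_z_z[OF j assms(2)] scaleC_mult D_scale D_mon_w[OF assms(1,2) j]
      unfolding r hi_def[symmetric] c using False by (simp add: mult.assoc)
  qed
  have sumT: "(\<Sum>j=1..l. T j) = C *\<^sub>C (ord_mon k z ?R * Q l * ?T)" for l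
    unfolding T_def Qsum_def by (simp add: sum_distrib_left sum_distrib_right complex_vs.scale_sum_right mult.assoc)
  have "D (Q k * (ord_mon k z r * ?T)) = D (ord_mon k z r * Q k * ?T)"
    using Q_ord_mon_z[OF assms(2), of r] by (simp add: mult.assoc[symmetric])
  also have "\<dots> = (\<Sum>j=1..k. D (ord_mon k z r * z j * (w j * ?T)))"
    unfolding Qsum_def by (simp add: sum_distrib_left sum_distrib_right D_sum mult.assoc)
  also have "\<dots> = (\<Sum>j=1..k. q *\<^sub>C T j + (if j < i then (inverse q - q) *\<^sub>C T j else 0)
      + (if j = i then q powi (- int (r i)) *\<^sub>C Y else 0))"
    by (intro sum.cong refl) (subst Dj, auto simp: power_int_minus complex_vs.scale_left_diff_distrib)
  also have "\<dots> = q *\<^sub>C (\<Sum>j=1..k. T j) + (inverse q - q) *\<^sub>C (\<Sum>j=1..i-1. T j) + q powi (- int (r i)) *\<^sub>C Y"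
  proof -
    have "(\<Sum>j=1..k. if j < i then (inverse q - q) *\<^sub>C T j else 0) = (\<Sum>j=1..i-1. (inverse q - q) *\<^sub>C T j)"
      by (rule sum.mono_neutral_cong_right) (use assms i_le in auto)
    moreover have "(\<Sum>j=1..k. if j = i then q powi (- int (r i)) *\<^sub>C Y else 0) = q powi (- int (r i)) *\<^sub>C Y"
      using assms i_le by simp
    ultimately show ?thesis
      by (simp add: sum.distrib complex_vs.scale_sum_right)
  qed
  also have "(\<Sum>j=1..k. T j) = Q k * D (ord_mon k z r * ?T)"
    unfolding sumT D_mon[OF assms(1,2)] C_def[symmetric] mult_scaleC_right
    using Q_ord_mon_z[OF assms(2), of ?R] by (simp add: mult.assoc[symmetric])
  also have "q *\<^sub>C (Q k * D (ord_mon k z r * ?T)) + (inverse q - q) *\<^sub>C (\<Sum>j=1..i-1. T j) + q powi (- int (r i)) *\<^sub>C Y =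
      q *\<^sub>C (Q k * D (ord_mon k z r * ?T)) +
      ((inverse q - q) *\<^sub>C (\<Sum>j=1..i-1. T j) + q powi (- int (r i)) *\<^sub>C Y)"
    by (simp add: add.assoc)
  \<comment> \<open>Read backwards, this is the reordering rule for w_i; splitting c into the
    exponents left of i, at i and right of i matches the two coefficients.\<close>
  also have "(inverse q - q) *\<^sub>C (\<Sum>j=1..i-1. T j) + q powi (- int (r i)) *\<^sub>C Y =
      q powi (- c) *\<^sub>C (w i * (ord_mon k z r * ?T))"
  proof -
    have lh: "c = lo r i + int (r i) + hi k r i"
      using lo_hi[OF i_le(1) assms(1), of r] mon by simp
    have "w i * (ord_mon k z r * ?T) = q powi (lo r i + hi k r i) *\<^sub>C Y +
        (q powi (lo r i + 2 * hi k r i) * (1 - q powi (2 * int (r i)))) *\<^sub>C (ord_mon k z ?R * Q (i - 1) * ?T)"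
      using w_ord_mon_z[OF i_le(1) assms(1,2), of r]
      by (simp add: mult.assoc[symmetric] distrib_right scaleC_mult lo_def hi_def Y_def)
    moreover have "q powi (- c) * q powi (lo r i + hi k r i) = q powi (- int (r i))"
      unfolding lh by (simp add: qpow_add)
    moreover have "q powi (- c) * (q powi (lo r i + 2 * hi k r i) * (1 - q powi (2 * int (r i)))) =
        (inverse q - q) * C"
    proof -
      have "(inverse q - q) * C = - (q powi hi k r i * ((q - inverse q) * qnum q (int (r i))))"
        by (simp add: C_def algebra_simps)
      also have "\<dots> = q powi (hi k r i - int (r i)) * (1 - q powi (2 * int (r i)))"
        unfolding qnum_mult[OF qq] by (simp add: right_diff_distrib qpow_add algebra_simps)
      finally show ?thesis
        unfolding lh qpow_add' by simp
    qed
    ultimately show ?thesis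
      unfolding sumT by (simp add: scaleC_add_right scaleC_scaleC)
  qed
  finally show ?case .
qed (auto simp: D_add D_scale distrib_left scaleC_mult scaleC_add_right mult.commute)

end

section \<open>Euler identities and the transfer from w-derivatives to z-derivatives\<close>

context q_relations_hold
begin

lemma euler_z_D:
  assumes D: "\<And>i. 1 \<le> i \<Longrightarrow> i \<le> n \<Longrightarrow> is_dz q n z w i (D i)" and qq: "q - inverse q \<noteq> 0"
    and k: "k \<le> n" and x: "x \<in> hom k c d"
  shows "(\<Sum>i=1..k. z i * D i x) = qnum q c *\<^sub>C x"
proof -
  have loc: "q_derivative q n z w i (D i)" if "i \<in> {1..k}" for i
    using that k D qq q_relations_hold_axioms
    by (intro q_derivative.intro q_derivative_axioms.intro) auto
  show ?thesis
    using x
  proof (induction rule: bihom_induct)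
    case (mon r t)
    have "(\<Sum>i=1..k. z i * D i (ord_mon k z r * ord_mon k w t)) =
      (\<Sum>i=1..k. (q powi (hi k r i - lo r i) * qnum q (int (r i))) *\<^sub>C (ord_mon k z r * ord_mon k w t))"
      using k by (intro sum.cong refl) (auto simp: q_derivative.z_D_mon[OF loc])
    also have "\<dots> = qnum q c *\<^sub>C (ord_mon k z r * ord_mon k w t)"
      unfolding complex_vs.scale_sum_left[symmetric]
      using qnum_sum[OF q0, of "\<lambda>j. int (r j)" k] mon by (simp add: hi_def lo_def)
    finally show ?case .
  next
    case (scale a x)
    have "(\<Sum>i=1..k. z i * D i (a *\<^sub>C x)) = a *\<^sub>C (\<Sum>i=1..k. z i * D i x)"
      by (simp add: q_derivative.D_scale[OF loc] complex_vs.scale_sum_right mult_scaleC_right)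
    then show ?case unfolding scale by (simp add: scaleC_scaleC mult_ac)
  qed (simp_all add: q_derivative.D_add[OF loc] q_derivative.D_0[OF loc]
      distrib_left sum.distrib scaleC_add_right)
qed

text \<open>Up to the constant q^(1-k), the weights q^(-2(i-1)) replace each exponent r_j in the
  telescoping sum by r_j + 1. The total c is thereby shifted to c + k.\<close>

lemma euler_D_z:
  assumes D: "\<And>i. 1 \<le> i \<Longrightarrow> i \<le> n \<Longrightarrow> is_dz q n z w i (D i)" and qq: "q - inverse q \<noteq> 0"
    and k: "k \<le> n" and x: "x \<in> hom k c d"
  shows "(\<Sum>i=1..k. q powi (- 2 * (int i - 1)) *\<^sub>C D i (z i * x)) =
    (q powi (1 - int k) * qnum q (c + int k)) *\<^sub>C x"
proof -
  have loc: "q_derivative q n z w i (D i)" if "i \<in> {1..k}" for i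
    using that k D qq q_relations_hold_axioms
    by (intro q_derivative.intro q_derivative_axioms.intro) auto
  show ?thesis
    using x
  proof (induction rule: bihom_induct)
    case (mon r t)
    let ?f = "\<lambda>j. int (r j) + 1"
    have e: "- 2 * (int i - 1) + (hi k r i - lo r i) =
        1 - int k + ((\<Sum>j=i+1..k. ?f j) - (\<Sum>j=1..<i. ?f j))" if "i \<in> {1..k}" for i
      using that by (simp add: hi_def lo_def sum.distrib of_nat_diff algebra_simps)
    have "(\<Sum>i=1..k. q powi (- 2 * (int i - 1)) *\<^sub>C D i (z i * (ord_mon k z r * ord_mon k w t))) =
      (\<Sum>i=1..k. (q powi (1 - int k) * (q powi ((\<Sum>j=i+1..k. ?f j) - (\<Sum>j=1..<i. ?f j)) * qnum q (?f i)))
        *\<^sub>C (ord_mon k z r * ord_mon k w t))"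
    proof (rule sum.cong[OF refl])
      fix i assume i: "i \<in> {1..k}"
      show "q powi (- 2 * (int i - 1)) *\<^sub>C D i (z i * (ord_mon k z r * ord_mon k w t)) =
        (q powi (1 - int k) * (q powi ((\<Sum>j=i+1..k. ?f j) - (\<Sum>j=1..<i. ?f j)) * qnum q (?f i)))
        *\<^sub>C (ord_mon k z r * ord_mon k w t)"
        using i k by (subst q_derivative.D_z_mon[OF loc])
          (auto simp only: scaleC_scaleC qpow_add' e[OF i] atLeastAtMost_iff)
    qed
    also have "\<dots> = (q powi (1 - int k) * qnum q (c + int k)) *\<^sub>C (ord_mon k z r * ord_mon k w t)"
      unfolding complex_vs.scale_sum_left[symmetric] sum_distrib_left[symmetric] qnum_sum[OF q0]
      using mon by (simp add: sum.distrib)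
    finally show ?case .
  next
    case (scale a x)
    have "(\<Sum>i=1..k. q powi (- 2 * (int i - 1)) *\<^sub>C D i (z i * (a *\<^sub>C x))) =
        a *\<^sub>C (\<Sum>i=1..k. q powi (- 2 * (int i - 1)) *\<^sub>C D i (z i * x))"
      unfolding complex_vs.scale_sum_right
      by (rule sum.cong) (auto simp: q_derivative.D_scale[OF loc] mult_scaleC_right scaleC_scaleC mult.commute)
    then show ?case unfolding scale by (simp add: scaleC_scaleC mult_ac)
  qed (simp_all add: q_derivative.D_add[OF loc] q_derivative.D_0[OF loc]
      distrib_left sum.distrib scaleC_add_right)
qed

lemma is_dz_dual:
  assumes "is_dw q n z w i E" "1 \<le> i" "i \<le> n"
  shows "is_dz (inverse q) n zd z i (\<lambda>x. q powi (2 * int i) *\<^sub>C E x)"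
  unfolding is_dz_def linear_scaleC_iff
proof (intro conjI allI)
  have E: "E (x + y) = E x + E y" "E (a *\<^sub>C x) = a *\<^sub>C E x" for x y a
    using assms(1) by (auto simp: is_dw_def linear_scaleC_iff)
  show "q powi (2 * int i) *\<^sub>C E (x + y) = q powi (2 * int i) *\<^sub>C E x + q powi (2 * int i) *\<^sub>C E y" for x y
    by (simp add: E scaleC_add_right)
  show "q powi (2 * int i) *\<^sub>C E (a *\<^sub>C x) = a *\<^sub>C q powi (2 * int i) *\<^sub>C E x" for a x
    by (simp add: E scaleC_scaleC mult.commute)
  fix r t
  let ?e = "\<lambda>r. \<Sum>j=1..n. int j * int (r j)"
  show "q powi (2 * int i) *\<^sub>C E (ord_mon n zd r * ord_mon n z t) =
      (inverse q powi int (\<Sum>j=i+1..n. r j) * qnum (inverse q) (int (r i))) *\<^sub>C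
      (ord_mon n zd (r(i := r i - 1)) * ord_mon n z t)"
  proof (cases "r i = 0")
    case True
    then show ?thesis
      unfolding ord_mon_zd mult_scaleC_left E
      using assms(1) by (simp add: is_dw_def)
  next
    case False
    have "?e r = int i * int (r i) + (\<Sum>j\<in>{1..n}-{i}. int j * int (r j))"
      by (rule sum.remove) (use assms in auto)
    moreover have "?e (r(i := r i - 1)) = int i * int (r i - 1) + (\<Sum>j\<in>{1..n}-{i}. int j * int ((r(i := r i - 1)) j))"
      by (subst sum.remove[of _ i]) (use assms in auto)
    moreover have "(\<Sum>j\<in>{1..n}-{i}. int j * int ((r(i := r i - 1)) j)) = (\<Sum>j\<in>{1..n}-{i}. int j * int (r j))"
      by (rule sum.cong) auto
    \<comment> \<open>Lowering \<open>r i\<close> changes the rescaling between \<open>zd\<close>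
      and \<open>w\<close> by q^(-2i), which the factor q^(2i) in front of \<open>E\<close>
      absorbs.\<close>
    ultimately have e: "?e r = ?e (r(i := r i - 1)) + int i"
      using False by (simp add: of_nat_diff algebra_simps)
    have "E (ord_mon n w r * ord_mon n z t) =
       (q powi (- int (\<Sum>j=i+1..n. r j)) * qnum q (int (r i))) *\<^sub>C
         (ord_mon n w (r(i := r i - 1)) * ord_mon n z t)"
      using assms(1) by (simp add: is_dw_def)
    then show ?thesis
      unfolding ord_mon_zd mult_scaleC_left E qnum_inverse inverse_powi e
      by (simp add: scaleC_scaleC qpow_add qpow_add' algebra_simps del: of_nat_sum fun_upd_apply)
  qed
qed

end

section \<open>The \<open>q\<close>-Laplacian\<close>

lemma qnum_mult_shift:
  assumes "q \<noteq> 0" "q - inverse q \<noteq> 0"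
  shows "qnum q (a + 1) * qnum q b - qnum q a * qnum q (b + 1) = qnum q (b - a)"
proof -
  let ?k = "q - inverse q"
  have k: "?k * qnum q a = q powi a - inverse (q powi a)" for a
    using qnum_mult[OF assms(2), of a] by (simp add: power_int_minus)
  have "?k * ?k * (qnum q (a + 1) * qnum q b - qnum q a * qnum q (b + 1)) =
      (?k * qnum q (a + 1)) * (?k * qnum q b) - (?k * qnum q a) * (?k * qnum q (b + 1))"
    by (simp add: algebra_simps)
  also have "\<dots> = ?k * (?k * qnum q (b - a))"
    unfolding k using assms(1) by (simp add: power_int_add power_int_diff field_simps)
  finally show ?thesis using assms(2) by (simp add: mult.assoc)
qed

lemma qnum_neg: "qnum q (- a) = - qnum q a"
  by (simp add: qnum_def diff_divide_distrib)

text \<open>This is \<open>qnum_mult_shift\<close> at -b - 1 in place of b, using that q-numbers are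
  odd. It sums the commutators met when the power of \<open>Q k\<close> grows.\<close>

lemma qnum_mult_add:
  assumes "q \<noteq> 0" "q - inverse q \<noteq> 0"
  shows "qnum q a * qnum q b + qnum q (a + b + 1) = qnum q (a + 1) * qnum q (b + 1)"
proof -
  have "- b - 1 = - (b + 1)" "- b - 1 + 1 = - b" "- b - 1 - a = - (a + b + 1)" by simp_all
  with qnum_mult_shift[OF assms, of a "- b - 1"]
  have "qnum q (a + 1) * - qnum q (b + 1) - qnum q a * - qnum q b = - qnum q (a + b + 1)"
    by (simp only: qnum_neg)
  then have "qnum q (a + b + 1) = - (qnum q (a + 1) * - qnum q (b + 1) - qnum q a * - qnum q b)"
    by simp
  then show ?thesis by simp
qed

locale q_laplacian = q_relations_hold +
  fixes D E :: "nat \<Rightarrow> 'a \<Rightarrow> 'a"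
  assumes D: "1 \<le> i \<Longrightarrow> i \<le> n \<Longrightarrow> is_dz q n z w i (D i)"
    and E: "1 \<le> i \<Longrightarrow> i \<le> n \<Longrightarrow> is_dw q n z w i (E i)"
    and nroot: "\<And>k::nat. k > 0 \<Longrightarrow> q ^ k \<noteq> 1"
begin

lemma qq: "q - inverse q \<noteq> 0"
proof
  assume "q - inverse q = 0"
  then have "q * q = 1" using q0 by (metis eq_iff_diff_eq_0 right_inverse)
  then show False using nroot[of 2] by (simp add: power2_eq_square)
qed

lemma qpow_eq_1_iff: "q powi a = 1 \<longleftrightarrow> a = 0"
proof
  assume a: "q powi a = 1"
  show "a = 0"
  proof (rule ccontr)
    assume "a \<noteq> 0"
    have "q powi \<bar>a\<bar> = 1" using a by (auto simp: abs_if power_int_minus)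
    then have "q ^ nat \<bar>a\<bar> = 1" by (simp add: power_int_def)
    then show False using nroot[of "nat \<bar>a\<bar>"] \<open>a \<noteq> 0\<close> by simp
  qed
qed simp

lemma qnum_eq_0_iff: "qnum q a = 0 \<longleftrightarrow> a = 0"
proof
  assume "qnum q a = 0"
  then have "q powi a = q powi (- a)" using qq by (simp add: qnum_def)
  then have "q powi a * q powi a = q powi a * q powi (- a)" by simp
  then have "q powi (a + a) = q powi (a + - a)" unfolding qpow_add .
  then show "a = 0" using qpow_eq_1_iff[of "a + a"] by simp
qed simp

lemma D_loc: "1 \<le> i \<Longrightarrow> i \<le> n \<Longrightarrow> q_derivative q n z w i (D i)"
  using D qq q_relations_hold_axioms
  by (intro q_derivative.intro q_derivative_axioms.intro) auto

lemma E_loc: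
  "1 \<le> i \<Longrightarrow> i \<le> n \<Longrightarrow> q_derivative (inverse q) n zd z i (\<lambda>x. q powi (2 * int i) *\<^sub>C E i x)"
  using is_dz_dual[OF E] qq dual
  by (intro q_derivative.intro q_derivative_axioms.intro) auto

lemma qpow_scale_cancel: "q powi a *\<^sub>C x = q powi a *\<^sub>C y \<Longrightarrow> x = y"
  by (rule scaleC_right_cancelD[of "q powi a"]) (use q0 in auto)

context
  fixes i assumes i: "1 \<le> i" "i \<le> n"
begin

lemmas D_simps = q_derivative.D_add[OF D_loc[OF i]] q_derivative.D_scale[OF D_loc[OF i]]
  q_derivative.D_sum[OF D_loc[OF i]] q_derivative.D_0[OF D_loc[OF i]]

lemma E_add: "E i (x + y) = E i x + E i y"
  and E_scale: "E i (c *\<^sub>C x) = c *\<^sub>C E i x"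
  using E[OF i] by (auto simp: is_dw_def linear_scaleC_iff)

lemma E_0: "E i 0 = 0"
  using E_scale[of 0 0] by simp

lemma E_hom:
  assumes "k \<le> n" "x \<in> hom k c d"
  shows "E i x \<in> hom k c (d - 1)"
proof -
  have "q powi (2 * int i) *\<^sub>C E i x \<in> hom k c (d - 1)"
    using q_derivative.D_hom[OF E_loc[OF i] assms(1), of x d c] assms by (simp add: hom_dual)
  then have "q powi (- 2 * int i) *\<^sub>C q powi (2 * int i) *\<^sub>C E i x \<in> hom k c (d - 1)"
    by (rule bihom_scale)
  then show ?thesis by (simp add: scaleC_scaleC qpow_add scaleC_one)
qed

lemma E_high:
  assumes "k < i" "x \<in> hom k c d"
  shows "E i x = 0"
proof (rule qpow_scale_cancel)
  show "q powi (2 * int i) *\<^sub>C E i x = q powi (2 * int i) *\<^sub>C 0"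
    using q_derivative.D_high[OF E_loc[OF i] assms(1), of x d c] assms i by (simp add: hom_dual)
qed

lemma E_mult_z_power:
  assumes "k \<le> n" "1 \<le> j" "j \<le> n" "x \<in> hom k c d"
  shows "E i (x * z j ^ b) = E i x * z j ^ b"
proof (rule qpow_scale_cancel)
  show "q powi (2 * int i) *\<^sub>C E i (x * z j ^ b) = q powi (2 * int i) *\<^sub>C (E i x * z j ^ b)"
    using q_derivative.D_mult_w_power[OF E_loc[OF i] assms(1-3), of x d c b] assms
    by (simp add: hom_dual mult_scaleC_left)
qed

lemma zd_power: "zd j ^ a = q powi (- 2 * int j * int a) *\<^sub>C w j ^ a"
  by (induction a) (auto simp: zd_def scaleC_one scaleC_mult qpow_add algebra_simps)

lemma E_w_power_comm:
  assumes "1 \<le> j" "j \<le> n" "j \<noteq> i" "k \<le> n" "x \<in> hom k c d"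
  shows "E i (w j ^ a * x) = w j ^ a * E i x"
proof (rule qpow_scale_cancel)
  show "q powi (2 * int i + - 2 * int j * int a) *\<^sub>C E i (w j ^ a * x) =
      q powi (2 * int i + - 2 * int j * int a) *\<^sub>C (w j ^ a * E i x)"
    using q_derivative.D_z_power_comm[OF E_loc[OF i] assms(1-4), of x d c a] assms
    by (simp add: hom_dual zd_power scaleC_mult E_scale qpow_add add.commute)
qed

text \<open>This is \<open>D_Q\<close> at the dual data. The dual quadratic element contributes
  q^(-2k) and the rescaled derivative q^(2i); dividing by both produces the exponent 2k -
  2i.\<close>

lemma E_Q:
  assumes "i \<le> k" "k \<le> n" "x \<in> hom k c d"
  shows "E i (Q k * x) = inverse q *\<^sub>C (Q k * E i x) + q powi (2 * int k - 2 * int i + d) *\<^sub>C (z i * x)"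
proof (rule qpow_scale_cancel)
  let ?e = "2 * int i + - 2 * int k"
  have "q powi ?e *\<^sub>C E i (Q k * x) = inverse q *\<^sub>C q powi ?e *\<^sub>C (Q k * E i x) + q powi d *\<^sub>C (z i * x)"
    using q_derivative.D_Q[OF E_loc[OF i] assms(1,2), of x d c] assms
    by (simp add: hom_dual Qsum_dual scaleC_mult E_scale qpow_add inverse_powi add.commute)
  also have "\<dots> = q powi ?e *\<^sub>C (inverse q *\<^sub>C (Q k * E i x) + q powi (2 * int k - 2 * int i + d) *\<^sub>C (z i * x))"
    by (simp add: scaleC_add_right scaleC_scaleC qpow_add mult.commute)
  finally show "q powi ?e *\<^sub>C E i (Q k * x) =
    q powi ?e *\<^sub>C (inverse q *\<^sub>C (Q k * E i x) + q powi (2 * int k - 2 * int i + d) *\<^sub>C (z i * x))" .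
qed

end

text \<open>This is \<open>euler_D_z\<close> at the dual data. The factors q^(2i) of the derivative
  and q^(-2i) of \<open>zd\<close> cancel, leaving precisely the weights of the Laplacian.\<close>

lemma euler_E_w:
  assumes "k \<le> n" "x \<in> hom k c d"
  shows "(\<Sum>i=1..k. q powi (2 * (int i - 1)) *\<^sub>C E i (w i * x)) =
    (q powi (int k - 1) * qnum q (d + int k)) *\<^sub>C x"
proof -
  interpret d: q_relations_hold "inverse q" n zd z by (rule dual)
  have "(\<Sum>i=1..k. inverse q powi (- 2 * (int i - 1)) *\<^sub>C q powi (2 * int i) *\<^sub>C E i (zd i * x)) =
      (inverse q powi (1 - int k) * qnum (inverse q) (d + int k)) *\<^sub>C x"
    by (rule d.euler_D_z[of "\<lambda>i x. q powi (2 * int i) *\<^sub>C E i x"])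
      (use is_dz_dual E qq assms hom_dual in auto)
  moreover have "inverse q powi (- 2 * (int i - 1)) *\<^sub>C q powi (2 * int i) *\<^sub>C E i (zd i * x) =
      q powi (2 * (int i - 1)) *\<^sub>C E i (w i * x)" if "i \<in> {1..k}" for i
    using that assms by (simp add: zd_def scaleC_mult E_scale inverse_powi qpow_add)
  ultimately show ?thesis
    by (simp add: inverse_powi qnum_inverse)
qed

definition Lap :: "nat \<Rightarrow> 'a \<Rightarrow> 'a" where
  "Lap k x = (\<Sum>i=1..k. q ^ (2 * (i - 1)) *\<^sub>C E i (D i x))"

lemma Lap_powi: "Lap k x = (\<Sum>i=1..k. q powi (2 * (int i - 1)) *\<^sub>C E i (D i x))"
  unfolding Lap_def
proof (rule sum.cong[OF refl])
  fix i assume "i \<in> {1..k}"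
  then have "int (2 * (i - 1)) = 2 * (int i - 1)" by (auto simp: of_nat_diff)
  then have "q ^ (2 * (i - 1)) = q powi (2 * (int i - 1))" by (metis power_int_of_nat)
  then show "q ^ (2 * (i - 1)) *\<^sub>C E i (D i x) = q powi (2 * (int i - 1)) *\<^sub>C E i (D i x)" by simp
qed

lemma Lap_add: "k \<le> n \<Longrightarrow> Lap k (x + y) = Lap k x + Lap k y"
  by (simp add: Lap_def D_simps E_add scaleC_add_right sum.distrib)

lemma Lap_scale: "k \<le> n \<Longrightarrow> Lap k (c *\<^sub>C x) = c *\<^sub>C Lap k x"
  by (simp add: Lap_def D_simps E_scale scaleC_scaleC complex_vs.scale_sum_right mult.commute)

lemma Lap_0: "k \<le> n \<Longrightarrow> Lap k 0 = 0"
  by (simp add: Lap_def D_simps E_0)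

lemma Lap_diff: "k \<le> n \<Longrightarrow> Lap k (x - y) = Lap k x - Lap k y"
  using Lap_add[of k "x - y" y] by simp

lemma Lap_sum: "k \<le> n \<Longrightarrow> Lap k (sum f A) = (\<Sum>x\<in>A. Lap k (f x))"
  by (induction A rule: infinite_finite_induct) (auto simp: Lap_add Lap_0)

lemma Lap_hom: "k \<le> n \<Longrightarrow> x \<in> hom k c d \<Longrightarrow> Lap k x \<in> hom k (c - 1) (d - 1)"
  unfolding Lap_def by (intro bihom_sum bihom_scale E_hom q_derivative.D_hom[OF D_loc]) auto

text \<open>The factors q and q^-1 of \<open>D_Q\<close> and \<open>E_Q\<close> cancel in the main
  term. The weight q^(2(i-1)) makes the coefficient of z_i D_i independent of i and is the one
  required by \<open>euler_E_w\<close>, so both remainders are Euler sums; \<open>qnum_add\<close>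
  merges their values.\<close>

lemma Lap_Q:
  assumes "k \<le> n" "x \<in> hom k c d"
  shows "Lap k (Q k * x) = Q k * Lap k x + (q powi (int k - 1) * qnum q (c + d + int k)) *\<^sub>C x"
proof -
  have ez: "(\<Sum>i=1..k. z i * D i x) = qnum q c *\<^sub>C x"
    by (rule euler_z_D) (use D qq assms in auto)
  have "q powi (2 * (int i - 1)) *\<^sub>C E i (D i (Q k * x)) =
      Q k * (q powi (2 * (int i - 1)) *\<^sub>C E i (D i x)) + q powi (2 * int k - 1 + d) *\<^sub>C (z i * D i x) +
      q powi (- c) *\<^sub>C q powi (2 * (int i - 1)) *\<^sub>C E i (w i * x)" if "i \<in> {1..k}" for i
  proof -
    have i: "1 \<le> i" "i \<le> n" "i \<le> k" using that assms by auto
    have Dx: "D i x \<in> hom k (c - 1) d"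
      by (rule q_derivative.D_hom[OF D_loc]) (use i assms in auto)
    have "E i (D i (Q k * x)) = q *\<^sub>C inverse q *\<^sub>C (Q k * E i (D i x)) +
        q *\<^sub>C q powi (2 * int k - 2 * int i + d) *\<^sub>C (z i * D i x) + q powi (- c) *\<^sub>C E i (w i * x)"
      unfolding q_derivative.D_Q[OF D_loc[OF i(1,2)] i(3) assms] E_add[OF i(1,2)] E_scale[OF i(1,2)]
        E_Q[OF i assms(1) Dx] scaleC_add_right ..
    moreover have "q powi (2 * (int i - 1)) * (q * q powi (2 * int k - 2 * int i + d)) = q powi (2 * int k - 1 + d)"
    proof -
      have "q powi (2 * (int i - 1)) * (q powi 1 * q powi (2 * int k - 2 * int i + d)) = q powi (2 * int k - 1 + d)"
        unfolding qpow_add by (simp add: algebra_simps)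
      then show ?thesis by simp
    qed
    ultimately show ?thesis
      using q0 by (simp add: scaleC_linear mult.commute)
  qed
  then have "Lap k (Q k * x) = Q k * Lap k x + q powi (2 * int k - 1 + d) *\<^sub>C (\<Sum>i=1..k. z i * D i x) +
      q powi (- c) *\<^sub>C (\<Sum>i=1..k. q powi (2 * (int i - 1)) *\<^sub>C E i (w i * x))"
    by (simp add: Lap_powi sum.distrib sum_distrib_left complex_vs.scale_sum_right)
  also have "\<dots> = Q k * Lap k x + (q powi (2 * int k - 1 + d) * qnum q c +
      q powi (- c) * (q powi (int k - 1) * qnum q (d + int k))) *\<^sub>C x"
    unfolding euler_E_w[OF assms] ez by (simp add: scaleC_add_left scaleC_scaleC add.assoc)
  also have "q powi (2 * int k - 1 + d) * qnum q c + q powi (- c) * (q powi (int k - 1) * qnum q (d + int k)) =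
      q powi (int k - 1) * qnum q (c + d + int k)"
  proof -
    have e: "q powi (2 * int k - 1 + d) = q powi (int k - 1) * q powi (d + int k)"
      by (simp add: qpow_add algebra_simps)
    show ?thesis
      unfolding e add.assoc qnum_add[OF q0, of c "d + int k"] by (simp add: distrib_left mult_ac)
  qed
  finally show ?thesis .
qed

text \<open>The commutator is applied to Q^j x, whose total degree is c + d + 2j;
  \<open>qnum_mult_add\<close> adds the new value to the earlier ones. For j = 0 the truncated
  exponent is harmless because [0] = 0.\<close>

lemma Lap_Q_power:
  assumes "k \<le> n" "x \<in> hom k c d"
  shows "Lap k (Q k ^ j * x) = Q k ^ j * Lap k x +
    (q powi (int k - 1) * (qnum q (int j) * qnum q (c + d + int k + int j - 1))) *\<^sub>C (Q k ^ (j - 1) * x)"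
proof (induction j)
  case (Suc j)
  have "Q k ^ j * x \<in> hom k (int j * 1 + c) (int j * 1 + d)"
    by (intro hom_mult hom_power Q_hom assms order_refl)
  from Lap_Q[OF assms(1) this]
  have "Lap k (Q k * (Q k ^ j * x)) = Q k * Lap k (Q k ^ j * x) +
      (q powi (int k - 1) * qnum q (c + d + 2 * int j + int k)) *\<^sub>C (Q k ^ j * x)"
    by (simp add: algebra_simps)
  also have "Q k * Lap k (Q k ^ j * x) = Q k ^ Suc j * Lap k x +
      (q powi (int k - 1) * (qnum q (int j) * qnum q (c + d + int k + int j - 1))) *\<^sub>C (Q k ^ j * x)"
    unfolding Suc.IH by (cases j) (simp_all add: distrib_left mult_scaleC_right mult.assoc)
  also have "\<dots> + (q powi (int k - 1) * qnum q (c + d + 2 * int j + int k)) *\<^sub>C (Q k ^ j * x) =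
      Q k ^ Suc j * Lap k x + (q powi (int k - 1) * (qnum q (int j) * qnum q (c + d + int k + int j - 1) +
        qnum q (c + d + 2 * int j + int k))) *\<^sub>C (Q k ^ j * x)"
    by (simp add: add.assoc distrib_left flip: scaleC_add_left)
  also have "qnum q (int j) * qnum q (c + d + int k + int j - 1) + qnum q (c + d + 2 * int j + int k) =
      qnum q (int (Suc j)) * qnum q (c + d + int k + int (Suc j) - 1)"
    using qnum_mult_add[OF q0 qq, of "int j" "c + d + int k + int j - 1"] by (simp add: algebra_simps)
  finally show ?case by (simp add: mult.assoc)
qed simp

text \<open>The eigenvalue \<open>-q\<^sup>n\<^sup>-\<^sup>1[j+1][c+d+n+j]\<close> is what remains of \<open>\<Delta>(Qg) = 0\<close> after \<open>j\<close> applications of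
  \<open>\<Delta>\<close>; iterating lowers the degree until the polynomial vanishes.\<close>

lemma Q_Lap_eigenvector_zero:
  assumes "1 \<le> n" "g \<in> hom n c d"
    and "Q n * Lap n g = - (q powi (int n - 1) * (qnum q (int j + 1) * qnum q (c + d + int n + int j))) *\<^sub>C g"
  shows "g = 0"
  using assms(2,3)
proof (induction "nat (c + 1)" arbitrary: c d g j rule: less_induct)
  case less
  show ?case
  proof (cases "c < 0 \<or> d < 0")
    case True
    then show ?thesis using bihom_neg less.prems(1) by blast
  next
    case False
    define p where "p = q powi (int n - 1)"
    have p0: "p \<noteq> 0" using q0 by (simp add: p_def)
    let ?g = "Lap n g"
    have g1: "?g \<in> hom n (c - 1) (d - 1)" by (rule Lap_hom) (use less.prems in auto)
    have "Q n * Lap n ?g = Lap n (Q n * ?g) - (p * qnum q (c + d - 2 + int n)) *\<^sub>C ?g"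
      using Lap_Q[OF order_refl g1] by (simp add: p_def algebra_simps)
    also have "\<dots> = - (p * (qnum q (int j + 1) * qnum q (c + d + int n + int j) + qnum q (c + d - 2 + int n))) *\<^sub>C ?g"
      unfolding less.prems(2) Lap_scale[OF order_refl] p_def[symmetric]
      by (simp add: complex_vs.scale_minus_left distrib_left scaleC_add_left complex_vs.scale_left_diff_distrib)
    also have "qnum q (int j + 1) * qnum q (c + d + int n + int j) + qnum q (c + d - 2 + int n) =
        qnum q (int (Suc j) + 1) * qnum q ((c - 1) + (d - 1) + int n + int (Suc j))"
      using qnum_mult_shift[OF q0 qq, of "int j + 1" "c + d + int n + int j - 1"]
      by (simp add: algebra_simps)
    finally have eq: "Q n * Lap n ?g = - (q powi (int n - 1) * (qnum q (int (Suc j) + 1) *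
        qnum q ((c - 1) + (d - 1) + int n + int (Suc j)))) *\<^sub>C ?g"
      unfolding p_def .
    have "nat (c - 1 + 1) < nat (c + 1)" using False by simp
    then have "?g = 0" by (rule less.hyps[OF _ g1 eq])
    then have "(p * (qnum q (int j + 1) * qnum q (c + d + int n + int j))) *\<^sub>C g = 0"
      using less.prems(2) by (simp add: p_def complex_vs.scale_minus_left)
    \<comment> \<open>Both q-numbers have positive argument since c, d are nonnegative and n is at
      least 1; they are nonzero because q is not a root of unity.\<close>
    moreover have "p * (qnum q (int j + 1) * qnum q (c + d + int n + int j)) \<noteq> 0"
      using p0 False assms(1) by (auto simp: qnum_eq_0_iff)
    ultimately show ?thesis by (simp add: complex_vs.scale_eq_0_iff)
  qed
qed

lemma Lap_Q_eq_0:
  assumes "1 \<le> n" "g \<in> hom n c d" "Lap n (Q n * g) = 0"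
  shows "g = 0"
proof (rule Q_Lap_eigenvector_zero[OF assms(1,2), of 0])
  have "Q n * Lap n g + (q powi (int n - 1) * qnum q (c + d + int n)) *\<^sub>C g = 0"
    using Lap_Q[OF order_refl assms(2)] assms(3) by simp
  then show "Q n * Lap n g =
      - (q powi (int n - 1) * (qnum q (int 0 + 1) * qnum q (c + d + int n + int 0))) *\<^sub>C g"
    by (simp add: qnum_1[OF qq] complex_vs.scale_minus_left eq_neg_iff_add_eq_0)
qed

section \<open>The Laplacian on inner polynomials multiplied by a power of an outermost
  variable\<close>

lemma z_power_qcomm_hom:
  assumes "k < j" "j \<le> n" "x \<in> hom k c d"
  shows "z j ^ a * x = q powi (- (c + d) * int a) *\<^sub>C (x * z j ^ a)"
  using qcomm_power_left[OF q0 z_qcomm_hom[OF assms]] by simp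

lemma w_power_qcomm_hom:
  assumes "k < j" "j \<le> n" "x \<in> hom k c d"
  shows "w j ^ a * x = q powi ((c + d) * int a) *\<^sub>C (x * w j ^ a)"
  using qcomm_power_left[OF q0 w_qcomm_hom[OF assms]] by simp

text \<open>The n-th summand vanishes because no w_n occurs. For i < n, \<open>D i\<close> commutes
  with z_n^a on the left and \<open>E i\<close> with z_n^a on the right. The power is moved to the
  right before \<open>E i\<close> acts and back afterwards; the total degree has then dropped by
  one, which leaves q^-a.\<close>

lemma Lap_z_top:
  assumes n: "n = Suc k" and p: "p \<in> hom k c d"
  shows "Lap n (z n ^ a * p) = q powi (- int a) *\<^sub>C (z n ^ a * Lap k p)"
proof -
  have kn: "k < n" "k \<le> n" "1 \<le> n" using n by auto
  have top: "E n (D n (z n ^ a * p)) = 0"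
  proof -
    have "D n (z n ^ a * p) = (q powi (- c) * qnum q (int a)) *\<^sub>C (z n ^ (a - 1) * p)"
      by (rule q_derivative.D_top[OF D_loc n p]) (use kn in auto)
    moreover have "E n (p * z n ^ (a - 1)) = 0"
      using E_mult_z_power[OF kn(3) order_refl kn(2,3) order_refl p] E_high[OF kn(3) order_refl kn(1) p]
      by simp
    ultimately show ?thesis
      using kn by (simp add: z_power_qcomm_hom[OF kn(1) order_refl p] E_scale)
  qed
  have step: "E i (D i (z n ^ a * p)) = q powi (- int a) *\<^sub>C (z n ^ a * E i (D i p))" if "i \<in> {1..k}" for i
  proof -
    have i: "1 \<le> i" "i \<le> n" "n \<noteq> i" using that n by auto
    have 1: "D i p \<in> hom k (c - 1) d" by (rule q_derivative.D_hom[OF D_loc[OF i(1,2)] kn(2) p])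
    have 2: "E i (D i p) \<in> hom k (c - 1) (d - 1)" by (rule E_hom[OF i(1,2) kn(2) 1])
    have "E i (D i (z n ^ a * p)) = E i (z n ^ a * D i p)"
      by (simp add: q_derivative.D_z_power_comm[OF D_loc[OF i(1,2)] kn(3) order_refl i(3) kn(2) p])
    also have "\<dots> = q powi (- (c - 1 + d) * int a) *\<^sub>C (E i (D i p) * z n ^ a)"
      by (simp add: z_power_qcomm_hom[OF kn(1) order_refl 1] E_scale[OF i(1,2)]
          E_mult_z_power[OF i(1,2) kn(2,3) order_refl 1])
    also have "\<dots> = q powi (- int a) *\<^sub>C (z n ^ a * E i (D i p))"
      unfolding z_power_qcomm_hom[OF kn(1) order_refl 2] scaleC_scaleC qpow_add
      by (simp add: algebra_simps)
    finally show ?thesis .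
  qed
  have "Lap n (z n ^ a * p) = (\<Sum>i=1..k. q ^ (2 * (i - 1)) *\<^sub>C E i (D i (z n ^ a * p)))"
    unfolding Lap_def using top by (simp add: n)
  also have "\<dots> = (\<Sum>i=1..k. q ^ (2 * (i - 1)) *\<^sub>C q powi (- int a) *\<^sub>C (z n ^ a * E i (D i p)))"
    by (intro sum.cong refl) (simp only: step)
  finally show ?thesis
    by (simp add: Lap_def sum_distrib_left complex_vs.scale_sum_right scaleC_mult mult.commute)
qed

text \<open>Here the sides are exchanged: \<open>D i\<close> commutes with w_n^a on the right,
  \<open>E i\<close> with w_n^a on the left. The degree now drops between the two moves because of
  \<open>D i\<close>, and the factor is q^a.\<close>

lemma Lap_w_top:
  assumes n: "n = Suc k" and p: "p \<in> hom k c d"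
  shows "Lap n (w n ^ a * p) = q powi int a *\<^sub>C (w n ^ a * Lap k p)"
proof -
  have kn: "k < n" "k \<le> n" "1 \<le> n" using n by auto
  have top: "E n (D n (w n ^ a * p)) = 0"
    using kn q_derivative.D_mult_w_power[OF D_loc[OF kn(3) order_refl] kn(2,3) order_refl p]
      q_derivative.D_high[OF D_loc[OF kn(3) order_refl] kn(1) p]
    by (simp add: w_power_qcomm_hom[OF kn(1) order_refl p] D_simps E_scale E_0)
  have step: "E i (D i (w n ^ a * p)) = q powi int a *\<^sub>C (w n ^ a * E i (D i p))" if "i \<in> {1..k}" for i
  proof -
    have i: "1 \<le> i" "i \<le> n" "n \<noteq> i" using that n by auto
    have 1: "D i p \<in> hom k (c - 1) d" by (rule q_derivative.D_hom[OF D_loc[OF i(1,2)] kn(2) p])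
    have "D i (w n ^ a * p) = q powi ((c + d) * int a) *\<^sub>C (D i p * w n ^ a)"
      by (simp add: w_power_qcomm_hom[OF kn(1) order_refl p] D_simps[OF i(1,2)]
          q_derivative.D_mult_w_power[OF D_loc[OF i(1,2)] kn(2,3) order_refl p])
    also have "\<dots> = q powi int a *\<^sub>C (w n ^ a * D i p)"
      unfolding w_power_qcomm_hom[OF kn(1) order_refl 1] scaleC_scaleC qpow_add
      by (simp add: algebra_simps)
    finally show ?thesis
      by (simp add: E_scale[OF i(1,2)] E_w_power_comm[OF i(1,2) kn(3) order_refl i(3) kn(2) 1])
  qed
  have "Lap n (w n ^ a * p) = (\<Sum>i=1..k. q ^ (2 * (i - 1)) *\<^sub>C E i (D i (w n ^ a * p)))"
    unfolding Lap_def using top by (simp add: n)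
  also have "\<dots> = (\<Sum>i=1..k. q ^ (2 * (i - 1)) *\<^sub>C q powi int a *\<^sub>C (w n ^ a * E i (D i p)))"
    by (intro sum.cong refl) (simp only: step)
  finally show ?thesis
    by (simp add: Lap_def sum_distrib_left complex_vs.scale_sum_right scaleC_mult mult.commute)
qed

end

section \<open>Hypergeometric coefficients\<close>

lemma qpoch_Suc: "qpoch a t (Suc s) = qpoch a t s * (1 - a * t ^ s)"
  by (simp add: qpoch_def)

context q_relations_hold
begin

lemma qpoch_powi: "qpoch (q powi (2 * x)) (q\<^sup>2) N = (\<Prod>j<N. 1 - q powi (2 * (x + int j)))"
proof -
  have "(q\<^sup>2) ^ j = q powi (2 * int j)" for j
    using qpow_power[of 2 j] by simp
  then show ?thesis
    by (simp add: qpoch_def qpow_add distrib_left)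
qed

lemma prod_one_minus_qpow_neg:
  "(\<Prod>j<N. 1 - q powi (- 2 * (x + int j))) =
    (-1) ^ N * q powi (- int N * (2 * x + int N - 1)) * (\<Prod>j<N. 1 - q powi (2 * (x + int j)))"
proof (induction N)
  case (Suc N)
  have "1 - q powi (- 2 * (x + int N)) = - (q powi (- 2 * (x + int N)) * (1 - q powi (2 * (x + int N))))"
    by (simp add: right_diff_distrib qpow_add)
  moreover have "q powi (- int N * (2 * x + int N - 1)) * q powi (- 2 * (x + int N)) =
      q powi (- int (Suc N) * (2 * x + int (Suc N) - 1))"
    unfolding qpow_add by (simp add: algebra_simps)
  moreover have "(-1) ^ N * X * P * - (y * r) = (-1) ^ Suc N * (X * y) * (P * r)" for X P y r :: complex
    by simp
  ultimately show ?case
    by (simp only: prod.lessThan_Suc Suc.IH)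
qed simp

text \<open>The product is read backwards and each factor 1 - q^(-2y) is written as -q^(-2y) (1 -
  q^(2y)). This converts the negative exponents of the theorem into positive ones, for which
  \<open>qpoch_nonzero\<close> applies.\<close>

lemma qpoch_reverse:
  "qpoch (q powi (- 2 * (x + int N - 1))) (q\<^sup>2) N =
    (-1) ^ N * q powi (- int N * (2 * x + int N - 1)) * qpoch (q powi (2 * x)) (q\<^sup>2) N"
proof -
  have "qpoch (q powi (- 2 * (x + int N - 1))) (q\<^sup>2) N =
      (\<Prod>j<N. 1 - q powi (2 * (- (x + int N - 1) + int j)))"
    using qpoch_powi[of "- (x + int N - 1)" N] by simp
  also have "\<dots> = (\<Prod>j<N. 1 - q powi (2 * (- (x + int N - 1) + int (N - Suc j))))"
    by (rule prod.nat_diff_reindex[symmetric])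
  also have "\<dots> = (\<Prod>j<N. 1 - q powi (- 2 * (x + int j)))"
    by (rule prod.cong) (auto simp: of_nat_diff algebra_simps)
  finally show ?thesis
    unfolding prod_one_minus_qpow_neg qpoch_powi .
qed

end

context q_laplacian
begin

lemma one_minus_qpow: "1 - q powi (2 * x) = - ((q - inverse q) * q powi x * qnum q x)"
proof -
  have "(q - inverse q) * q powi x * qnum q x = q powi x * (q powi x - q powi (- x))"
    using qnum_mult[OF qq, of x] by (simp add: mult_ac)
  then show ?thesis by (simp add: right_diff_distrib qpow_add)
qed

lemma qpoch_nonzero: "x \<ge> 1 \<Longrightarrow> qpoch (q powi (2 * x)) (q\<^sup>2) N \<noteq> 0"
  unfolding qpoch_powi by (auto simp: qpow_eq_1_iff)

text \<open>The j-th coefficient of the hypergeometric polynomial of the theorem, with the exponents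
  of q as parameters; the power of q^2 is its argument.\<close>

definition psi :: "nat \<Rightarrow> int \<Rightarrow> int \<Rightarrow> nat \<Rightarrow> complex" where
  "psi N M \<sigma> j = phi21_coeff (q powi (- 2 * int N)) (q powi (2 * M)) (q powi (2 * \<sigma>)) (q\<^sup>2) j * (q\<^sup>2) ^ j"

text \<open>In the ratio of consecutive coefficients each factor 1 - q^(2x) equals -(q - q^-1) q^x
  [x]. With M = \<sigma> + b + N the remaining powers of q give q^(b-1) for every j, and the
  argument q^2 raises this to the q^(b+1) of the recursion.\<close>

lemma psi_Suc:
  assumes "\<sigma> \<ge> 1"
  shows "psi N (\<sigma> + b + int N) \<sigma> (Suc j) * (q powi (- b) * (qnum q (int j + 1) * qnum q (\<sigma> + int j))) +
    psi N (\<sigma> + b + int N) \<sigma> j * (q * (qnum q (int N - int j) * qnum q (\<sigma> + b + int N + int j))) = 0"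
proof -
  let ?M = "\<sigma> + b + int N" and ?k = "q - inverse q"
  have t: "(q\<^sup>2) ^ j = q powi (2 * int j)"
    using qpow_power[of 2 j] by simp
  define A where "A = - (?k * q powi (int j - int N) * qnum q (int j - int N))"
  define B where "B = - (?k * q powi (?M + int j) * qnum q (?M + int j))"
  define C where "C = - (?k * q powi (\<sigma> + int j) * qnum q (\<sigma> + int j))"
  define F where "F = - (?k * q powi (int j + 1) * qnum q (int j + 1))"
  have f: "1 - q powi (- 2 * int N) * (q\<^sup>2) ^ j = A" "1 - q powi (2 * ?M) * (q\<^sup>2) ^ j = B"
    "1 - q powi (2 * \<sigma>) * (q\<^sup>2) ^ j = C" "1 - q\<^sup>2 * (q\<^sup>2) ^ j = F"
    unfolding t qpow_add A_def B_def C_def F_def one_minus_qpow[symmetric]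
    using qpow_add[of 2 "2 * int j"] by (simp_all add: algebra_simps)
  have CF: "C \<noteq> 0" "F \<noteq> 0"
    using assms q0 qq by (auto simp: C_def F_def qnum_eq_0_iff)
  have "psi N ?M \<sigma> (Suc j) = psi N ?M \<sigma> j * q\<^sup>2 * (A * B / (C * F))"
    unfolding psi_def phi21_coeff_def qpoch_Suc f by (simp add: mult_ac)
  then have psi_CF: "psi N ?M \<sigma> (Suc j) * (C * F) = psi N ?M \<sigma> j * (q\<^sup>2 * (A * B))"
    using CF by simp
  have CF_eq: "C * F = ?k\<^sup>2 * (q powi (\<sigma> + 2 * int j + 1) * (qnum q (int j + 1) * qnum q (\<sigma> + int j)))"
  proof -
    have "q powi (\<sigma> + 2 * int j + 1) = q powi (\<sigma> + int j) * q powi (int j + 1)"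
      unfolding qpow_add by (simp add: algebra_simps)
    then show ?thesis by (simp add: C_def F_def power2_eq_square mult_ac)
  qed
  have AB_eq: "q\<^sup>2 * (A * B) = - (?k\<^sup>2 * (q powi (\<sigma> + 2 * int j + 1) * q powi b * (q * (qnum q (int N - int j) * qnum q (?M + int j)))))"
  proof -
    have "q\<^sup>2 * (q powi (int j - int N) * q powi (?M + int j)) = q powi (\<sigma> + 2 * int j + 1) * q powi b * q"
      using qpow_add[of "\<sigma> + 2 * int j + 1 + b" 1] qpow_add'[of 2 "int j - int N" "q powi (?M + int j)"]
      by (simp add: qpow_add algebra_simps)
    moreover have "qnum q (int j - int N) = - qnum q (int N - int j)"
      using qnum_neg[of q "int N - int j"] by simp
    ultimately show ?thesis
      unfolding A_def B_def power2_eq_square[of ?k] by (simp add: mult_ac)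
  qed
  have "?k\<^sup>2 * q powi (\<sigma> + 2 * int j + 1) * (psi N ?M \<sigma> (Suc j) * (qnum q (int j + 1) * qnum q (\<sigma> + int j))) =
      psi N ?M \<sigma> (Suc j) * (C * F)"
    unfolding CF_eq by (simp add: mult_ac)
  also have "\<dots> = ?k\<^sup>2 * q powi (\<sigma> + 2 * int j + 1) *
      - (q powi b * (psi N ?M \<sigma> j * (q * (qnum q (int N - int j) * qnum q (?M + int j)))))"
    unfolding psi_CF AB_eq by (simp add: mult_ac)
  finally have "?k\<^sup>2 * q powi (\<sigma> + 2 * int j + 1) * (psi N ?M \<sigma> (Suc j) * (qnum q (int j + 1) * qnum q (\<sigma> + int j))) =
    ?k\<^sup>2 * q powi (\<sigma> + 2 * int j + 1) * - (q powi b * (psi N ?M \<sigma> j * (q * (qnum q (int N - int j) * qnum q (?M + int j)))))" .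
  then have "psi N ?M \<sigma> (Suc j) * (qnum q (int j + 1) * qnum q (\<sigma> + int j)) =
    - (q powi b * (psi N ?M \<sigma> j * (q * (qnum q (int N - int j) * qnum q (?M + int j)))))"
    using qq q0 by (subst (asm) mult_cancel_left) auto
  then have "psi N ?M \<sigma> (Suc j) * (q powi (- b) * (qnum q (int j + 1) * qnum q (\<sigma> + int j))) =
    q powi (- b) * - (q powi b * (psi N ?M \<sigma> j * (q * (qnum q (int N - int j) * qnum q (?M + int j)))))"
    by (simp add: mult.left_commute)
  also have "\<dots> = - (psi N ?M \<sigma> j * (q * (qnum q (int N - int j) * qnum q (?M + int j))))"
    by (simp add: qpow_add')
  finally show ?thesis by simp
qed

text \<open>The scalar in front of the hypergeometric polynomial of the theorem: N is the smaller of
  m - s and m' - s', b is their difference, and \<sigma> = s + s' + n - 1.\<close>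

definition proj_const :: "nat \<Rightarrow> int \<Rightarrow> int \<Rightarrow> complex" where
  "proj_const N b \<sigma> = q powi (- 2 * (b + int N) * int N) *
    (qpoch (q powi (- 2 * (\<sigma> + int N - 1))) (q\<^sup>2) N /
     qpoch (q powi (- 2 * (\<sigma> + b + int N + int N - 1))) (q\<^sup>2) N)"

text \<open>The term j = N is the one that carries no factor \<open>Q n\<close>. Its coefficient
  must therefore agree with the constant in \<open>z_w_power_mod_Q\<close>, and this requirement
  determines \<open>proj_const\<close>.\<close>

lemma proj_const_psi:
  assumes "\<sigma> \<ge> 1" "b \<ge> 0"
  shows "proj_const N b \<sigma> * psi N (\<sigma> + b + int N) \<sigma> N = (-1) ^ N * q powi (- int N * (int N - 1))"
proof -
  let ?M = "\<sigma> + b + int N"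
  define S where "S = qpoch (q powi (2 * \<sigma>)) (q\<^sup>2) N"
  define T where "T = qpoch (q powi (2 * ?M)) (q\<^sup>2) N"
  define U where "U = qpoch (q\<^sup>2) (q\<^sup>2) N"
  have nz: "S \<noteq> 0" "T \<noteq> 0" "U \<noteq> 0"
    using qpoch_nonzero[of \<sigma> N] qpoch_nonzero[of ?M N] qpoch_nonzero[of 1 N] assms
    by (simp_all add: S_def T_def U_def)
  have 1: "qpoch (q powi (- 2 * int N)) (q\<^sup>2) N = (-1) ^ N * q powi (- int N * (int N + 1)) * U"
    using qpoch_reverse[of 1 N] by (simp add: U_def add.commute)
  have 2: "proj_const N b \<sigma> = q powi (- 2 * (b + int N) * int N) *
      ((-1) ^ N * q powi (- int N * (2 * \<sigma> + int N - 1)) * S /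
       ((-1) ^ N * q powi (- int N * (2 * ?M + int N - 1)) * T))"
    unfolding proj_const_def qpoch_reverse S_def T_def ..
  also have "\<dots> = q powi (- 2 * (b + int N) * int N) * (q powi (- int N * (2 * \<sigma> + int N - 1)) /
      q powi (- int N * (2 * ?M + int N - 1))) * (S / T)"
    by simp
  also have "q powi (- 2 * (b + int N) * int N) * (q powi (- int N * (2 * \<sigma> + int N - 1)) /
      q powi (- int N * (2 * ?M + int N - 1))) = 1"
    using q0 by (simp add: power_int_diff[symmetric] qpow_add algebra_simps)
  finally have pc: "proj_const N b \<sigma> = S / T" by simp
  have "psi N ?M \<sigma> N = ((-1) ^ N * q powi (- int N * (int N + 1)) * U * T) / (S * U) * q powi (2 * int N)"
    unfolding psi_def phi21_coeff_def 1 using qpow_power[of 2 N] by (simp add: S_def T_def U_def)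
  then have "proj_const N b \<sigma> * psi N ?M \<sigma> N = (-1) ^ N * (q powi (- int N * (int N + 1)) * q powi (2 * int N))"
    unfolding pc using nz by simp
  also have "q powi (- int N * (int N + 1)) * q powi (2 * int N) = q powi (- int N * (int N - 1))"
    unfolding qpow_add by (simp add: algebra_simps)
  finally show ?thesis .
qed

section \<open>The projection\<close>

lemma harmonic_decomposition_unique:
  assumes "1 \<le> n" "Lap n f = 0" "Lap n f' = 0" "g \<in> hom n c d" "g' \<in> hom n c d"
    and "f + Q n * g = f' + Q n * g'"
  shows "f = f'"
proof -
  have eq: "Q n * (g - g') = f' - f" using assms(6) by (simp add: right_diff_distrib algebra_simps)
  have "Lap n (Q n * (g - g')) = 0"
    unfolding eq using assms(2,3) by (simp add: Lap_diff)
  then have "g - g' = 0" by (intro Lap_Q_eq_0[OF assms(1) bihom_diff[OF assms(4,5)]])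
  then show ?thesis using eq by simp
qed

text \<open>The Laplacian lowers either \<open>g j\<close> or the power of \<open>Q n\<close>; these
  contributions are \<open>X\<close> and \<open>Y\<close>. Both \<open>X (Suc j)\<close> and
  \<open>Y j\<close> are multiples of Q_n^(N-j-1) g_j, so they can cancel in pairs. The unpaired
  ends \<open>X 0\<close> and \<open>Y N\<close> vanish since [0] = 0.\<close>

lemma Lap_ladder_sum:
  assumes g: "\<And>j. j \<le> N \<Longrightarrow> g j \<in> hom n (c + int j) (d + int j)"
    and Lg: "\<And>j. j \<le> N \<Longrightarrow>
      Lap n (g j) = (q powi (int n - 2) * (\<theta> * (qnum q (int j) * qnum q (\<sigma> + int j - 1)))) *\<^sub>C g (j - 1)"
    and rec: "\<And>j. j < N \<Longrightarrow> \<phi> (Suc j) * (\<theta> * (qnum q (int j + 1) * qnum q (\<sigma> + int j))) +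
      \<phi> j * (q * (qnum q (int N - int j) * qnum q (c + d + int n + int N - 1 + int j))) = 0"
  shows "Lap n (\<Sum>j\<le>N. \<phi> j *\<^sub>C (Q n ^ (N - j) * g j)) = 0"
proof -
  define X where "X j = (\<phi> j * (q powi (int n - 2) * (\<theta> * (qnum q (int j) * qnum q (\<sigma> + int j - 1))))) *\<^sub>C
      (Q n ^ (N - j) * g (j - 1))" for j
  define Y where "Y j = (\<phi> j * (q powi (int n - 1) *
      (qnum q (int N - int j) * qnum q (c + d + int n + int N - 1 + int j)))) *\<^sub>C (Q n ^ (N - j - 1) * g j)" for j
  have "\<phi> j *\<^sub>C Lap n (Q n ^ (N - j) * g j) = X j + Y j" if "j \<le> N" for j
    unfolding Lap_Q_power[OF order_refl g[OF that]] Lg[OF that] X_def Y_def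
    using that by (simp add: scaleC_linear of_nat_diff algebra_simps)
  then have "Lap n (\<Sum>j\<le>N. \<phi> j *\<^sub>C (Q n ^ (N - j) * g j)) = (\<Sum>j\<le>N. X j) + (\<Sum>j\<le>N. Y j)"
    by (simp add: Lap_sum Lap_scale sum.distrib)
  also have "(\<Sum>j\<le>N. X j) = (\<Sum>j<N. X (Suc j))"
    unfolding lessThan_Suc_atMost[symmetric] sum.lessThan_Suc_shift by (simp add: X_def)
  also have "(\<Sum>j\<le>N. Y j) = (\<Sum>j<N. Y j)"
    unfolding lessThan_Suc_atMost[symmetric] by (simp add: Y_def)
  also have "(\<Sum>j<N. X (Suc j)) + (\<Sum>j<N. Y j) = (\<Sum>j<N. X (Suc j) + Y j)"
    by (simp add: sum.distrib)
  also have "\<dots> = 0"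
  proof (rule sum.neutral, rule ballI)
    fix j assume "j \<in> {..<N}"
    then have j: "j < N" by simp
    have q1: "q powi (int n - 1) = q powi (int n - 2) * q"
      using qpow_add[of "int n - 2" 1] by simp
    have "X (Suc j) + Y j = (q powi (int n - 2) * (\<phi> (Suc j) * (\<theta> * (qnum q (int j + 1) * qnum q (\<sigma> + int j))) +
      \<phi> j * (q * (qnum q (int N - int j) * qnum q (c + d + int n + int N - 1 + int j))))) *\<^sub>C (Q n ^ (N - j - 1) * g j)"
      unfolding X_def Y_def q1 by (simp add: distrib_left scaleC_add_left mult_ac add.commute)
    then show "X (Suc j) + Y j = 0" unfolding rec[OF j] by simp
  qed
  finally show ?thesis .
qed

text \<open>The ladder \<open>g\<close> is abstract so that one computation covers both an outer
  power of z_n and one of w_n. The polynomial is harmonic by the recursion, and it differs from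
  \<open>p\<close> by a multiple of \<open>Q n\<close> because their coefficients at
  \<open>g N\<close> agree.\<close>

lemma ladder_projection:
  assumes g: "\<And>j. j \<le> N \<Longrightarrow> g j \<in> hom n (c + int j) (d + int j)"
    and Lg: "\<And>j. j \<le> N \<Longrightarrow> Lap n (g j) =
      (q powi (int n - 2) * (q powi (- b) * (qnum q (int j) * qnum q (\<sigma> + int j - 1)))) *\<^sub>C g (j - 1)"
    and \<sigma>: "\<sigma> \<ge> 1" "b \<ge> 0" "c + d + int n - 1 = \<sigma> + b"
    and G: "G \<in> hom n (c + int N - 1) (d + int N - 1)"
    and p: "p = ((-1) ^ N * q powi (- int N * (int N - 1))) *\<^sub>C g N + Q n * G"
  defines "f \<equiv> (\<Sum>j\<le>N. (proj_const N b \<sigma> * psi N (\<sigma> + b + int N) \<sigma> j) *\<^sub>C (Q n ^ (N - j) * g j))"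
  shows "f \<in> hom n (c + int N) (d + int N)" "Lap n f = 0"
    "\<exists>G \<in> hom n (c + int N - 1) (d + int N - 1). p = f + Q n * G"
proof -
  let ?\<phi> = "\<lambda>j. proj_const N b \<sigma> * psi N (\<sigma> + b + int N) \<sigma> j"
  have Qg: "Q n ^ i * g j \<in> hom n (c + int (i + j)) (d + int (i + j))" if "j \<le> N" for i j
    using hom_mult[OF order_refl hom_power[OF order_refl Q_hom[OF order_refl order_refl]] g[OF that], of i]
    by (simp add: ac_simps)
  show "f \<in> hom n (c + int N) (d + int N)"
    unfolding f_def
  proof (intro bihom_sum bihom_scale)
    fix j assume "j \<in> {..N}"
    then show "Q n ^ (N - j) * g j \<in> hom n (c + int N) (d + int N)"
      using Qg[of j "N - j"] by simp
  qed
  show "Lap n f = 0"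
    unfolding f_def
  proof (rule Lap_ladder_sum[OF g Lg])
    fix j assume "j < N"
    have "c + d + int n + int N - 1 + int j = \<sigma> + b + int N + int j" using \<sigma> by simp
    then show "?\<phi> (Suc j) * (q powi (- b) * (qnum q (int j + 1) * qnum q (\<sigma> + int j))) +
      ?\<phi> j * (q * (qnum q (int N - int j) * qnum q (c + d + int n + int N - 1 + int j))) = 0"
      using psi_Suc[OF \<sigma>(1), of N b j] by (simp only: mult.assoc distrib_left[symmetric] mult_zero_right)
  qed
  \<comment> \<open>The quotient of the terms j < N by \<open>Q n\<close>.\<close>
  define G' where "G' = (\<Sum>j<N. ?\<phi> j *\<^sub>C (Q n ^ (N - j - 1) * g j))"
  have G': "G' \<in> hom n (c + int N - 1) (d + int N - 1)"
    unfolding G'_def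
  proof (intro bihom_sum bihom_scale)
    fix j assume "j \<in> {..<N}"
    then show "Q n ^ (N - j - 1) * g j \<in> hom n (c + int N - 1) (d + int N - 1)"
      using Qg[of j "N - j - 1"] by (simp add: of_nat_diff algebra_simps)
  qed
  have "Q n * G' = (\<Sum>j<N. ?\<phi> j *\<^sub>C (Q n ^ (N - j) * g j))"
    unfolding G'_def sum_distrib_left
  proof (rule sum.cong[OF refl])
    fix j assume "j \<in> {..<N}"
    then obtain i where "N - j = Suc i" by (cases "N - j") auto
    then show "Q n * (?\<phi> j *\<^sub>C (Q n ^ (N - j - 1) * g j)) = ?\<phi> j *\<^sub>C (Q n ^ (N - j) * g j)"
      by (simp add: mult_scaleC_right mult.assoc)
  qed
  then have "f = Q n * G' + ?\<phi> N *\<^sub>C g N"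
    unfolding f_def lessThan_Suc_atMost[symmetric] by simp
  then have "p = f + Q n * (G - G')"
    unfolding p proj_const_psi[OF \<sigma>(1,2)] by (simp add: right_diff_distrib)
  then show "\<exists>G \<in> hom n (c + int N - 1) (d + int N - 1). p = f + Q n * G"
    using bihom_diff[OF G G'] by blast
qed

text \<open>In the middle of z^(N+1) w^(N+1) the product z w is replaced by Q_n - Q_k. Moving Q_k to
  the right past w^N costs q^(-2N); the product of the successive factors -q^(-2i), i < N, is the
  stated constant.\<close>

lemma z_w_power_mod_Q:
  assumes n: "n = Suc k"
  shows "\<exists>G \<in> hom n (int N - 1) (int N - 1).
    z n ^ N * w n ^ N = ((-1) ^ N * q powi (- int N * (int N - 1))) *\<^sub>C Q k ^ N + Q n * G"
proof (induction N)
  case 0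
  show ?case by (intro bexI[of _ 0]) (simp_all add: scaleC_one)
next
  case (Suc N)
  then obtain G where G: "G \<in> hom n (int N - 1) (int N - 1)"
    and eq: "z n ^ N * w n ^ N = ((-1) ^ N * q powi (- int N * (int N - 1))) *\<^sub>C Q k ^ N + Q n * G" by blast
  have kn: "k < n" "k \<le> n" "1 \<le> n" using n by auto
  let ?t = "q powi (- 2 * int N)"
  have zN: "z n ^ N \<in> hom n (int N) 0" and wN: "w n ^ N \<in> hom n 0 (int N)"
    using hom_power[OF order_refl z_hom[OF kn(3) order_refl order_refl], of N]
      hom_power[OF order_refl w_hom[OF kn(3) order_refl order_refl], of N] by auto
  have zw: "z n * w n = Q n - Q k" by (simp add: n Q_Suc)
  have wQ: "w n ^ N * Q k = q powi (2 * int N) *\<^sub>C (Q k * w n ^ N)"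
    using w_power_qcomm_hom[OF kn(1) order_refl Q_hom[OF order_refl kn(2)], of N] by simp
  have Qw: "Q k * w n ^ N = ?t *\<^sub>C (w n ^ N * Q k)"
    unfolding wQ scaleC_scaleC qpow_add by (simp add: scaleC_one)
  have "z n ^ Suc N * w n ^ Suc N = z n ^ N * (z n * w n) * w n ^ N"
    by (simp only: power_Suc2[of "z n"] power_Suc[of "w n"] mult.assoc)
  also have "\<dots> = z n ^ N * Q n * w n ^ N - z n ^ N * (Q k * w n ^ N)"
    by (simp add: zw algebra_simps)
  also have "z n ^ N * Q n = Q n * z n ^ N"
    using Q_central[OF order_refl zN] by simp
  also have "z n ^ N * (Q k * w n ^ N) = ?t *\<^sub>C ((z n ^ N * w n ^ N) * Q k)"
    unfolding Qw by (simp add: mult_scaleC_right mult.assoc)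
  also have "Q n * z n ^ N * w n ^ N - ?t *\<^sub>C ((z n ^ N * w n ^ N) * Q k) =
      - (?t * ((-1) ^ N * q powi (- int N * (int N - 1)))) *\<^sub>C Q k ^ Suc N +
      Q n * (z n ^ N * w n ^ N - ?t *\<^sub>C (G * Q k))"
    by (subst eq)
      (simp add: algebra_simps scaleC_linear power_commutes complex_vs.scale_minus_left)
  also have "- (?t * ((-1) ^ N * q powi (- int N * (int N - 1)))) =
      (-1) ^ Suc N * q powi (- int (Suc N) * (int (Suc N) - 1))"
    using qpow_add[of "- 2 * int N" "- int N * (int N - 1)"] by (simp add: algebra_simps)
  finally have "z n ^ Suc N * w n ^ Suc N = ((-1) ^ Suc N * q powi (- int (Suc N) * (int (Suc N) - 1))) *\<^sub>C Q k ^ Suc N +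
      Q n * (z n ^ N * w n ^ N - ?t *\<^sub>C (G * Q k))" .
  moreover have "z n ^ N * w n ^ N - ?t *\<^sub>C (G * Q k) \<in> hom n (int (Suc N) - 1) (int (Suc N) - 1)"
    using hom_mult[OF order_refl zN wN] hom_mult[OF order_refl G Q_hom[OF kn(2) order_refl]]
    by (intro bihom_diff bihom_scale) simp_all
  ultimately show ?case by blast
qed

lemma Q_power_commute:
  assumes "x \<in> hom n c d"
  shows "Q n ^ j * x = x * Q n ^ j"
  by (induction j) (simp_all add: mult.assoc power_commutes, simp add: Q_central[OF order_refl assms] flip: mult.assoc)

section \<open>The two projections for a fixed harmonic polynomial in the inner variables\<close>

context
  fixes k :: nat and s s' :: int and h :: 'a
  assumes n: "n = Suc k" "1 \<le> k" and s: "s \<ge> 0" "s' \<ge> 0"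
    and h: "h \<in> hom k s s'" "Lap k h = 0"
begin

private abbreviation (input) "\<sigma> \<equiv> s + s' + int n - 1"

lemma kn: "k < n" "k \<le> n" "1 \<le> n" "int k - 1 = int n - 2"
  using n by auto

lemma Qh_hom: "Q k ^ j * h \<in> hom k (s + int j) (s' + int j)"
  using hom_mult[OF kn(2) hom_power[OF kn(2) Q_hom[OF order_refl kn(2)]] h(1), of j]
  by (simp add: ac_simps)

lemma Lap_Qh: "Lap k (Q k ^ j * h) =
    (q powi (int n - 2) * (qnum q (int j) * qnum q (\<sigma> + int j - 1))) *\<^sub>C (Q k ^ (j - 1) * h)"
  using Lap_Q_power[OF kn(2) h(1), of j] h(2) n(1) by (simp add: algebra_simps)

lemma projection_z:
  fixes b N :: nat
  defines "p \<equiv> z n ^ (b + N) * w n ^ N * h"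
  defines "f \<equiv> z n ^ b * (proj_const N (int b) \<sigma> *\<^sub>C phi21_hom N (q powi (- 2 * int N))
      (q powi (2 * (\<sigma> + int b + int N))) (q powi (2 * \<sigma>)) (q\<^sup>2) (q\<^sup>2) (Q k) (Q n)) * h"
  shows "f \<in> hom n (int b + s + int N) (s' + int N)" "Lap n f = 0"
    "\<exists>G \<in> hom n (int b + s + int N - 1) (s' + int N - 1). p = f + Q n * G"
proof -
  define g where "g j = z n ^ b * (Q k ^ j * h)" for j
  have zb: "z n ^ b \<in> hom n (int b) 0"
    using hom_power[OF order_refl z_hom[OF kn(3) order_refl order_refl], of b] by simp
  have g: "g j \<in> hom n (int b + s + int j) (s' + int j)" for j
    unfolding g_def using hom_mult[OF order_refl zb bihom_mono[OF kn(2) Qh_hom[of j]]] by (simp add: ac_simps)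
  have Lg: "Lap n (g j) = (q powi (int n - 2) * (q powi (- int b) * (qnum q (int j) * qnum q (\<sigma> + int j - 1)))) *\<^sub>C g (j - 1)" for j
    unfolding g_def Lap_z_top[OF n(1) Qh_hom] Lap_Qh by (simp add: scaleC_mult mult_ac)
  obtain G0 where G0: "G0 \<in> hom n (int N - 1) (int N - 1)"
    and eq: "z n ^ N * w n ^ N = ((-1) ^ N * q powi (- int N * (int N - 1))) *\<^sub>C Q k ^ N + Q n * G0"
    using z_w_power_mod_Q[OF n(1)] by blast
  define G where "G = z n ^ b * G0 * h"
  have G: "G \<in> hom n (int b + s + int N - 1) (s' + int N - 1)"
    using hom_mult[OF order_refl hom_mult[OF order_refl zb G0] bihom_mono[OF kn(2) h(1)]]
    unfolding G_def by (simp add: algebra_simps)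
  have p: "p = ((-1) ^ N * q powi (- int N * (int N - 1))) *\<^sub>C g N + Q n * G"
  proof -
    have "p = z n ^ b * (z n ^ N * w n ^ N) * h" by (simp add: p_def power_add mult.assoc)
    also have "\<dots> = ((-1) ^ N * q powi (- int N * (int N - 1))) *\<^sub>C g N + (z n ^ b * Q n) * G0 * h"
      unfolding eq g_def by (simp add: distrib_left distrib_right scaleC_mult mult.assoc)
    also have "z n ^ b * Q n = Q n * z n ^ b" using Q_central[OF order_refl zb] by simp
    finally show ?thesis by (simp add: G_def mult.assoc)
  qed
  have f: "f = (\<Sum>j\<le>N. (proj_const N (int b) \<sigma> * psi N (\<sigma> + int b + int N) \<sigma> j) *\<^sub>C (Q n ^ (N - j) * g j))"
    unfolding f_def phi21_hom_def complex_vs.scale_sum_right sum_distrib_left sum_distrib_right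
  proof (rule sum.cong[OF refl], goal_cases)
    case (1 j)
    have "Q n ^ (N - j) * g j = z n ^ b * Q n ^ (N - j) * Q k ^ j * h"
      unfolding g_def using Q_power_commute[OF zb, of "N - j"] by (simp add: mult.assoc[symmetric])
    then show ?case by (simp add: psi_def scaleC_mult mult.assoc)
  qed
  have \<sigma>: "\<sigma> \<ge> 1" "int b \<ge> 0" "int b + s + s' + int n - 1 = \<sigma> + int b" using s n by auto
  note * = ladder_projection[OF g Lg \<sigma> G p, folded f]
  show "f \<in> hom n (int b + s + int N) (s' + int N)" by (rule *)
  show "Lap n f = 0" by (rule *)
  show "\<exists>G \<in> hom n (int b + s + int N - 1) (s' + int N - 1). p = f + Q n * G" by (rule *)
qed

text \<open>In the result w_n^b stands between Q_k^j and h. Moving it to the front gives q^(-2jb),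
  and the change of this factor from j to j - 1 turns the q^b of \<open>Lap_w_top\<close> into q^-b.
  The ladder thus obeys the same rule as in the z-case.\<close>

lemma projection_w:
  fixes b N :: nat
  defines "p \<equiv> z n ^ N * w n ^ (N + b) * h"
  defines "f \<equiv> (proj_const N (int b) \<sigma> *\<^sub>C phi21_hom N (q powi (- 2 * int N))
      (q powi (2 * (\<sigma> + int b + int N))) (q powi (2 * \<sigma>)) (q\<^sup>2) (q\<^sup>2) (Q k) (Q n)) * w n ^ b * h"
  shows "f \<in> hom n (s + int N) (int b + s' + int N)" "Lap n f = 0"
    "\<exists>G \<in> hom n (s + int N - 1) (int b + s' + int N - 1). p = f + Q n * G"
proof -
  define g where "g j = Q k ^ j * w n ^ b * h" for j
  have wb: "w n ^ b \<in> hom n 0 (int b)"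
    using hom_power[OF order_refl w_hom[OF kn(3) order_refl order_refl], of b] by simp
  have Qj: "Q k ^ j \<in> hom k (int j) (int j)" for j
    using hom_power[OF kn(2) Q_hom[OF order_refl kn(2)], of j] by simp
  have gw: "g j = q powi (- 2 * int j * int b) *\<^sub>C (w n ^ b * (Q k ^ j * h))" for j
    unfolding g_def mult.assoc[of "w n ^ b", symmetric] w_power_qcomm_hom[OF kn(1) order_refl Qj]
    by (simp add: scaleC_mult qpow_add scaleC_one algebra_simps)
  have g: "g j \<in> hom n (s + int j) (int b + s' + int j)" for j
    unfolding gw using hom_mult[OF order_refl wb bihom_mono[OF kn(2) Qh_hom[of j]]]
    by (intro bihom_scale) (simp add: ac_simps)
  have Lg: "Lap n (g j) = (q powi (int n - 2) * (q powi (- int b) * (qnum q (int j) * qnum q (\<sigma> + int j - 1)))) *\<^sub>C g (j - 1)" for j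
  proof (cases j)
    case 0
    then show ?thesis
      unfolding gw Lap_scale[OF order_refl] Lap_w_top[OF n(1) Qh_hom] Lap_Qh by simp
  next
    case (Suc i)
    have "q powi (- 2 * int j * int b) * q powi int b = q powi (- int b) * q powi (- 2 * int (j - 1) * int b)"
      unfolding qpow_add by (simp add: Suc algebra_simps)
    then show ?thesis
      unfolding gw Lap_scale[OF order_refl] Lap_w_top[OF n(1) Qh_hom] Lap_Qh scaleC_mult
      by (simp only: mult.assoc[symmetric]) (simp only: mult_ac)
  qed
  obtain G0 where G0: "G0 \<in> hom n (int N - 1) (int N - 1)"
    and eq: "z n ^ N * w n ^ N = ((-1) ^ N * q powi (- int N * (int N - 1))) *\<^sub>C Q k ^ N + Q n * G0"
    using z_w_power_mod_Q[OF n(1)] by blast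
  define G where "G = G0 * w n ^ b * h"
  have G: "G \<in> hom n (s + int N - 1) (int b + s' + int N - 1)"
    using hom_mult[OF order_refl hom_mult[OF order_refl G0 wb] bihom_mono[OF kn(2) h(1)]]
    unfolding G_def by (simp add: algebra_simps)
  have p: "p = ((-1) ^ N * q powi (- int N * (int N - 1))) *\<^sub>C g N + Q n * G"
  proof -
    have "p = (z n ^ N * w n ^ N) * w n ^ b * h" by (simp add: p_def power_add mult.assoc)
    then show ?thesis
      unfolding eq g_def G_def by (simp add: distrib_right scaleC_mult mult.assoc)
  qed
  have f: "f = (\<Sum>j\<le>N. (proj_const N (int b) \<sigma> * psi N (\<sigma> + int b + int N) \<sigma> j) *\<^sub>C (Q n ^ (N - j) * g j))"
    unfolding f_def phi21_hom_def complex_vs.scale_sum_right sum_distrib_left sum_distrib_right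
    by (rule sum.cong) (simp_all add: psi_def g_def scaleC_mult mult.assoc)
  have \<sigma>: "\<sigma> \<ge> 1" "int b \<ge> 0" "s + (int b + s') + int n - 1 = \<sigma> + int b" using s n by auto
  note * = ladder_projection[OF g Lg \<sigma> G p, folded f]
  show "f \<in> hom n (s + int N) (int b + s' + int N)" by (rule *)
  show "Lap n f = 0" by (rule *)
  show "\<exists>G \<in> hom n (s + int N - 1) (int b + s' + int N - 1). p = f + Q n * G" by (rule *)
qed

end

end

section \<open>Linear extensions from words\<close>

lemma eval_free_add: "eval_free \<phi> (x + y) = eval_free \<phi> x + eval_free \<phi> y"
  unfolding eval_free_def by (rule setsum_keys_plus_distrib) (auto simp: scaleC_add_left)

lemma eval_free_single: "eval_free \<phi> (Poly_Mapping.single u c) = c *\<^sub>C prod_list (map \<phi> u)"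
  by (simp add: eval_free_def)

lemma eval_free_0: "eval_free \<phi> 0 = 0"
  by (simp add: eval_free_def)

lemma eval_free_diff: "eval_free \<phi> (x - y) = eval_free \<phi> x - eval_free \<phi> y"
  using eval_free_add[of \<phi> "x - y" y] by simp

lemma eval_free_sum: "eval_free \<phi> (sum f A) = (\<Sum>i\<in>A. eval_free \<phi> (f i))"
  by (induction A rule: infinite_finite_induct) (auto simp: eval_free_add eval_free_0)

lemma sum_single_keys: "(\<Sum>u\<in>Poly_Mapping.keys p. Poly_Mapping.single u (Poly_Mapping.lookup p u)) = p"
  by (rule poly_mapping_eqI) (simp add: lookup_sum lookup_single when_def in_keys_iff)

lemma const_mult_single: "const a * Poly_Mapping.single u b = Poly_Mapping.single u (a * b)"
  by (simp add: const_def mult_single plus_list_def)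

text \<open>A scalar-valued counterpart of \<open>eval_free\<close>. Applied to one coefficient at a
  time, it lets words act by operators without an algebra structure on these operators.\<close>

definition lin_ext :: "('g list \<Rightarrow> complex) \<Rightarrow> ('g list \<Rightarrow>\<^sub>0 complex) \<Rightarrow> complex" where
  "lin_ext f p = (\<Sum>u\<in>Poly_Mapping.keys p. Poly_Mapping.lookup p u * f u)"

lemma lin_ext_add: "lin_ext f (x + y) = lin_ext f x + lin_ext f y"
  unfolding lin_ext_def by (rule setsum_keys_plus_distrib) (auto simp: distrib_right)

lemma lin_ext_single [simp]: "lin_ext f (Poly_Mapping.single u c) = c * f u"
  by (simp add: lin_ext_def)

lemma lin_ext_0 [simp]: "lin_ext f 0 = 0"
  by (simp add: lin_ext_def)

lemma lin_ext_diff: "lin_ext f (x - y) = lin_ext f x - lin_ext f y"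
  using lin_ext_add[of f "x - y" y] by simp

lemma lin_ext_sum: "lin_ext f (sum g A) = (\<Sum>i\<in>A. lin_ext f (g i))"
  by (induction A rule: infinite_finite_induct) (auto simp: lin_ext_add)

lemma lin_ext_mult: "lin_ext f (x * y) = lin_ext (\<lambda>u. lin_ext (\<lambda>v. f (u @ v)) y) x"
proof -
  have "x * y = (\<Sum>u\<in>Poly_Mapping.keys x. Poly_Mapping.single u (Poly_Mapping.lookup x u)) *
      (\<Sum>v\<in>Poly_Mapping.keys y. Poly_Mapping.single v (Poly_Mapping.lookup y v))"
    by (simp add: sum_single_keys)
  also have "lin_ext f \<dots> = (\<Sum>u\<in>Poly_Mapping.keys x. \<Sum>v\<in>Poly_Mapping.keys y.
      Poly_Mapping.lookup x u * Poly_Mapping.lookup y v * f (u @ v))"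
    by (simp add: sum_product lin_ext_sum mult_single plus_list_def)
  finally show ?thesis
    by (simp add: lin_ext_def[of _ x] lin_ext_def[of _ y] sum_distrib_left mult.assoc)
qed

section \<open>A representation on a quantum torus\<close>

text \<open>Put \<open>Q\<^sub>k = z\<^sub>1w\<^sub>1 + \<dots> + z\<^sub>kw\<^sub>k\<close>. If the \<open>z\<^sub>k\<close> were invertible, then \<open>w\<^sub>k = z\<^sub>k\<^sup>-\<^sup>1(Q\<^sub>k - Q\<^sub>k\<^sub>-\<^sub>1)\<close>, where the
  \<open>z\<^sub>j\<close> and \<open>Q\<^sub>k\<close> pairwise \<open>q\<close>-commute. The functions \<open>F a c\<close> are coefficient families of
  \<open>z\<^sub>1\<^sup>a\<^sup>1\<cdots>z\<^sub>n\<^sup>a\<^sup>n Q\<^sub>1\<^sup>c\<^sup>1\<cdots>Q\<^sub>n\<^sup>c\<^sup>n\<close> in this quantum torus, on which \<open>Zop\<close> and \<open>Wop\<close> act by left multiplication.\<close>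

type_synonym coeffs = "(nat \<Rightarrow> int) \<Rightarrow> (nat \<Rightarrow> int) \<Rightarrow> complex"

definition unit :: "nat \<Rightarrow> nat \<Rightarrow> int" where "unit k i = (if i = k then 1 else 0)"

definition below :: "nat \<Rightarrow> (nat \<Rightarrow> int) \<Rightarrow> int" where "below k a = (\<Sum>i=1..<k. a i)"
definition above :: "nat \<Rightarrow> nat \<Rightarrow> (nat \<Rightarrow> int) \<Rightarrow> int" where "above n k a = (\<Sum>i=k+1..n. a i)"

lemma below_shift: "below k (\<lambda>i. a i + unit j i) = below k a + (if 1 \<le> j \<and> j < k then 1 else 0)"
  "below k (\<lambda>i. a i - unit j i) = below k a - (if 1 \<le> j \<and> j < k then 1 else 0)"
  by (auto simp: below_def unit_def sum.distrib sum_subtractf)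

lemma above_shift: "above n k (\<lambda>i. a i + unit j i) = above n k a + (if k < j \<and> j \<le> n then 1 else 0)"
  "above n k (\<lambda>i. a i - unit j i) = above n k a - (if k < j \<and> j \<le> n then 1 else 0)"
  by (auto simp: above_def unit_def sum.distrib sum_subtractf)

text \<open>The exponent of z_i in the leading monomial of a word: a letter \<open>W i\<close>
  counts as z_i^-1 Q_i.\<close>

definition aexp :: "gen list \<Rightarrow> nat \<Rightarrow> int" where
  "aexp u i = int (count_list u (Z i)) - int (count_list u (W i))"
definition cexp :: "gen list \<Rightarrow> nat \<Rightarrow> int" where
  "cexp u i = int (count_list u (W i))"

context
  fixes q :: complex and n :: nat
  assumes q0: "q \<noteq> 0"
begin

definition Zop :: "nat \<Rightarrow> coeffs \<Rightarrow> coeffs" where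
  "Zop j F = (\<lambda>a c. q powi (- below j a) * F (\<lambda>i. a i - unit j i) c)"

text \<open>Left multiplication by z_k^-1 Q_k. The element Q_k pays q^2 for each later z, and z_k^-1
  pays q for each earlier one.\<close>

definition Uop :: "nat \<Rightarrow> coeffs \<Rightarrow> coeffs" where
  "Uop k F = (\<lambda>a c. q powi (below k a + 2 * above n k a) *
    F (\<lambda>i. a i + unit k i) (\<lambda>i. c i - unit k i))"

text \<open>Left multiplication by z_k^-1 Q_(k-1). Here Q_(k-1) also passes z_k, whose exponent
  before the multiplication is \<open>a k + 1\<close>; the case k = 1 reflects Q_0 = 0.\<close>

definition Vop :: "nat \<Rightarrow> coeffs \<Rightarrow> coeffs" where
  "Vop k F = (\<lambda>a c. if k = 1 then 0 else q powi (below k a + 2 * above n k a + 2 * (a k + 1)) *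
    F (\<lambda>i. a i + unit k i) (\<lambda>i. c i - unit (k - 1) i))"

definition Kop :: "nat \<Rightarrow> coeffs \<Rightarrow> coeffs" where
  "Kop k F = (\<lambda>a c. if k = 0 then 0 else q powi (2 * above n k a) * F a (\<lambda>i. c i - unit k i))"

definition Wop :: "nat \<Rightarrow> coeffs \<Rightarrow> coeffs" where
  "Wop k F = (\<lambda>a c. Uop k F a c - Vop k F a c)"

lemma qadd: "q powi a * q powi b = q powi (a + b)" "q powi a * (q powi b * x) = q powi (a + b) * x"
  using q0 by (simp_all add: power_int_add)

lemma qscale: "q * q powi b = q powi (1 + b)" "inverse q * q powi b = q powi (- 1 + b)"
  "q * (q powi b * x) = q powi (1 + b) * x" "inverse q * (q powi b * x) = q powi (- 1 + b) * x"
proof -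
  show *: "q * q powi b = q powi (1 + b)" "inverse q * q powi b = q powi (- 1 + b)" for b
    using q0 power_int_add[of q "-1" b] by (simp_all add: power_int_add power_int_minus)
  show "q * (q powi b * x) = q powi (1 + b) * x" "inverse q * (q powi b * x) = q powi (- 1 + b) * x"
    using *[of b] by (simp_all add: mult.assoc[symmetric])
qed

lemma Z_Z:
  assumes "1 \<le> i" "i < j" "j \<le> n"
  shows "Zop i (Zop j F) a c = q * Zop j (Zop i F) a c"
  using assms
  by (simp add: Zop_def below_shift qadd qscale diff_right_commute[of _ "unit i _" "unit j _"] algebra_simps)

lemma U_Z:
  assumes "1 \<le> i" "i \<le> n" "1 \<le> j" "j \<le> n" "i \<noteq> j"
  shows "Uop j (Zop i F) a c = q * Zop i (Uop j F) a c"
  using assms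
  by (cases "i < j")
   (simp_all add: Zop_def Uop_def below_shift above_shift qadd qscale algebra_simps)

lemma V_Z:
  assumes "1 \<le> i" "i \<le> n" "1 \<le> j" "j \<le> n" "i \<noteq> j"
  shows "Vop j (Zop i F) a c = q * Zop i (Vop j F) a c"
  using assms
  by (cases "i < j")
   (simp_all add: Zop_def Vop_def below_shift above_shift qadd qscale algebra_simps unit_def[of i j])

lemma U_U:
  assumes "1 \<le> i" "i < j" "j \<le> n"
  shows "Uop i (Uop j F) a c = inverse q * Uop j (Uop i F) a c"
  using assms
  by (simp add: Uop_def below_shift above_shift qadd qscale algebra_simps)

lemma U_V:
  assumes "1 \<le> i" "i < j" "j \<le> n"
  shows "Uop i (Vop j F) a c = inverse q * Vop j (Uop i F) a c"
  using assms
  by (simp add: Uop_def Vop_def below_shift above_shift qadd qscale algebra_simps unit_def[of i j])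

lemma V_U:
  assumes "1 \<le> i" "i < j" "j \<le> n"
  shows "Vop i (Uop j F) a c = inverse q * Uop j (Vop i F) a c"
  using assms
  by (simp add: Uop_def Vop_def below_shift above_shift qadd qscale algebra_simps unit_def[of j i])

lemma V_V:
  assumes "1 \<le> i" "i < j" "j \<le> n"
  shows "Vop i (Vop j F) a c = inverse q * Vop j (Vop i F) a c"
  using assms
  by (simp add: Vop_def below_shift above_shift qadd qscale algebra_simps unit_def[of i j] unit_def[of j i])

lemma U_diff: "Uop k (\<lambda>a c. F a c - G a c) a c = Uop k F a c - Uop k G a c"
  and V_diff: "Vop k (\<lambda>a c. F a c - G a c) a c = Vop k F a c - Vop k G a c"
  and Z_diff: "Zop k (\<lambda>a c. F a c - G a c) a c = Zop k F a c - Zop k G a c"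
  by (simp_all add: Uop_def Vop_def Zop_def right_diff_distrib)

lemma W_Z:
  assumes "1 \<le> i" "i \<le> n" "1 \<le> j" "j \<le> n" "i \<noteq> j"
  shows "Wop j (Zop i F) a c = q * Zop i (Wop j F) a c"
  unfolding Wop_def Z_diff using U_Z[OF assms] V_Z[OF assms] by (simp add: right_diff_distrib)

lemma W_W:
  assumes "1 \<le> i" "i < j" "j \<le> n"
  shows "Wop i (Wop j F) a c = inverse q * Wop j (Wop i F) a c"
  unfolding Wop_def U_diff V_diff U_U[OF assms] U_V[OF assms] V_U[OF assms] V_V[OF assms]
  by (simp add: right_diff_distrib)

lemma above_Suc: "k \<le> n \<Longrightarrow> 1 \<le> k \<Longrightarrow> above n (k - 1) a = a k + above n k a"
  by (cases k) (simp_all add: above_def sum.atLeast_Suc_atMost)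

lemma Z_W:
  assumes "1 \<le> k" "k \<le> n"
  shows "Zop k (Wop k F) a c = Kop k F a c - Kop (k - 1) F a c"
  using assms above_Suc[of k a]
  by (auto simp: Wop_def Zop_def Uop_def Vop_def Kop_def below_shift above_shift qadd
      right_diff_distrib unit_def[of k k] distrib_left add.commute)

lemma W_Zk:
  assumes "1 \<le> k" "k \<le> n"
  shows "Wop k (Zop k F) a c = Kop k F a c - q\<^sup>2 * Kop (k - 1) F a c"
proof -
  have "q\<^sup>2 * q powi b = q powi (2 + b)" "q\<^sup>2 * (q powi b * x) = q powi (2 + b) * x" for b and x :: complex
    using q0 by (simp_all add: power_int_add)
  then show ?thesis
    using assms above_Suc[of k a]
    by (auto simp: Wop_def Zop_def Uop_def Vop_def Kop_def below_shift above_shift qadd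
      right_diff_distrib unit_def[of k k] distrib_left add.commute)
qed

lemma sum_Z_W: "k \<le> n \<Longrightarrow> (\<Sum>s=1..k. Zop s (Wop s F) a c) = Kop k F a c"
proof (induction k)
  case (Suc k)
  then show ?case using Z_W[of "Suc k"] by simp
qed (simp add: Kop_def)

text \<open>The model has z_k w_k = Q_k - Q_(k-1) and w_k z_k = Q_k - q^2 Q_(k-1). Their difference
  is (1 - q^2) Q_(k-1), and the sum of the z_s w_s telescopes to Q_(k-1).\<close>

lemma W_Z_same:
  assumes "1 \<le> k" "k \<le> n"
  shows "Wop k (Zop k F) a c =
    Zop k (Wop k F) a c + (1 - q\<^sup>2) * (\<Sum>s=1..<k. Zop s (Wop s F) a c)"
proof -
  have "{1..<k} = {1..k-1}" using assms by auto
  then show ?thesis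
    using sum_Z_W[of "k - 1"] assms W_Zk[OF assms] Z_W[OF assms] by (simp add: algebra_simps)
qed

definition gen_op :: "gen \<Rightarrow> coeffs \<Rightarrow> coeffs" where
  "gen_op g = (case g of Z j \<Rightarrow> Zop j | W j \<Rightarrow> Wop j)"

lemma gen_op_simps [simp]: "gen_op (Z j) = Zop j" "gen_op (W j) = Wop j"
  by (simp_all add: gen_op_def)

lemma gen_op_sum:
  "gen_op g (\<lambda>a c. \<Sum>v\<in>V. s v * F v a c) = (\<lambda>a c. \<Sum>v\<in>V. s v * gen_op g (F v) a c)"
proof -
  have "Uop k (\<lambda>a c. \<Sum>v\<in>V. s v * F v a c) a c = (\<Sum>v\<in>V. s v * Uop k (F v) a c)"
    "Vop k (\<lambda>a c. \<Sum>v\<in>V. s v * F v a c) a c = (\<Sum>v\<in>V. s v * Vop k (F v) a c)"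
    "Zop k (\<lambda>a c. \<Sum>v\<in>V. s v * F v a c) a c = (\<Sum>v\<in>V. s v * Zop k (F v) a c)" for k a c
    by (simp_all add: Uop_def Vop_def Zop_def sum_distrib_left mult.left_commute)
  then show ?thesis
    by (cases g) (simp_all add: Wop_def right_diff_distrib sum_subtractf fun_eq_iff)
qed

lemma foldr_gen_op_sum:
  "foldr gen_op u (\<lambda>a c. \<Sum>v\<in>V. s v * F v a c) = (\<lambda>a c. \<Sum>v\<in>V. s v * foldr gen_op u (F v) a c)"
  by (induction u) (simp_all add: gen_op_sum)

definition act :: "(gen list \<Rightarrow>\<^sub>0 complex) \<Rightarrow> coeffs \<Rightarrow> coeffs" where
  "act p F = (\<lambda>a c. lin_ext (\<lambda>u. foldr gen_op u F a c) p)"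

lemma act_mult: "act (x * y) F = act x (act y F)"
proof (intro ext)
  fix a c
  have *: "act y F = (\<lambda>a c. \<Sum>v\<in>Poly_Mapping.keys y. Poly_Mapping.lookup y v * foldr gen_op v F a c)"
    by (simp add: act_def lin_ext_def)
  have "foldr gen_op u (act y F) a c = lin_ext (\<lambda>v. foldr gen_op (u @ v) F a c) y" for u
    unfolding * foldr_gen_op_sum by (simp add: lin_ext_def)
  then show "act (x * y) F a c = act x (act y F) a c"
    by (simp add: act_def lin_ext_mult)
qed

lemma act_relation:
  assumes "p \<in> q_relations q n"
  shows "act p F a c = 0"
  using assms unfolding q_relations_def act_def word_def
  by (auto simp: lin_ext_diff lin_ext_add lin_ext_sum const_mult_single sum_distrib_left Z_Z W_W W_Z W_Z_same)

lemma foldr_gen_op_0: "foldr gen_op u (\<lambda>a c. 0) = (\<lambda>a c. 0)"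
  using foldr_gen_op_sum[of u "\<lambda>_. 0" "\<lambda>_ _ _. 0" "{}"] by simp

text \<open>The induction is general in \<open>F\<close> because a right multiple
  \<open>x * a\<close> acts as \<open>x\<close> on \<open>act a F\<close>.\<close>

lemma act_ideal:
  assumes "p \<in> two_sided_ideal S (q_relations q n)"
  shows "act p F = (\<lambda>a c. 0)"
  using assms
proof (induction arbitrary: F rule: two_sided_ideal.induct)
  case (left x y)
  then show ?case by (simp add: act_mult) (simp add: act_def foldr_gen_op_0 lin_ext_def)
qed (auto simp: act_relation act_mult fun_eq_iff, auto simp: act_def lin_ext_add)

section \<open>Leading monomials and linear independence of words\<close>

definition wt :: "(nat \<Rightarrow> int) \<Rightarrow> int" where "wt c = (\<Sum>k=1..n. int k * c k)"

text \<open>With \<open>Q\<^sub>k\<close> of weight \<open>k\<close>, the element \<open>z\<^sub>k\<^sup>-\<^sup>1Q\<^sub>k\<close> is the top part of \<open>w\<^sub>k\<close>. So a word in the generators, in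
  whatever order, has one leading monomial, which records its exponents.\<close>

definition lead :: "coeffs \<Rightarrow> (nat \<Rightarrow> int) \<Rightarrow> (nat \<Rightarrow> int) \<Rightarrow> bool" where
  "lead F a0 c0 \<longleftrightarrow> F a0 c0 \<noteq> 0 \<and> (\<forall>a c. F a c \<noteq> 0 \<longrightarrow> a = a0 \<and> (c = c0 \<or> wt c < wt c0))"

lemma wt_shift:
  assumes "1 \<le> j" "j \<le> n"
  shows "wt (\<lambda>i. c i + unit j i) = wt c + int j" "wt (\<lambda>i. c i - unit j i) = wt c - int j"
proof -
  have "(\<Sum>k=1..n. int k * unit j k) = (\<Sum>k=1..n. if k = j then int j else 0)"
    by (rule sum.cong) (auto simp: unit_def)
  then have "(\<Sum>k=1..n. int k * unit j k) = int j" using assms by simp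
  then show "wt (\<lambda>i. c i + unit j i) = wt c + int j" "wt (\<lambda>i. c i - unit j i) = wt c - int j"
    by (simp_all add: wt_def distrib_left right_diff_distrib sum.distrib sum_subtractf)
qed

lemma lead_Z:
  assumes "lead F a0 c0"
  shows "lead (Zop j F) (\<lambda>i. a0 i + unit j i) c0"
  unfolding lead_def
proof (intro conjI allI impI)
  show "Zop j F (\<lambda>i. a0 i + unit j i) c0 \<noteq> 0"
    using assms q0 by (simp add: lead_def Zop_def)
  fix a c assume "Zop j F a c \<noteq> 0"
  then have "F (\<lambda>i. a i - unit j i) c \<noteq> 0" by (simp add: Zop_def)
  then have "(\<lambda>i. a i - unit j i) = a0" and c: "c = c0 \<or> wt c < wt c0"
    using assms unfolding lead_def by blast+
  then show "a = (\<lambda>i. a0 i + unit j i)" by auto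
  show "c = c0 \<or> wt c < wt c0" by (rule c)
qed

lemma lead_W:
  assumes F: "lead F a0 c0" and k: "1 \<le> k" "k \<le> n"
  shows "lead (Wop k F) (\<lambda>i. a0 i - unit k i) (\<lambda>i. c0 i + unit k i)"
  unfolding lead_def
proof (intro conjI allI impI)
  \<comment> \<open>The k-part raises the weight by k, this one only by k - 1. To reach the new
    leading place it would need a term of \<open>F\<close> of weight \<open>wt c0 + 1\<close>, above
    the leading one.\<close>
  have "Vop k F (\<lambda>i. a0 i - unit k i) (\<lambda>i. c0 i + unit k i) = 0"
  proof (cases "k = 1")
    case False
    then have k1: "1 \<le> k - 1" "k - 1 \<le> n" using k by auto
    let ?c = "\<lambda>i. (\<lambda>i. c0 i + unit k i) i - unit (k - 1) i"
    have "wt ?c = wt c0 + 1"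
      unfolding wt_shift[OF k1] wt_shift[OF k] using k by (simp add: of_nat_diff)
    then have c: "?c \<noteq> c0" "\<not> wt ?c < wt c0" by (metis less_irrefl zless_add1_eq, simp)
    have "F a0 ?c = 0"
    proof (rule ccontr)
      assume "F a0 ?c \<noteq> 0"
      then have "?c = c0 \<or> wt ?c < wt c0" using F unfolding lead_def by blast
      then show False using c by blast
    qed
    then show ?thesis by (simp add: Vop_def)
  qed (simp add: Vop_def)
  then show "Wop k F (\<lambda>i. a0 i - unit k i) (\<lambda>i. c0 i + unit k i) \<noteq> 0"
    using F q0 by (simp add: Wop_def Uop_def lead_def)
  fix a c assume "Wop k F a c \<noteq> 0"
  then have "Uop k F a c \<noteq> 0 \<or> Vop k F a c \<noteq> 0" by (auto simp: Wop_def)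
  then have "a = (\<lambda>i. a0 i - unit k i) \<and>
      (c = (\<lambda>i. c0 i + unit k i) \<or> wt c < wt (\<lambda>i. c0 i + unit k i))"
  proof
    assume "Uop k F a c \<noteq> 0"
    then have "F (\<lambda>i. a i + unit k i) (\<lambda>i. c i - unit k i) \<noteq> 0" by (simp add: Uop_def)
    then have a: "(\<lambda>i. a i + unit k i) = a0"
      and c: "(\<lambda>i. c i - unit k i) = c0 \<or> wt (\<lambda>i. c i - unit k i) < wt c0"
      using F unfolding lead_def by blast+
    have "a = (\<lambda>i. a0 i - unit k i)" using a by auto
    moreover have "c = (\<lambda>i. c0 i + unit k i) \<or> wt c < wt (\<lambda>i. c0 i + unit k i)"
    proof -
      have "c = (\<lambda>i. c0 i + unit k i)" if "(\<lambda>i. c i - unit k i) = c0" using that by auto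
      then show ?thesis using c wt_shift(1)[OF k, of c0] wt_shift(2)[OF k, of c] by linarith
    qed
    ultimately show ?thesis by blast
  next
    assume V: "Vop k F a c \<noteq> 0"
    then have k1: "1 \<le> k - 1" "k - 1 \<le> n" using k by (auto simp: Vop_def split: if_splits)
    from V have "F (\<lambda>i. a i + unit k i) (\<lambda>i. c i - unit (k - 1) i) \<noteq> 0"
      by (simp add: Vop_def split: if_splits)
    then have a: "(\<lambda>i. a i + unit k i) = a0"
      and c: "(\<lambda>i. c i - unit (k - 1) i) = c0 \<or> wt (\<lambda>i. c i - unit (k - 1) i) < wt c0"
      using F unfolding lead_def by blast+
    have "a = (\<lambda>i. a0 i - unit k i)" using a by auto
    moreover have "wt c < wt (\<lambda>i. c0 i + unit k i)"
    proof -
      have "wt (\<lambda>i. c i - unit (k - 1) i) \<le> wt c0" using c by (metis less_le_not_le order_refl)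
      then show ?thesis using k unfolding wt_shift[OF k] wt_shift[OF k1] by simp
    qed
    ultimately show ?thesis by blast
  qed
  then show "a = (\<lambda>i. a0 i - unit k i)"
    "c = (\<lambda>i. c0 i + unit k i) \<or> wt c < wt (\<lambda>i. c0 i + unit k i)" by blast+
qed

definition vac :: coeffs where "vac a c = (if a = (\<lambda>_. 0) \<and> c = (\<lambda>_. 0) then 1 else 0)"

lemma lead_word:
  assumes "set u \<subseteq> gens n"
  shows "lead (foldr gen_op u vac) (aexp u) (cexp u)"
  using assms
proof (induction u)
  case Nil
  show ?case by (simp add: lead_def vac_def aexp_def[abs_def] cexp_def[abs_def])
next
  case (Cons g u)
  show ?case
  proof (cases g)
    case (Z j)
    then have "aexp (g # u) = (\<lambda>i. aexp u i + unit j i)" "cexp (g # u) = cexp u"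
      by (auto simp: aexp_def cexp_def unit_def)
    then show ?thesis using lead_Z[OF Cons.IH, of j] Cons.prems Z by simp
  next
    case (W j)
    then have "aexp (g # u) = (\<lambda>i. aexp u i - unit j i)" "cexp (g # u) = (\<lambda>i. cexp u i + unit j i)"
      by (auto simp: aexp_def cexp_def unit_def)
    moreover have "1 \<le> j" "j \<le> n" using Cons.prems W by (auto simp: gens_def)
    ultimately show ?thesis using lead_W[OF Cons.IH, of j] Cons.prems W by simp
  qed
qed

text \<open>Among the words with nonzero coefficient one of maximal weight is chosen, and the
  vanishing action is read off at its leading monomial. Another contributing word would have the
  same exponents or a larger weight; injectivity excludes the first and maximality the
  second.\<close>

lemma words_independent:
  fixes \<phi> :: "gen \<Rightarrow> 'a::complex_algebra_1"
  assumes pres: "presented_by (gens n) (q_relations q n) \<phi>"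
    and S: "finite S" "\<And>u. u \<in> S \<Longrightarrow> set u \<subseteq> gens n" "inj_on (\<lambda>u. (aexp u, cexp u)) S"
    and sum0: "(\<Sum>u\<in>S. \<kappa> u *\<^sub>C prod_list (map \<phi> u)) = 0"
    and u: "u \<in> S"
  shows "\<kappa> u = 0"
proof (rule ccontr)
  assume "\<kappa> u \<noteq> 0"
  define p where "p = (\<Sum>u\<in>S. Poly_Mapping.single u (\<kappa> u))"
  have "Poly_Mapping.keys p \<subseteq> S"
    using S(1) by (auto simp: p_def in_keys_iff lookup_sum lookup_single when_def split: if_splits)
  then have "p \<in> free_alg (gens n)" using S(2) by (auto simp: free_alg_def)
  moreover have "eval_free \<phi> p = 0"
    using sum0 by (simp add: p_def eval_free_sum eval_free_single)
  ultimately have "p \<in> two_sided_ideal (free_alg (gens n)) (q_relations q n)"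
    using pres unfolding presented_by_def by blast
  then have p0: "act p vac a c = 0" for a c by (simp add: act_ideal)
  define T where "T = {v \<in> S. \<kappa> v \<noteq> 0}"
  have T: "finite T" "T \<noteq> {}" using S(1) u \<open>\<kappa> u \<noteq> 0\<close> by (auto simp: T_def)
  have "Max ((\<lambda>v. wt (cexp v)) ` T) \<in> (\<lambda>v. wt (cexp v)) ` T"
    using T by (intro Max_in) auto
  then obtain v where v: "v \<in> T" "Max ((\<lambda>v. wt (cexp v)) ` T) = wt (cexp v)" by auto
  then have max: "wt (cexp x) \<le> wt (cexp v)" if "x \<in> T" for x
    using Max_ge[of "(\<lambda>v. wt (cexp v)) ` T" "wt (cexp x)"] T that by auto
  let ?f = "\<lambda>x. foldr gen_op x vac (aexp v) (cexp v)"
  have z: "\<kappa> x * ?f x = 0" if x: "x \<in> S" "x \<noteq> v" for x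
  proof (rule ccontr)
    assume nz: "\<kappa> x * ?f x \<noteq> 0"
    then have "x \<in> T" using x by (auto simp: T_def)
    have "aexp v = aexp x" "cexp v = cexp x \<or> wt (cexp v) < wt (cexp x)"
      using lead_word[OF S(2)[OF x(1)]] nz unfolding lead_def by auto
    then have "(aexp v, cexp v) = (aexp x, cexp x)" using max[OF \<open>x \<in> T\<close>] by auto
    then show False using S(3) x v(1) by (auto simp: inj_on_def T_def)
  qed
  have "0 = (\<Sum>x\<in>S. \<kappa> x * ?f x)"
    using p0[of "aexp v" "cexp v"] by (simp add: act_def p_def lin_ext_sum)
  also have "\<dots> = \<kappa> v * ?f v"
  proof -
    have "(\<Sum>x\<in>S - {v}. \<kappa> x * ?f x) = 0" by (rule sum.neutral) (use z in blast)
    then show ?thesis using S(1) v(1) by (simp add: sum.remove[of S v] T_def)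
  qed
  finally show False
    using lead_word[OF S(2), of v] v(1) unfolding lead_def T_def by auto
qed

lemma words_extend:
  fixes \<phi> :: "gen \<Rightarrow> 'a::complex_algebra_1" and f :: "gen list \<Rightarrow> 'a"
  assumes pres: "presented_by (gens n) (q_relations q n) \<phi>"
    and B: "\<And>u. u \<in> B \<Longrightarrow> set u \<subseteq> gens n" "inj_on (\<lambda>u. (aexp u, cexp u)) B"
  shows "\<exists>g. Vector_Spaces.linear scaleC scaleC g \<and> (\<forall>u\<in>B. g (prod_list (map \<phi> u)) = f u)"
proof -
  interpret vector_space_pair "scaleC :: complex \<Rightarrow> 'a \<Rightarrow> 'a" "scaleC :: complex \<Rightarrow> 'a \<Rightarrow> 'a"
    by unfold_locales
  let ?ev = "\<lambda>u. prod_list (map \<phi> u)"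
  \<comment> \<open>Independence is a property of the set of values, so distinct words must first be
    shown to have distinct values; two words with coefficients 1 and -1 are tested.\<close>
  have inj: "inj_on ?ev B"
  proof (rule inj_onI, rule ccontr)
    fix u v assume uv: "u \<in> B" "v \<in> B" "?ev u = ?ev v" "u \<noteq> v"
    let ?\<kappa> = "\<lambda>x. if x = u then 1 else - 1 :: complex"
    have "inj_on (\<lambda>u. (aexp u, cexp u)) {u, v}"
      by (rule inj_on_subset[OF B(2)]) (use uv in auto)
    moreover have "(\<Sum>x\<in>{u, v}. ?\<kappa> x *\<^sub>C ?ev x) = 0"
      using uv(3,4) not_sym[OF uv(4)] by (simp add: scaleC_one complex_vs.scale_minus_left)
    ultimately have "?\<kappa> u = 0"
      using words_independent[OF pres, of "{u, v}" ?\<kappa> u] uv B(1) by blast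
    then show False by simp
  qed
  have "complex_vs.independent (?ev ` B)"
    unfolding complex_vs.independent_explicit_finite_subsets
  proof (intro allI impI ballI)
    fix S \<kappa> x assume S: "S \<subseteq> ?ev ` B" "finite S" "(\<Sum>v\<in>S. \<kappa> v *\<^sub>C v) = 0" "x \<in> S"
    obtain S' where S': "S' \<subseteq> B" "finite S'" "S = ?ev ` S'"
      using finite_subset_image[OF S(2,1)] by blast
    obtain u where u: "u \<in> S'" "x = ?ev u" using S(4) S'(3) by blast
    have "(\<Sum>u\<in>S'. \<kappa> (?ev u) *\<^sub>C ?ev u) = 0"
      using S(3) unfolding S'(3) by (subst (asm) sum.reindex) (use inj S' inj_on_subset in auto)
    then have "\<kappa> (?ev u) = 0"
      by (rule words_independent[OF pres S'(2) _ _ _ u(1), rotated 2])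
        (use B S' in \<open>auto intro: inj_on_subset\<close>)
    then show "\<kappa> x = 0" by (simp add: u)
  qed
  from linear_independent_extend[OF this, of "\<lambda>x. f (inv_into B ?ev x)"]
  obtain g where "Vector_Spaces.linear scaleC scaleC g" "\<forall>x\<in>?ev ` B. g x = f (inv_into B ?ev x)"
    by blast
  moreover have "inv_into B ?ev (?ev u) = u" if "u \<in> B" for u
    using inj that by (rule inv_into_f_f)
  ultimately show ?thesis by force
qed

end

section \<open>Existence and uniqueness of the \<open>q\<close>-derivatives\<close>

lemma presented_by_relation:
  assumes "presented_by G R \<phi>" "r \<in> R"
  shows "eval_free \<phi> r = 0"
  using assms two_sided_ideal.base[OF assms(2), of "free_alg G"] unfolding presented_by_def by blast

lemma is_q_algebra_relations:
  assumes "q \<noteq> 0" "is_q_algebra q n z w"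
  shows "q_relations_hold q n z w"
proof
  note rel = presented_by_relation[OF assms(2)[unfolded is_q_algebra_def]]
  note ev = word_def const_mult_single eval_free_diff eval_free_add eval_free_single eval_free_sum
    scaleC_one sum_distrib_left complex_vs.scale_sum_right
  show "q \<noteq> 0" by (rule assms)
  show "z i * z j = q *\<^sub>C (z j * z i)" if "1 \<le> i" "i < j" "j \<le> n" for i j
  proof -
    have "word [Z i, Z j] - const q * word [Z j, Z i] \<in> q_relations q n"
      using that unfolding q_relations_def by blast
    from rel[OF this] show ?thesis by (simp add: ev)
  qed
  show "w i * w j = inverse q *\<^sub>C (w j * w i)" if "1 \<le> i" "i < j" "j \<le> n" for i j
  proof -
    have "word [W i, W j] - const (inverse q) * word [W j, W i] \<in> q_relations q n"
      using that unfolding q_relations_def by blast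
    from rel[OF this] show ?thesis by (simp add: ev)
  qed
  show "w j * z i = q *\<^sub>C (z i * w j)" if "1 \<le> i" "i \<le> n" "1 \<le> j" "j \<le> n" "i \<noteq> j" for i j
  proof -
    have "i \<in> {1..n}" "j \<in> {1..n}" using that by auto
    then have "word [W j, Z i] - const q * word [Z i, W j] \<in> q_relations q n"
      using that(5) unfolding q_relations_def by blast
    from rel[OF this] show ?thesis by (simp add: ev)
  qed
  show "w k * z k = z k * w k + (1 - q\<^sup>2) *\<^sub>C (\<Sum>s=1..<k. z s * w s)" if "1 \<le> k" "k \<le> n" for k
  proof -
    have "k \<in> {1..n}" using that by auto
    then have "word [W k, Z k] - (word [Z k, W k] + const (1 - q\<^sup>2) * (\<Sum>s=1..<k. word [Z s, W s]))
        \<in> q_relations q n"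
      unfolding q_relations_def by blast
    from rel[OF this] show ?thesis by (simp add: ev)
  qed
qed

section \<open>Ordered monomials as words whose letter counts recover the exponents\<close>

definition gen_word :: "(nat \<Rightarrow> gen) \<Rightarrow> nat \<Rightarrow> (nat \<Rightarrow> nat) \<Rightarrow> gen list" where
  "gen_word g k r = concat (map (\<lambda>i. replicate (r i) (g i)) [1..<Suc k])"

lemma gen_word_0 [simp]: "gen_word g 0 r = []"
  and gen_word_Suc: "gen_word g (Suc k) r = gen_word g k r @ replicate (r (Suc k)) (g (Suc k))"
  by (simp_all add: gen_word_def)

lemma count_list_replicate_if: "count_list (replicate m x) y = (if x = y then m else 0)"
  by (induction m) auto

lemma count_gen_word [simp]:
  "count_list (gen_word Z k r) (Z i) = (if 1 \<le> i \<and> i \<le> k then r i else 0)"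
  "count_list (gen_word W k r) (W i) = (if 1 \<le> i \<and> i \<le> k then r i else 0)"
  "count_list (gen_word Z k r) (W i) = 0" "count_list (gen_word W k r) (Z i) = 0"
  by (induction k) (auto simp: gen_word_Suc count_list_replicate_if le_Suc_eq)

lemma gen_word_cong: "(\<And>i. 1 \<le> i \<Longrightarrow> i \<le> k \<Longrightarrow> r i = r' i) \<Longrightarrow> gen_word g k r = gen_word g k r'"
  by (induction k) (auto simp: gen_word_Suc)

lemma set_gen_word: "set (gen_word Z k r) \<subseteq> gens k" "set (gen_word W k r) \<subseteq> gens k"
  by (auto simp: gen_word_def gens_def)

lemma eval_gen_word:
  "prod_list (map (case_gen z w) (gen_word Z k r)) = ord_mon k z r"
  "prod_list (map (case_gen z w) (gen_word W k r)) = ord_mon k w r"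
proof -
  have rep: "prod_list (replicate m x) = x ^ m" for m and x :: 'a
    by (induction m) auto
  show "prod_list (map (case_gen z w) (gen_word Z k r)) = ord_mon k z r"
    "prod_list (map (case_gen z w) (gen_word W k r)) = ord_mon k w r"
    by (induction k) (auto simp: gen_word_Suc ord_mon_Suc rep)
qed

lemma words_inj:
  "inj_on (\<lambda>u. (aexp u, cexp u)) {gen_word Z n r @ gen_word W n t | r t. True}"
  "inj_on (\<lambda>u. (aexp u, cexp u)) {gen_word W n r @ gen_word Z n t | r t. True}"
proof -
  have counts: "count_list u (Z i) = count_list v (Z i) \<and> count_list u (W i) = count_list v (W i)"
    if "(aexp u, cexp u) = (aexp v, cexp v)" for u v i
  proof -
    have "aexp u i = aexp v i" "cexp u i = cexp v i" using that by auto
    then show ?thesis by (simp add: aexp_def cexp_def)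
  qed
  show "inj_on (\<lambda>u. (aexp u, cexp u)) {gen_word Z n r @ gen_word W n t | r t. True}"
  proof (rule inj_onI, clarify)
    fix r t r' t' assume "aexp (gen_word Z n r @ gen_word W n t) = aexp (gen_word Z n r' @ gen_word W n t')"
      "cexp (gen_word Z n r @ gen_word W n t) = cexp (gen_word Z n r' @ gen_word W n t')"
    then have rt: "r i = r' i" "t i = t' i" if "1 \<le> i" "i \<le> n" for i
      using that counts[of "gen_word Z n r @ gen_word W n t" "gen_word Z n r' @ gen_word W n t'" i] by simp_all
    have "gen_word Z n r = gen_word Z n r'" "gen_word W n t = gen_word W n t'"
      by (rule gen_word_cong, erule (1) rt)+
    then show "gen_word Z n r @ gen_word W n t = gen_word Z n r' @ gen_word W n t'" by simp
  qed
  show "inj_on (\<lambda>u. (aexp u, cexp u)) {gen_word W n r @ gen_word Z n t | r t. True}"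
  proof (rule inj_onI, clarify)
    fix r t r' t' assume "aexp (gen_word W n r @ gen_word Z n t) = aexp (gen_word W n r' @ gen_word Z n t')"
      "cexp (gen_word W n r @ gen_word Z n t) = cexp (gen_word W n r' @ gen_word Z n t')"
    then have rt: "r i = r' i" "t i = t' i" if "1 \<le> i" "i \<le> n" for i
      using that counts[of "gen_word W n r @ gen_word Z n t" "gen_word W n r' @ gen_word Z n t'" i] by simp_all
    have "gen_word W n r = gen_word W n r'" "gen_word Z n t = gen_word Z n t'"
      by (rule gen_word_cong, erule (1) rt)+
    then show "gen_word W n r @ gen_word Z n t = gen_word W n r' @ gen_word Z n t'" by simp
  qed
qed

text \<open>Letter counts return the exponents set to 0 outside 1..n; the formula for a derivative
  takes the same value on them.\<close>

lemma restrict_exponent: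
  fixes r :: "nat \<Rightarrow> nat" and x :: "nat \<Rightarrow> 'a::monoid_mult"
  assumes "1 \<le> i" "i \<le> n"
  defines "r' \<equiv> (\<lambda>i. if 1 \<le> i \<and> i \<le> n then r i else 0)"
  shows "(\<Sum>j=i+1..n. r' j) = (\<Sum>j=i+1..n. r j)" "r' i = r i"
    "ord_mon n x (r'(i := r i - 1)) = ord_mon n x (r(i := r i - 1))" "ord_mon n x r' = ord_mon n x r"
  using assms by (auto intro!: sum.cong ord_mon_cong)

context
  fixes q :: complex and n :: nat and z w :: "nat \<Rightarrow> 'a::complex_algebra_1"
  assumes q0: "q \<noteq> 0" and alg: "is_q_algebra q n z w"
begin

interpretation q_relations_hold q n z w
  by (rule is_q_algebra_relations[OF q0 alg])

lemma ex_dz: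
  assumes "1 \<le> i" "i \<le> n"
  shows "\<exists>D. is_dz q n z w i D"
proof -
  let ?r = "\<lambda>u i. count_list u (Z i)" and ?t = "\<lambda>u i. count_list u (W i)"
  \<comment> \<open>The prescribed value is read off from letter counts, so it is a function of the
    word and not of the chosen exponent functions.\<close>
  define f where "f u = (q powi int (\<Sum>j=i+1..n. ?r u j) * qnum q (int (?r u i))) *\<^sub>C
         (ord_mon n z ((?r u)(i := ?r u i - 1)) * ord_mon n w (?t u))" for u
  obtain D where D: "Vector_Spaces.linear scaleC scaleC D"
    "\<forall>u\<in>{gen_word Z n r @ gen_word W n t | r t. True}. D (prod_list (map (case_gen z w) u)) = f u"
  proof -
    have "set u \<subseteq> gens n" if "u \<in> {gen_word Z n r @ gen_word W n t | r t. True}" for u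
      using that by (auto dest: subsetD[OF set_gen_word(1)] subsetD[OF set_gen_word(2)])
    from words_extend[OF q0 alg[unfolded is_q_algebra_def] this words_inj(1), where f = f] that
    show ?thesis by blast
  qed
  have "D (ord_mon n z r * ord_mon n w t) =
       (q powi int (\<Sum>j=i+1..n. r j) * qnum q (int (r i))) *\<^sub>C
         (ord_mon n z (r(i := r i - 1)) * ord_mon n w t)" for r t
  proof -
    have "D (prod_list (map (case_gen z w) (gen_word Z n r @ gen_word W n t))) = f (gen_word Z n r @ gen_word W n t)"
      using D(2) by blast
    then show ?thesis
      unfolding f_def map_append prod_list.append eval_gen_word count_list_append count_gen_word
        add_0_right add_0_left restrict_exponent[OF assms] .
  qed
  then show ?thesis using D(1) unfolding is_dz_def by blast
qed

lemma ex_dw: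
  assumes "1 \<le> i" "i \<le> n"
  shows "\<exists>D. is_dw q n z w i D"
proof -
  let ?t = "\<lambda>u i. count_list u (Z i)" and ?r = "\<lambda>u i. count_list u (W i)"
  define f where "f u = (q powi (- int (\<Sum>j=i+1..n. ?r u j)) * qnum q (int (?r u i))) *\<^sub>C
         (ord_mon n w ((?r u)(i := ?r u i - 1)) * ord_mon n z (?t u))" for u
  obtain D where D: "Vector_Spaces.linear scaleC scaleC D"
    "\<forall>u\<in>{gen_word W n r @ gen_word Z n t | r t. True}. D (prod_list (map (case_gen z w) u)) = f u"
  proof -
    have "set u \<subseteq> gens n" if "u \<in> {gen_word W n r @ gen_word Z n t | r t. True}" for u
      using that by (auto dest: subsetD[OF set_gen_word(1)] subsetD[OF set_gen_word(2)])
    from words_extend[OF q0 alg[unfolded is_q_algebra_def] this words_inj(2), where f = f] that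
    show ?thesis by blast
  qed
  have "D (ord_mon n w r * ord_mon n z t) =
       (q powi (- int (\<Sum>j=i+1..n. r j)) * qnum q (int (r i))) *\<^sub>C
         (ord_mon n w (r(i := r i - 1)) * ord_mon n z t)" for r t
  proof -
    have "D (prod_list (map (case_gen z w) (gen_word W n r @ gen_word Z n t))) = f (gen_word W n r @ gen_word Z n t)"
      using D(2) by blast
    then show ?thesis
      unfolding f_def map_append prod_list.append eval_gen_word count_list_append count_gen_word
        add_0_right add_0_left restrict_exponent[OF assms] .
  qed
  then show ?thesis using D(1) unfolding is_dw_def by blast
qed

lemma word_hom:
  "set u \<subseteq> gens n \<Longrightarrow> \<exists>c d. prod_list (map (case_gen z w) u) \<in> hom n c d"
proof (induction u)
  case Nil
  then show ?case using one_hom by auto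
next
  case (Cons g u)
  then obtain c d where cd: "prod_list (map (case_gen z w) u) \<in> hom n c d" by auto
  show ?case
  proof (cases g)
    case (Z j)
    then have "1 \<le> j" "j \<le> n" using Cons.prems by (auto simp: gens_def)
    from z_mult_hom[OF this order_refl cd] show ?thesis using Z by auto
  next
    case (W j)
    then have "1 \<le> j" "j \<le> n" using Cons.prems by (auto simp: gens_def)
    from w_mult_hom[OF this order_refl cd] show ?thesis using W by auto
  qed
qed

text \<open>Evaluation is onto, so every element is a combination of words, and the value of each
  word lies in some \<open>hom n c d\<close>.\<close>

lemma linear_eq_on_hom:
  assumes "Vector_Spaces.linear scaleC scaleC D" "Vector_Spaces.linear scaleC scaleC D'"
    and eq: "\<And>c d x. x \<in> hom n c d \<Longrightarrow> D x = D' x"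
  shows "D = (D' :: 'a \<Rightarrow> 'a)"
proof
  fix x :: 'a
  have lin: "L (\<Sum>u\<in>K. c u *\<^sub>C y u) = (\<Sum>u\<in>K. c u *\<^sub>C L (y u))"
    if "Vector_Spaces.linear scaleC scaleC L" for L :: "'a \<Rightarrow> 'a" and K c and y :: "gen list \<Rightarrow> 'a"
  proof -
    have "L 0 = 0" using that unfolding linear_scaleC_iff by (metis complex_vs.scale_zero_left)
    then show ?thesis
      using that by (induction K rule: infinite_finite_induct) (auto simp: linear_scaleC_iff)
  qed
  obtain p where p: "p \<in> free_alg (gens n)" "x = eval_free (case_gen z w) p"
    using alg unfolding is_q_algebra_def presented_by_def by blast
  show "D x = D' x"
    unfolding p(2) eval_free_def lin[OF assms(1)] lin[OF assms(2)]
  proof (rule sum.cong[OF refl])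
    fix u assume "u \<in> Poly_Mapping.keys p"
    then have "set u \<subseteq> gens n" using p(1) by (auto simp: free_alg_def)
    from word_hom[OF this] show "Poly_Mapping.lookup p u *\<^sub>C D (prod_list (map (case_gen z w) u)) =
        Poly_Mapping.lookup p u *\<^sub>C D' (prod_list (map (case_gen z w) u))"
      using eq by auto
  qed
qed

lemma is_dz_dz:
  assumes "1 \<le> i" "i \<le> n"
  shows "is_dz q n z w i (dz q n z w i)"
proof -
  have "D = D'" if D: "is_dz q n z w i D" "is_dz q n z w i D'" for D D'
  proof (rule linear_eq_on_hom)
    show lin: "Vector_Spaces.linear scaleC scaleC D" "Vector_Spaces.linear scaleC scaleC D'"
      using D by (auto simp: is_dz_def)
    have 0: "D 0 = 0" "D' 0 = 0"
      using lin unfolding linear_scaleC_iff by (metis complex_vs.scale_zero_left)+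
    show "D x = D' x" if "x \<in> hom n c d" for c d x
      using that by (induction rule: bihom_induct) (use D lin 0 in \<open>auto simp: is_dz_def linear_scaleC_iff\<close>)
  qed
  then have "\<exists>!D. is_dz q n z w i D" using ex_dz[OF assms] by blast
  then show ?thesis unfolding dz_def is_dz_def[symmetric] by (rule theI')
qed

lemma is_dw_dw:
  assumes "1 \<le> i" "i \<le> n"
  shows "is_dw q n z w i (dw q n z w i)"
proof -
  have "D = D'" if D: "is_dw q n z w i D" "is_dw q n z w i D'" for D D'
  proof (rule linear_eq_on_hom)
    show lin: "Vector_Spaces.linear scaleC scaleC D" "Vector_Spaces.linear scaleC scaleC D'"
      using D by (auto simp: is_dw_def)
    have 0: "D 0 = 0" "D' 0 = 0"
      using lin unfolding linear_scaleC_iff by (metis complex_vs.scale_zero_left)+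
    show "D x = D' x" if "x \<in> hom n c d" for c d x
      \<comment> \<open>Through the dual description, monomials with the w's on the left span the
        space; on these \<open>dw\<close> is prescribed.\<close>
      using that unfolding hom_dual[OF order_refl, symmetric]
    proof (induction rule: bihom_induct)
      case (mon r t)
      then show ?case using D lin by (simp add: ord_mon_zd mult_scaleC_left linear_scaleC_iff is_dw_def)
    qed (use 0 lin in \<open>auto simp: linear_scaleC_iff\<close>)
  qed
  then have "\<exists>!D. is_dw q n z w i D" using ex_dw[OF assms] by blast
  then show ?thesis unfolding dw_def is_dw_def[symmetric] by (rule theI')
qed

end

lemma q_laplacian_dz_dw:
  assumes "q \<noteq> 0" "\<forall>k::nat. k > 0 \<longrightarrow> q ^ k \<noteq> 1" "is_q_algebra q n z w"
  shows "q_laplacian q n z w (dz q n z w) (dw q n z w)"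
  using assms is_q_algebra_relations is_dz_dz is_dw_dw
  by (intro q_laplacian.intro q_laplacian_axioms.intro) auto

theorem proposition10:
  fixes q :: complex and n m m' s s' :: nat
    and z w :: "nat \<Rightarrow> 'a::complex_algebra_1" and h :: 'a
  assumes q_nonzero: "q \<noteq> 0"
    and q_not_root_of_unity: "\<forall>k::nat. k > 0 \<longrightarrow> q ^ k \<noteq> 1"
    and n_ge_2: "n \<ge> 2"
    and algebra: "is_q_algebra q n z w"
    and s_le: "s \<le> m"
    and s'_le: "s' \<le> m'"
    and h_harmonic: "h \<in> harmonic q n (n - 1) z w (int s) (int s')"
  shows "z n ^ (m - s) * w n ^ (m' - s') * h \<in> bihom n z w (int m) (int m') \<and>
    (m - s \<ge> m' - s' \<longrightarrow>
      harm_proj q n z w (int m) (int m') (z n ^ (m - s) * w n ^ (m' - s') * h) =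
        z n ^ ((m - s) - (m' - s')) *
        ((q powi (- 2 * int (m - s) * int (m' - s')) *
          (qpoch (q powi (- 2 * int m' - 2 * int s - 2 * int n + 4)) (q\<^sup>2) (m' - s') /
           qpoch (q powi (- 2 * int m - 2 * int m' - 2 * int n + 4)) (q\<^sup>2) (m' - s'))) *\<^sub>C
         phi21_hom (m' - s')
           (q powi (- 2 * int (m' - s')))
           (q powi (2 * (int m + int s' + int n - 1)))
           (q powi (2 * (int s + int s' + int n - 1)))
           (q\<^sup>2) (q\<^sup>2) (Qsum (n - 1) z w) (Qsum n z w)) * h) \<and>
    (m - s \<le> m' - s' \<longrightarrow>
      harm_proj q n z w (int m) (int m') (z n ^ (m - s) * w n ^ (m' - s') * h) =
        ((q powi (- 2 * int (m - s) * int (m' - s')) *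
          (qpoch (q powi (- 2 * int m - 2 * int s' - 2 * int n + 4)) (q\<^sup>2) (m - s) /
           qpoch (q powi (- 2 * int m - 2 * int m' - 2 * int n + 4)) (q\<^sup>2) (m - s))) *\<^sub>C
         phi21_hom (m - s)
           (q powi (- 2 * int (m - s)))
           (q powi (2 * (int m' + int s + int n - 1)))
           (q powi (2 * (int s + int s' + int n - 1)))
           (q\<^sup>2) (q\<^sup>2) (Qsum (n - 1) z w) (Qsum n z w)) *
        w n ^ ((m' - s') - (m - s)) * h)"
proof (intro conjI impI)
  interpret q_laplacian q n z w "dz q n z w" "dw q n z w"
    by (rule q_laplacian_dz_dw[OF q_nonzero q_not_root_of_unity algebra])
  have Lap: "qLaplace q n k z w = Lap k" for k
    by (simp add: fun_eq_iff qLaplace_def Lap_def)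
  define k where "k = n - 1"
  have n: "n = Suc k" "1 \<le> k" "n - 1 = k" "1 \<le> n" "k \<le> n" using n_ge_2 by (auto simp: k_def)
  have h: "h \<in> hom k (int s) (int s')" "Lap k h = 0"
    using h_harmonic[unfolded n(3)] by (simp_all add: harmonic_def Lap)
  \<comment> \<open>A candidate that is harmonic and differs from \<open>p\<close> by a multiple of
    \<open>Q n\<close> satisfies the description; injectivity of the Laplacian after multiplication
    by \<open>Q n\<close> makes it the only one.\<close>
  have proj: "harm_proj q n z w c d p = f"
    if "f \<in> hom n c d" "Lap n f = 0" "\<exists>G \<in> hom n (c - 1) (d - 1). p = f + Q n * G" for c d p f
    unfolding harm_proj_def
  proof (rule the_equality)
    show "f \<in> harmonic q n n z w c d \<and> (\<exists>g\<in>hom n (c - 1) (d - 1). p = f + Q n * g)"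
      using that by (simp add: harmonic_def Lap)
    fix f' assume "f' \<in> harmonic q n n z w c d \<and> (\<exists>g\<in>hom n (c - 1) (d - 1). p = f' + Q n * g)"
    then show "f' = f"
      using that harmonic_decomposition_unique[OF n(4)] by (auto simp: harmonic_def Lap)
  qed
  show "z n ^ (m - s) * w n ^ (m' - s') * h \<in> bihom n z w (int m) (int m')"
    using hom_mult[OF order_refl hom_mult[OF order_refl
        hom_power[OF order_refl z_hom[OF n(4) order_refl order_refl], of "m - s"]
        hom_power[OF order_refl w_hom[OF n(4) order_refl order_refl], of "m' - s'"]]
      bihom_mono[OF n(5) h(1)]] s_le s'_le by (simp add: of_nat_diff)
  {
    assume le: "m - s \<ge> m' - s'"
    define N where "N = m' - s'"
    define b where "b = (m - s) - N"
    have mm: "m = b + N + s" "m' = N + s'" "m - s = b + N" "m' - s' = N"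
      using le s_le s'_le by (auto simp: N_def b_def)
    note * = projection_z[OF n(1,2) _ _ h, where N = N and b = b]
    \<comment> \<open>The exponents of the theorem in terms of N, b and \<sigma> = s + s' + n - 1;
      after this rewriting the scalar is literally \<open>proj_const\<close>.\<close>
    have e: "- 2 * int (b + N) * int N = - 2 * (int b + int N) * int N"
      "- 2 * int m' - 2 * int s - 2 * int n + 4 = - 2 * (int s + int s' + int n - 1 + int N - 1)"
      "- 2 * int m - 2 * int m' - 2 * int n + 4 =
        - 2 * (int s + int s' + int n - 1 + int b + int N + int N - 1)"
      "int m + int s' + int n - 1 = int s + int s' + int n - 1 + int b + int N"
      by (simp_all add: mm algebra_simps)
    show "harm_proj q n z w (int m) (int m') (z n ^ (m - s) * w n ^ (m' - s') * h) =
        z n ^ ((m - s) - (m' - s')) *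
        ((q powi (- 2 * int (m - s) * int (m' - s')) *
          (qpoch (q powi (- 2 * int m' - 2 * int s - 2 * int n + 4)) (q\<^sup>2) (m' - s') /
           qpoch (q powi (- 2 * int m - 2 * int m' - 2 * int n + 4)) (q\<^sup>2) (m' - s'))) *\<^sub>C
         phi21_hom (m' - s')
           (q powi (- 2 * int (m' - s')))
           (q powi (2 * (int m + int s' + int n - 1)))
           (q powi (2 * (int s + int s' + int n - 1)))
           (q\<^sup>2) (q\<^sup>2) (Qsum (n - 1) z w) (Qsum n z w)) * h"
      unfolding mm(3,4) n(3) e proj_const_def[symmetric] add_diff_cancel_right'
      by (rule proj) (use * in \<open>simp_all add: mm(1,2) ac_simps\<close>)
  next
    assume le: "m - s \<le> m' - s'"
    define N where "N = m - s"
    define b where "b = (m' - s') - N"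
    have mm: "m = N + s" "m' = N + b + s'" "m - s = N" "m' - s' = N + b"
      using le s_le s'_le by (auto simp: N_def b_def)
    note * = projection_w[OF n(1,2) _ _ h, where N = N and b = b]
    have e: "- 2 * int N * int (N + b) = - 2 * (int b + int N) * int N"
      "- 2 * int m - 2 * int s' - 2 * int n + 4 = - 2 * (int s + int s' + int n - 1 + int N - 1)"
      "- 2 * int m - 2 * int m' - 2 * int n + 4 =
        - 2 * (int s + int s' + int n - 1 + int b + int N + int N - 1)"
      "int m' + int s + int n - 1 = int s + int s' + int n - 1 + int b + int N"
      by (simp_all add: mm algebra_simps)
    show "harm_proj q n z w (int m) (int m') (z n ^ (m - s) * w n ^ (m' - s') * h) =
        ((q powi (- 2 * int (m - s) * int (m' - s')) *
          (qpoch (q powi (- 2 * int m - 2 * int s' - 2 * int n + 4)) (q\<^sup>2) (m - s) /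
           qpoch (q powi (- 2 * int m - 2 * int m' - 2 * int n + 4)) (q\<^sup>2) (m - s))) *\<^sub>C
         phi21_hom (m - s)
           (q powi (- 2 * int (m - s)))
           (q powi (2 * (int m' + int s + int n - 1)))
           (q powi (2 * (int s + int s' + int n - 1)))
           (q\<^sup>2) (q\<^sup>2) (Qsum (n - 1) z w) (Qsum n z w)) *
        w n ^ ((m' - s') - (m - s)) * h"
      unfolding mm(3,4) n(3) e proj_const_def[symmetric] add_diff_cancel_left'
      by (rule proj) (use * in \<open>simp_all add: mm(1,2) ac_simps\<close>)
  }
qed

end
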